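(* Let $x(t)$ evolve by the ODE $\frac{\mathrm d}{\mathrm dt}x=f(x)$, $x(0)=x_0$, where $f:\mathbb R^n\to\mathbb R^n$ is a vector of real polynomials and $\mathcal B=\{x\in\mathbb R^n: g_i(x)\ge0,\ i=1,\dots,I,\ h_j(x)=0,\ j=1,\dots,J\}$, with given $g_i,h_j\in\mathbb R[x]$, is a semialgebraic set that is forward invariant. For $k\in\{1,\dots,n\}$ let $\Phi_k(x,z^k)=(z^k)^{\mathsf T}Df^{[k]}(x)z^k$ and $\ell_k(x,z^k)=Df^{[k]}(x)z^k-\Phi_k(x,z^k)z^k$. Let $\Sigma^\Omega$ be the quadratic module for the set $\Omega=\mathcal B\times\mathbb S^{\binom nk-1}\subset\mathbb R^n\times\mathbb R^{\binom nk}$, specified by the constraints $g_i(x)\ge0$, $h_j(x)=0$ and the equality $|z^k|^2-1=0$. 1. Suppose each trajectory $x(t)$ in $\mathcal B$ is bounded for $t\ge0$. For each $k\in\{1,\dots,n\}$ and each pair $(\nu,\nu')$ of polynomial degrees, $$\sup_{x_0\in\mathcal B}M_k(x_0)\le C_1(k,\nu,\nu'),$$ where $$C_1(k,\nu,\nu')=\inf_{B\in\mathbb R,\ V\in\mathbb R[x,z^k]_\nu}B\quad\text{s.t.}\quad B-\Phi_k-f\cdot D_xV-\ell_k\cdot D_{z^k}V\in\Sigma^\Omega_{\nu'}.$$ 2. Suppose $\mathcal B$ is compact and its semialgebraic specification is Archimedean. Then, for each $k$, $$\sup_{x_0\in\mathcal B}M_k(x_0)=\inf_{\nu,\nu'\in\mathbb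 Z_{\ge}}C_1(k,\nu,\nu').$$
   Context: Forward invariant means trajectories starting in $\mathcal B$ remain in $\mathcal B$ for all $t\ge0$. $Df(x)$ is the $n\times n$ Jacobian. $\mathbb S^{m-1}=\{z\in\mathbb R^m:|z|=1\}$. $\mathbb Z_\ge$ is the set of nonnegative integers. $\mathbb R[\cdot]_\nu$ denotes real polynomials of total degree at most $\nu$. $D_xV,D_{z^k}V$ are gradients. An infimum over an empty set is $+\infty$. The case $\mathcal B=\mathbb R^n$ corresponds to there being no $g_i$ or $h_j$. For a set $\Omega$ specified by polynomial constraints $g_i\ge0$ ($i=1,\dots,I$) and $h_j=0$ ($j=1,\dots,J$), its quadratic module is $$\Sigma^\Omega=\Big\{\sigma_0+\sum_i\sigma_ig_i+\sum_j\rho_jh_j:\ \sigma_i\in\Sigma\ (i=0,\dots,I),\ \rho_j\text{ real polynomials}\Big\},$$ where $\Sigma$ is the set of polynomials that are sums of squares of polynomials; $\Sigma^\Omega_{\nu'}$ is the subset in which all $\sigma_i$ and $\rho_j$ can be chosen with degree at most $\nu'$. The specification is Archimedean if $R^2-|x|^2$ belongs to the quadratic module for some constant $R$. For $A\in\mathbb R^{n\times n}$, the $k$th multiplicative compound $A^{(k)}\in\mathbb R^{\binom nk\times\binom nk}$ is the matrix of all $k\times k$ minors of $A$, rows and columns indexed by increasing $k$-tuples from $\{1,\dots,n\}$ in lexicographic order. The $k$th additive compound is $A^{[k]}=\frac{\mathrm d}{\mathrm d\delta}(I+\delta A)^{(k)}\big|_{\delta=0}$. $Df^{[k]}(x)$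 denotes the $k$th additive compound of $Df(x)$. Along a trajectory $x(t)$ from $x_0$, let $y^k(t)\in\mathbb R^{\binom nk}$ solve $\frac{\mathrm d}{\mathrm dt}y^k=Df^{[k]}(x(t))\,y^k$, $y^k(0)=y^k_0$. The sum of the $k$ leading Lyapunov exponents is $$M_k(x_0)=\sup_{y_0^k\in\mathbb S^{\binom nk-1}}\ \limsup_{t\to\infty}\frac1t\log|y^k(t)|.$$ *)

theory Defs
  imports
    "HOL-Analysis.Analysis"
    "HOL-Library.List_Lexorder"
    "Jordan_Normal_Form.Determinant"
begin

no_notation Matrix.vec_index (infixl "$" 100)
no_notation Matrix.scalar_prod (infix "\<bullet>" 70)

text \<open>
  The notation \<open>real^'i\<close> would constrain every unannotated \<open>'i\<close> to class \<open>finite\<close> only.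
\<close>

type_synonym 'i rvec = "(real, 'i) Finite_Cartesian_Product.vec"
type_synonym 'i rmat = "('i rvec, 'i) Finite_Cartesian_Product.vec"

text \<open>
  A real polynomial on a Euclidean space is identified with the function it induces, which is
  harmless over the infinite field of reals. The library predicates
  \<^const>\<open>real_polynomial_function\<close> and \<^const>\<open>polynomial_function\<close> are used when no
  bound on the degree is imposed.
\<close>

definition polys_upto :: "nat \<Rightarrow> ('a::euclidean_space \<Rightarrow> real) set" where
  "polys_upto \<nu> = {p. \<exists>(S :: ('a \<Rightarrow> nat) set) c. finite S \<and> (\<forall>\<alpha>\<in>S. (\<Sum>b\<in>Basis. \<alpha> b) \<le> \<nu>) \<and>
      p = (\<lambda>w. \<Sum>\<alpha>\<in>S. c \<alpha> * (\<Prod>b\<in>Basis. (w \<bullet> b) ^ \<alpha> b))}"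

definition sos :: "('a::euclidean_space \<Rightarrow> real) set" where
  "sos = {p. \<exists>qs. (\<forall>q\<in>set qs. real_polynomial_function q) \<and> p = (\<lambda>w. \<Sum>q\<leftarrow>qs. (q w)\<^sup>2)}"

text \<open>
  A semialgebraic specification is a list \<open>gs\<close> of inequality constraints \<open>g \<ge> 0\<close> together with
  a list \<open>hs\<close> of equality constraints \<open>h = 0\<close>. In \<open>qm_combination\<close>, \<open>\<sigma> 0\<close> is the free
  sum of squares, and \<open>\<sigma> (Suc i)\<close> multiplies the entry of \<open>gs\<close> at the (zero-based) position \<open>i\<close>.
\<close>

definition semialgebraic_set ::
  "('a::euclidean_space \<Rightarrow> real) list \<Rightarrow> ('a \<Rightarrow> real) list \<Rightarrow> 'a set" where
  "semialgebraic_set gs hs = {x. (\<forall>g\<in>set gs. g x \<ge> 0) \<and> (\<forall>h\<in>set hs. h x = 0)}"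

definition qm_combination ::
  "('a \<Rightarrow> real) list \<Rightarrow> ('a \<Rightarrow> real) list \<Rightarrow> (nat \<Rightarrow> 'a \<Rightarrow> real) \<Rightarrow> (nat \<Rightarrow> 'a \<Rightarrow> real) \<Rightarrow> 'a \<Rightarrow> real"
where
  "qm_combination gs hs \<sigma> \<rho> = (\<lambda>w. \<sigma> 0 w + (\<Sum>i<length gs. \<sigma> (Suc i) w * (gs ! i) w)
      + (\<Sum>j<length hs. \<rho> j w * (hs ! j) w))"

definition quadratic_module ::
  "('a::euclidean_space \<Rightarrow> real) list \<Rightarrow> ('a \<Rightarrow> real) list \<Rightarrow> ('a \<Rightarrow> real) set" where
  "quadratic_module gs hs = {qm_combination gs hs \<sigma> \<rho> | \<sigma> \<rho>.
      (\<forall>i\<le>length gs. \<sigma> i \<in> sos) \<and> (\<forall>j<length hs. real_polynomial_function (\<rho> j))}"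

definition quadratic_module_upto ::
  "nat \<Rightarrow> ('a::euclidean_space \<Rightarrow> real) list \<Rightarrow> ('a \<Rightarrow> real) list \<Rightarrow> ('a \<Rightarrow> real) set" where
  "quadratic_module_upto \<nu> gs hs = {qm_combination gs hs \<sigma> \<rho> | \<sigma> \<rho>.
      (\<forall>i\<le>length gs. \<sigma> i \<in> sos \<inter> polys_upto \<nu>) \<and> (\<forall>j<length hs. \<rho> j \<in> polys_upto \<nu>)}"

definition archimedean_spec ::
  "('a::euclidean_space \<Rightarrow> real) list \<Rightarrow> ('a \<Rightarrow> real) list \<Rightarrow> bool" where
  "archimedean_spec gs hs \<longleftrightarrow> (\<exists>R::real. (\<lambda>x. R\<^sup>2 - (norm x)\<^sup>2) \<in> quadratic_module gs hs)"

text \<open>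
  The coordinates of the \<open>k\<close>th compound are indexed by a linearly ordered type \<open>'m\<close> with
  \<open>CARD('m) = CARD('n) choose k\<close>; its \<open>r\<close>th element stands for the \<open>r\<close>th increasing
  \<open>k\<close>-tuple over \<open>'n\<close> in the lexicographic order. The ordered type \<open>'n\<close> plays the role
  of \<open>{1,\<dots>,n}\<close>.
\<close>

definition increasing_tuples :: "nat \<Rightarrow> 'n::{finite,linorder} list set" where
  "increasing_tuples k = {xs. length xs = k \<and> sorted_wrt (<) xs}"

definition ktuple :: "nat \<Rightarrow> 'm::{finite,linorder} \<Rightarrow> 'n::{finite,linorder} list" where
  "ktuple k r = sorted_list_of_set (increasing_tuples k) ! card {s. s < r}"

definition mult_compound ::
  "nat \<Rightarrow> 'n::{finite,linorder} rmat \<Rightarrow> 'm::{finite,linorder} rmat" where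
  "mult_compound k A = (\<chi> r s. Determinant.det
      (Matrix.mat k k (\<lambda>(a, b). A $ (ktuple k r ! a) $ (ktuple k s ! b))))"

definition add_compound ::
  "nat \<Rightarrow> 'n::{finite,linorder} rmat \<Rightarrow> 'm::{finite,linorder} rmat" where
  "add_compound k A =
     vector_derivative (\<lambda>\<delta>. mult_compound k (Finite_Cartesian_Product.mat 1 + \<delta> *\<^sub>R A)) (at 0)"

definition jac_compound ::
  "nat \<Rightarrow> ('n::{finite,linorder} rvec \<Rightarrow> 'n rvec) \<Rightarrow> 'n rvec \<Rightarrow> 'm::{finite,linorder} rmat" where
  "jac_compound k f x = add_compound k (jacobian f (at x))"

text \<open>
  \<open>trajectory f x0 T x\<close> says that \<open>x\<close> solves the initial value problem on \<open>[0, T)\<close>, where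
  \<open>T = \<infinity>\<close> is allowed. Quantifying over all \<open>T\<close> takes account of solutions that might blow
  up in finite time: \<open>bounded_trajectories\<close> excludes them, so that under this hypothesis every
  trajectory starting in the set exists for all \<open>t \<ge> 0\<close>.
\<close>

definition trajectory ::
  "('a::real_normed_vector \<Rightarrow> 'a) \<Rightarrow> 'a \<Rightarrow> ereal \<Rightarrow> (real \<Rightarrow> 'a) \<Rightarrow> bool" where
  "trajectory f x0 T x \<longleftrightarrow> x 0 = x0 \<and>
     (\<forall>t\<ge>0. ereal t < T \<longrightarrow> (x has_vector_derivative f (x t)) (at t within {0..}))"

definition forward_invariant :: "('a::real_normed_vector \<Rightarrow> 'a) \<Rightarrow> 'a set \<Rightarrow> bool" where
  "forward_invariant f S \<longleftrightarrow>
     (\<forall>x0\<in>S. \<forall>T x. trajectory f x0 T x \<longrightarrow> (\<forall>t\<ge>0. ereal t < T \<longrightarrow> x t \<in> S))"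

definition bounded_trajectories :: "('a::real_normed_vector \<Rightarrow> 'a) \<Rightarrow> 'a set \<Rightarrow> bool" where
  "bounded_trajectories f S \<longleftrightarrow>
     (\<forall>x0\<in>S. \<forall>T x. trajectory f x0 T x \<longrightarrow> bounded (x ` {t. 0 \<le> t \<and> ereal t < T}))"

text \<open>
  The argument of type \<open>'m itself\<close> fixes the space in which \<open>y\<close> and \<open>z\<close> live. When the
  trajectory of \<open>x0\<close> exists for all \<open>t \<ge> 0\<close>, it is unique, and so is \<open>y\<close> for each initial value
  on the unit sphere; the supremum below is then the one over initial values.
\<close>

definition lyapunov_sum ::
  "'m::{finite,linorder} itself \<Rightarrow> nat \<Rightarrow> ('n::{finite,linorder} rvec \<Rightarrow> 'n rvec) \<Rightarrow> 'n rvec \<Rightarrow> ereal"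
where
  "lyapunov_sum _ k f x0 =
     Sup {Limsup at_top (\<lambda>t. ereal (1 / t * ln (norm (y t)))) | x (y :: real \<Rightarrow> 'm rvec).
       trajectory f x0 \<infinity> x \<and> y 0 \<in> sphere 0 1 \<and>
       (\<forall>t\<ge>0. (y has_vector_derivative jac_compound k f (x t) *v y t) (at t within {0..}))}"

definition grad :: "('a::real_inner \<Rightarrow> real) \<Rightarrow> 'a \<Rightarrow> 'a" where
  "grad F x = (THE D. GDERIV F x :> D)"

definition \<Phi> ::
  "nat \<Rightarrow> ('n::{finite,linorder} rvec \<Rightarrow> 'n rvec) \<Rightarrow> 'n rvec \<Rightarrow> 'm::{finite,linorder} rvec \<Rightarrow> real" where
  "\<Phi> k f x z = z \<bullet> (jac_compound k f x *v z)"

definition ell ::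
  "nat \<Rightarrow> ('n::{finite,linorder} rvec \<Rightarrow> 'n rvec) \<Rightarrow> 'n rvec \<Rightarrow> 'm::{finite,linorder} rvec \<Rightarrow> 'm rvec" where
  "ell k f x z = jac_compound k f x *v z - \<Phi> k f x z *\<^sub>R z"

text \<open>
  The constraints below specify \<open>semialgebraic_set gs hs \<times> sphere 0 1\<close>. Since the infimum
  is taken in \<^typ>\<open>ereal\<close>, it is \<open>\<infinity>\<close> if no pair \<open>(B, V)\<close> is feasible.
\<close>

definition \<Omega>_ineqs :: "('a \<Rightarrow> real) list \<Rightarrow> ('a \<times> 'b \<Rightarrow> real) list" where
  "\<Omega>_ineqs gs = map (\<lambda>g w. g (fst w)) gs"

definition \<Omega>_eqs :: "('a \<Rightarrow> real) list \<Rightarrow> ('a \<times> 'b::real_normed_vector \<Rightarrow> real) list" where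
  "\<Omega>_eqs hs = map (\<lambda>h w. h (fst w)) hs @ [\<lambda>w. (norm (snd w))\<^sup>2 - 1]"

definition C1 ::
  "'m::{finite,linorder} itself \<Rightarrow> ('n::{finite,linorder} rvec \<Rightarrow> 'n rvec) \<Rightarrow>
   ('n rvec \<Rightarrow> real) list \<Rightarrow> ('n rvec \<Rightarrow> real) list \<Rightarrow> nat \<Rightarrow> nat \<Rightarrow> nat \<Rightarrow> ereal"
where
  "C1 _ f gs hs k \<nu> \<nu>' = Inf {ereal B | B (V :: 'n rvec \<times> 'm rvec \<Rightarrow> real).
     V \<in> polys_upto \<nu> \<and>
     (\<lambda>(x, z). B - \<Phi> k f x z - f x \<bullet> grad (\<lambda>x'. V (x', z)) x - ell k f x z \<bullet> grad (\<lambda>z'. V (x, z')) z)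
       \<in> quadratic_module_upto \<nu>' (\<Omega>_ineqs gs) (\<Omega>_eqs hs)}"

end

(*
  Along a solution y of the k-th compound equation, z = y/|y| obeys z' = ell(x, z) and ln|y| grows
  at rate Phi(x, z), so M_k is the largest long-time average of Phi over the projected flow on
  Omega. Integrating the polynomial constraint along this flow gives the bound by C1.

  Conversely, let b exceed all long-time averages. By compactness the averages of Phi over [0, T]
  are at most b + O(1/T), uniformly on Omega. The function V(w) = int_0^T (1 - t/T) Phi(flow_t w) dt
  satisfies Phi + F . DV = (1/T) int_0^T Phi(flow_t w) dt, where F = (f, ell). Replacing the flow by
  Euler iterates w -> w + h F(w) makes V a polynomial at the cost of an O(h) error, so neither
  differentiability of the flow nor polynomial approximation is needed. Putinar's Positivstellensatz
  then certifies that b - Phi - F . DV lies in the quadratic module. It is proved by subtracting an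
  element of the module that makes the polynomial positive on a large cube, and expanding the
  result in Bernstein polynomials, whose factors lie in the preorder of R^2 - |x|^2.
*)

theory Submission
  imports Defs
begin

section \<open>Polynomials of bounded degree\<close>

text \<open>The weight \<open>1 - t/T\<close> comes from integration by parts. Along the flow,
  \<open>V\<close> changes at the rate \<open>int_0^T (1 - t/T) (d/dt) Phi(flow_t w) dt\<close>; a
  weight that is 1 at time 0 and falls linearly to 0 at \<open>T\<close> turns this into
  \<open>- Phi(w)\<close> plus the plain mean.

  The obstacle is uniformity. A limsup below \<open>b\<close> gives for each starting point only
  some time at which its average is below \<open>b\<close>. Each such time also works on a
  neighbourhood, a finite subcover bounds the times from both sides, and a long trajectory is cut
  into such pieces; the last incomplete piece causes the bounded excess. Continuity in the starting
  point is again read off the Euler iterates, which are uniformly close to the true solutions.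

  Two strict gaps are spent: from the supremum to \<open>b\<close>, which yields these times, and
  from \<open>b\<close> to \<open>b'\<close>, which absorbs the errors in \<open>T\<close> and
  \<open>h\<close> and leaves the strict positivity that the Positivstellensatz requires. There a
  preorder is harmless, because for a single generator it is the quadratic module itself: the square
  of the generator is a square.\<close>

lemma polys_upto_mono:
  assumes "\<nu> \<le> \<nu>'"
  shows "polys_upto \<nu> \<subseteq> polys_upto \<nu>'"
  unfolding polys_upto_def using assms by (auto intro: order_trans)

text \<open>Sums and products of polynomials generate the same exponent several times, while the
  definition indexes the terms by the exponents themselves. Adding the coefficients over each fibre
  of \<open>e\<close> removes the repetitions.\<close>

lemma polys_uptoI:
  fixes e :: "'i \<Rightarrow> 'a::euclidean_space \<Rightarrow> nat"
  assumes "finite I" and "\<And>i. i \<in> I \<Longrightarrow> (\<Sum>b\<in>Basis. e i b) \<le> \<nu>"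
  shows "(\<lambda>w. \<Sum>i\<in>I. c i * (\<Prod>b\<in>Basis. (w \<bullet> b) ^ e i b)) \<in> polys_upto \<nu>"
proof -
  have "(\<lambda>w. \<Sum>i\<in>I. c i * (\<Prod>b\<in>Basis. (w \<bullet> b) ^ e i b))
      = (\<lambda>w. \<Sum>\<alpha>\<in>e ` I. (\<Sum>i\<in>{i \<in> I. e i = \<alpha>}. c i) * (\<Prod>b\<in>Basis. (w \<bullet> b) ^ \<alpha> b))"
  proof
    fix w
    show "(\<Sum>i\<in>I. c i * (\<Prod>b\<in>Basis. (w \<bullet> b) ^ e i b))
      = (\<Sum>\<alpha>\<in>e ` I. (\<Sum>i\<in>{i \<in> I. e i = \<alpha>}. c i) * (\<Prod>b\<in>Basis. (w \<bullet> b) ^ \<alpha> b))"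
      by (subst sum.image_gen[OF assms(1), of _ e]) (simp add: sum_distrib_right)
  qed
  then show ?thesis
    unfolding polys_upto_def using assms by (intro CollectI exI[of _ "e ` I"] exI) auto
qed

lemma polys_uptoE:
  assumes "p \<in> polys_upto \<nu>"
  obtains S :: "('a::euclidean_space \<Rightarrow> nat) set" and c where "finite S"
    and "\<And>\<alpha>. \<alpha> \<in> S \<Longrightarrow> (\<Sum>b\<in>Basis. \<alpha> b) \<le> \<nu>"
    and "p = (\<lambda>w. \<Sum>\<alpha>\<in>S. c \<alpha> * (\<Prod>b\<in>Basis. (w \<bullet> b) ^ \<alpha> b))"
  using assms unfolding polys_upto_def by blast

lemma polys_upto_const: "(\<lambda>w::'a::euclidean_space. c) \<in> polys_upto \<nu>"
  using polys_uptoI[of "{()}" "\<lambda>_ _. 0" \<nu> "\<lambda>_. c"] by simp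

lemma polys_upto_linear:
  fixes f :: "'a::euclidean_space \<Rightarrow> real"
  assumes "bounded_linear f"
  shows "f \<in> polys_upto 1"
proof -
  have "f = (\<lambda>w. \<Sum>i\<in>Basis. f i * (\<Prod>b\<in>Basis. (w \<bullet> b) ^ (if b = i then 1 else 0)))"
  proof
    fix w :: 'a
    have "f w = f (\<Sum>i\<in>Basis. (w \<bullet> i) *\<^sub>R i)"
      by (simp add: euclidean_representation)
    also have "\<dots> = (\<Sum>i\<in>Basis. (w \<bullet> i) * f i)"
      using assms by (simp add: linear_sum bounded_linear.linear linear_scale)
    also have "\<dots> = (\<Sum>i\<in>Basis. f i * (\<Prod>b\<in>Basis. (w \<bullet> b) ^ (if b = i then 1 else 0)))"
      by (intro sum.cong refl) (simp add: if_distrib[of "\<lambda>n. _ ^ n"] prod.delta mult.commute cong: if_cong)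
    finally show "f w = \<dots>" .
  qed
  also have "\<dots> \<in> polys_upto 1"
    by (rule polys_uptoI) (auto simp: sum.delta)
  finally show ?thesis .
qed

lemma polys_upto_add:
  fixes p q :: "'a::euclidean_space \<Rightarrow> real"
  assumes "p \<in> polys_upto \<nu>" and "q \<in> polys_upto \<nu>"
  shows "(\<lambda>w. p w + q w) \<in> polys_upto \<nu>"
proof -
  obtain S c where S: "finite S" "\<And>\<alpha>. \<alpha> \<in> S \<Longrightarrow> (\<Sum>b\<in>Basis. \<alpha> b) \<le> \<nu>"
    "p = (\<lambda>w. \<Sum>\<alpha>\<in>S. c \<alpha> * (\<Prod>b\<in>Basis. (w \<bullet> b) ^ \<alpha> b))"
    using assms(1) by (rule polys_uptoE) blast
  obtain S' c' where S': "finite S'" "\<And>\<alpha>. \<alpha> \<in> S' \<Longrightarrow> (\<Sum>b\<in>Basis. \<alpha> b) \<le> \<nu>"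
    "q = (\<lambda>w. \<Sum>\<alpha>\<in>S'. c' \<alpha> * (\<Prod>b\<in>Basis. (w \<bullet> b) ^ \<alpha> b))"
    using assms(2) by (rule polys_uptoE) blast
  \<comment> \<open>The disjoint sum keeps the two coefficient families apart even where
    \<open>S\<close> and \<open>S'\<close> share exponents.\<close>
  have "(\<lambda>w. p w + q w) = (\<lambda>w. \<Sum>i\<in>S <+> S'. case_sum c c' i * (\<Prod>b\<in>Basis. (w \<bullet> b) ^ case_sum (\<lambda>\<alpha>. \<alpha>) (\<lambda>\<alpha>. \<alpha>) i b))"
    using S(1) S'(1) by (simp add: S(3) S'(3) sum.Plus)
  also have "\<dots> \<in> polys_upto \<nu>"
    by (rule polys_uptoI) (use S S' in auto)
  finally show ?thesis .
qed

lemma polys_upto_mult: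
  fixes p q :: "'a::euclidean_space \<Rightarrow> real"
  assumes "p \<in> polys_upto \<nu>" and "q \<in> polys_upto \<mu>"
  shows "(\<lambda>w. p w * q w) \<in> polys_upto (\<nu> + \<mu>)"
proof -
  obtain S c where S: "finite S" "\<And>\<alpha>. \<alpha> \<in> S \<Longrightarrow> (\<Sum>b\<in>Basis. \<alpha> b) \<le> \<nu>"
    "p = (\<lambda>w. \<Sum>\<alpha>\<in>S. c \<alpha> * (\<Prod>b\<in>Basis. (w \<bullet> b) ^ \<alpha> b))"
    using assms(1) by (rule polys_uptoE) blast
  obtain S' c' where S': "finite S'" "\<And>\<alpha>. \<alpha> \<in> S' \<Longrightarrow> (\<Sum>b\<in>Basis. \<alpha> b) \<le> \<mu>"
    "q = (\<lambda>w. \<Sum>\<alpha>\<in>S'. c' \<alpha> * (\<Prod>b\<in>Basis. (w \<bullet> b) ^ \<alpha> b))"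
    using assms(2) by (rule polys_uptoE) blast
  have "(\<lambda>w. p w * q w) = (\<lambda>w. \<Sum>i\<in>S \<times> S'. (c (fst i) * c' (snd i)) * (\<Prod>b\<in>Basis. (w \<bullet> b) ^ (fst i b + snd i b)))"
    unfolding S(3) S'(3) sum_product sum.cartesian_product
    by (intro ext sum.cong) (auto simp: power_add prod.distrib)
  also have "\<dots> \<in> polys_upto (\<nu> + \<mu>)"
    by (rule polys_uptoI) (use S S' in \<open>auto simp: sum.distrib intro: add_mono\<close>)
  finally show ?thesis .
qed

lemma real_polynomial_function_imp_polys_upto:
  fixes p :: "'a::euclidean_space \<Rightarrow> real"
  assumes "real_polynomial_function p"
  shows "\<exists>\<nu>. p \<in> polys_upto \<nu>"
  using assms
proof induction
  case (linear f)
  then show ?case using polys_upto_linear by blast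
next
  case (const c)
  then show ?case using polys_upto_const by blast
next
  case (add f g)
  then obtain \<nu> \<mu> where "f \<in> polys_upto \<nu>" "g \<in> polys_upto \<mu>" by blast
  then have "f \<in> polys_upto (max \<nu> \<mu>)" "g \<in> polys_upto (max \<nu> \<mu>)"
    using polys_upto_mono[of \<nu> "max \<nu> \<mu>"] polys_upto_mono[of \<mu> "max \<nu> \<mu>"] by auto
  then show ?case using polys_upto_add by blast
next
  case (mult f g)
  then show ?case using polys_upto_mult by blast
qed

lemma polys_upto_imp_real_polynomial_function:
  fixes p :: "'a::euclidean_space \<Rightarrow> real"
  assumes "p \<in> polys_upto \<nu>"
  shows "real_polynomial_function p"
proof -
  obtain S c where S: "finite S" "\<And>\<alpha>. \<alpha> \<in> S \<Longrightarrow> (\<Sum>b\<in>Basis. \<alpha> b) \<le> \<nu>"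
    "p = (\<lambda>w. \<Sum>\<alpha>\<in>S. c \<alpha> * (\<Prod>b\<in>Basis. (w \<bullet> b) ^ \<alpha> b))"
    using assms by (rule polys_uptoE) blast
  show ?thesis
    unfolding S(3)
    by (intro real_polynomial_function_sum real_polynomial_function.intros(2-4)
        real_polynomial_function_prod real_polynomial_function_power
        real_polynomial_function.intros(1) S bounded_linear_inner_left finite_Basis)
qed

text \<open>That the gradient field is again polynomial serves twice: it makes the constraint in
  \<open>C1\<close> a polynomial to which the Positivstellensatz applies, and it yields bounds and
  Lipschitz constants on balls.\<close>

lemma real_polynomial_function_gderiv:
  fixes p :: "'a::euclidean_space \<Rightarrow> real"
  assumes "real_polynomial_function p"
  shows "\<exists>G. polynomial_function G \<and> (\<forall>x. GDERIV p x :> G x)"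
  using assms
proof induction
  case (linear f)
  have "f h = h \<bullet> (\<Sum>b\<in>Basis. f b *\<^sub>R b)" for h
  proof -
    have "f h = f (\<Sum>i\<in>Basis. (h \<bullet> i) *\<^sub>R i)"
      by (simp add: euclidean_representation)
    also have "\<dots> = (\<Sum>i\<in>Basis. (h \<bullet> i) * f i)"
      using linear by (simp add: linear_sum bounded_linear.linear linear_scale)
    finally show ?thesis by (simp add: inner_sum_right mult.commute)
  qed
  then have "f = (\<lambda>h. h \<bullet> (\<Sum>b\<in>Basis. f b *\<^sub>R b))" ..
  moreover have "FDERIV f x :> f" for x
    using linear by (rule bounded_linear_imp_has_derivative) 
  ultimately have "\<forall>x. GDERIV f x :> (\<Sum>b\<in>Basis. f b *\<^sub>R b)"
    unfolding gderiv_def by metis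
  then show ?case
    by (intro exI[of _ "\<lambda>_. \<Sum>b\<in>Basis. f b *\<^sub>R b"]) auto
next
  case (const c)
  then show ?case by (intro exI[of _ "\<lambda>_. 0"]) (auto simp: GDERIV_const)
next
  case (add f g)
  then obtain F G where "polynomial_function F" "\<forall>x. GDERIV f x :> F x"
    "polynomial_function G" "\<forall>x. GDERIV g x :> G x" by blast
  then show ?case
    by (intro exI[of _ "\<lambda>x. F x + G x"]) (auto intro: GDERIV_add)
next
  case (mult f g)
  then obtain F G where "polynomial_function F" "\<forall>x. GDERIV f x :> F x"
    "polynomial_function G" "\<forall>x. GDERIV g x :> G x" by blast
  then show ?case using mult
    by (intro exI[of _ "\<lambda>x. f x *\<^sub>R G x + g x *\<^sub>R F x"])
      (auto intro!: GDERIV_mult polynomial_function_add polynomial_function_mult simp: real_polynomial_function_eq[symmetric])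
qed

lemma grad_eq:
  assumes "GDERIV p x :> D"
  shows "grad p x = D"
  unfolding grad_def
proof (rule the_equality)
  fix D' assume "GDERIV p x :> D'"
  then have "(\<lambda>h. h \<bullet> D') = (\<lambda>h. h \<bullet> D)"
    using assms unfolding gderiv_def by (rule has_derivative_unique)
  then show "D' = D"
    by (metis inner_commute vector_eq_ldot)
qed (rule assms)

section \<open>Quadratic modules\<close>

lemma sos_square:
  assumes "real_polynomial_function q"
  shows "(\<lambda>w. (q w)\<^sup>2) \<in> sos"
  unfolding sos_def using assms by (intro CollectI exI[of _ "[q]"]) auto

lemma sos_const:
  assumes "0 \<le> c"
  shows "(\<lambda>_. c) \<in> sos"
  using sos_square[of "\<lambda>_. sqrt c"] assms by (simp add: real_polynomial_function.intros)

lemma sos_add: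
  assumes "p \<in> sos" and "q \<in> sos"
  shows "(\<lambda>w. p w + q w) \<in> sos"
proof -
  obtain ps qs where "\<forall>q\<in>set ps. real_polynomial_function q" "p = (\<lambda>w. \<Sum>q\<leftarrow>ps. (q w)\<^sup>2)"
    "\<forall>q\<in>set qs. real_polynomial_function q" "q = (\<lambda>w. \<Sum>q\<leftarrow>qs. (q w)\<^sup>2)"
    using assms unfolding sos_def by blast
  then show ?thesis
    unfolding sos_def by (intro CollectI exI[of _ "ps @ qs"]) auto
qed

lemma sos_sum:
  assumes "\<And>i. i \<in> I \<Longrightarrow> p i \<in> sos"
  shows "(\<lambda>w. \<Sum>i\<in>I. p i w) \<in> sos"
  using assms by (induction I rule: infinite_finite_induct) (auto intro: sos_const sos_add)

lemma sos_mult: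
  assumes "p \<in> sos" and "q \<in> sos"
  shows "(\<lambda>w. p w * q w) \<in> sos"
proof -
  obtain ps qs where ps: "\<forall>q\<in>set ps. real_polynomial_function q" "p = (\<lambda>w. \<Sum>q\<leftarrow>ps. (q w)\<^sup>2)"
    and qs: "\<forall>q\<in>set qs. real_polynomial_function q" "q = (\<lambda>w. \<Sum>q\<leftarrow>qs. (q w)\<^sup>2)"
    using assms unfolding sos_def by blast
  have single: "(\<lambda>w. (a w)\<^sup>2 * (\<Sum>q\<leftarrow>qs. (q w)\<^sup>2)) \<in> sos" if "real_polynomial_function a" for a
    unfolding sos_def
    using that qs(1)
    by (intro CollectI exI[of _ "map (\<lambda>b w. a w * b w) qs"])
      (auto simp: sum_list_const_mult[symmetric] power_mult_distrib o_def intro: real_polynomial_function.intros)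
  have "(\<lambda>w. (\<Sum>q\<leftarrow>ps. (q w)\<^sup>2) * (\<Sum>q\<leftarrow>qs. (q w)\<^sup>2)) \<in> sos"
    using ps(1)
  proof (induction ps)
    case Nil
    then show ?case by (simp add: sos_const)
  next
    case (Cons a ps)
    then show ?case
      using sos_add[OF single[of a]] by (simp add: distrib_right)
  qed
  then show ?thesis using ps qs by simp
qed

lemma sos_imp_real_polynomial_function:
  assumes "p \<in> sos"
  shows "real_polynomial_function p"
proof -
  obtain ps where "\<forall>q\<in>set ps. real_polynomial_function q" "p = (\<lambda>w. \<Sum>q\<leftarrow>ps. (q w)\<^sup>2)"
    using assms unfolding sos_def by blast
  moreover have "real_polynomial_function (\<lambda>w. \<Sum>q\<leftarrow>ps. (q w)\<^sup>2)"
    if "\<forall>q\<in>set ps. real_polynomial_function q" for ps :: "('a \<Rightarrow> real) list"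
    using that by (induction ps) (auto intro: real_polynomial_function.intros)
  ultimately show ?thesis by blast
qed

lemma sos_nonneg: "p \<in> sos \<Longrightarrow> 0 \<le> p w"
  unfolding sos_def by (auto intro!: sum_list_nonneg)

lemma quadratic_moduleI:
  assumes "\<And>i. i \<le> length gs \<Longrightarrow> \<sigma> i \<in> sos"
    and "\<And>j. j < length hs \<Longrightarrow> real_polynomial_function (\<rho> j)"
    and "\<And>w. p w = \<sigma> 0 w + (\<Sum>i<length gs. \<sigma> (Suc i) w * (gs ! i) w)
      + (\<Sum>j<length hs. \<rho> j w * (hs ! j) w)"
  shows "p \<in> quadratic_module gs hs"
proof -
  have "p = qm_combination gs hs \<sigma> \<rho>"
    unfolding qm_combination_def using assms(3) by blast
  then show ?thesis unfolding quadratic_module_def using assms(1,2) by blast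
qed

lemma quadratic_moduleE:
  assumes "p \<in> quadratic_module gs hs"
  obtains \<sigma> \<rho> where "\<And>i. i \<le> length gs \<Longrightarrow> \<sigma> i \<in> sos"
    and "\<And>j. j < length hs \<Longrightarrow> real_polynomial_function (\<rho> j)"
    and "\<And>w. p w = \<sigma> 0 w + (\<Sum>i<length gs. \<sigma> (Suc i) w * (gs ! i) w)
      + (\<Sum>j<length hs. \<rho> j w * (hs ! j) w)"
  using assms unfolding quadratic_module_def qm_combination_def by blast

lemma sos_subset_quadratic_module:
  assumes "p \<in> sos"
  shows "p \<in> quadratic_module gs hs"
  by (rule quadratic_moduleI[where \<sigma> = "\<lambda>i. if i = 0 then p else (\<lambda>_. 0)" and \<rho> = "\<lambda>_ _. 0"])
    (use assms in \<open>auto intro: sos_const real_polynomial_function.intros(2)\<close>)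

lemma ineq_in_quadratic_module:
  assumes "g \<in> set gs"
  shows "g \<in> quadratic_module gs hs"
proof -
  obtain k where k: "k < length gs" "gs ! k = g"
    using assms by (auto simp: in_set_conv_nth)
  show ?thesis
    by (rule quadratic_moduleI[where \<sigma> = "\<lambda>i _. if i = Suc k then 1 else 0" and \<rho> = "\<lambda>_ _. 0"])
      (use k in \<open>auto intro: sos_const real_polynomial_function.intros
        simp: if_distrib[of "\<lambda>c. c * _"] sum.delta cong: if_cong\<close>)
qed

lemma eq_in_quadratic_module:
  assumes "h \<in> set hs" and "real_polynomial_function \<rho>"
  shows "(\<lambda>w. \<rho> w * h w) \<in> quadratic_module gs hs"
proof -
  obtain k where k: "k < length hs" "hs ! k = h"
    using assms by (auto simp: in_set_conv_nth)
  have *: "(\<Sum>j<length hs. (if j = k then \<rho> w else 0) * (hs ! j) w) = \<rho> w * h w" for w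
    using k by (simp add: if_distrib[of "\<lambda>c. c * _"] sum.delta cong: if_cong)
  have "real_polynomial_function (\<lambda>w. if j = k then \<rho> w else 0)" for j
    using assms(2) by (cases "j = k") (auto intro: real_polynomial_function.intros)
  with * show ?thesis
    by (intro quadratic_moduleI[where \<sigma> = "\<lambda>i _. 0" and \<rho> = "\<lambda>j w. if j = k then \<rho> w else 0"])
      (auto intro: sos_const)
qed

lemma quadratic_module_add:
  assumes "p \<in> quadratic_module gs hs" and "q \<in> quadratic_module gs hs"
  shows "(\<lambda>w. p w + q w) \<in> quadratic_module gs hs"
proof -
  obtain \<sigma> \<rho> where 1: "\<And>i. i \<le> length gs \<Longrightarrow> \<sigma> i \<in> sos"
    "\<And>j. j < length hs \<Longrightarrow> real_polynomial_function (\<rho> j)"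
    "\<And>w. p w = \<sigma> 0 w + (\<Sum>i<length gs. \<sigma> (Suc i) w * (gs ! i) w)
      + (\<Sum>j<length hs. \<rho> j w * (hs ! j) w)"
    using assms(1) by (rule quadratic_moduleE) blast
  obtain \<sigma>' \<rho>' where 2: "\<And>i. i \<le> length gs \<Longrightarrow> \<sigma>' i \<in> sos"
    "\<And>j. j < length hs \<Longrightarrow> real_polynomial_function (\<rho>' j)"
    "\<And>w. q w = \<sigma>' 0 w + (\<Sum>i<length gs. \<sigma>' (Suc i) w * (gs ! i) w)
      + (\<Sum>j<length hs. \<rho>' j w * (hs ! j) w)"
    using assms(2) by (rule quadratic_moduleE) blast
  show ?thesis
    by (rule quadratic_moduleI[where \<sigma> = "\<lambda>i w. \<sigma> i w + \<sigma>' i w" and \<rho> = "\<lambda>j w. \<rho> j w + \<rho>' j w"])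
      (use 1 2 in \<open>auto intro: sos_add real_polynomial_function.intros simp: distrib_right sum.distrib\<close>)
qed

lemma quadratic_module_mult:
  assumes "s \<in> sos" and "p \<in> quadratic_module gs hs"
  shows "(\<lambda>w. s w * p w) \<in> quadratic_module gs hs"
proof -
  obtain \<sigma> \<rho> where 1: "\<And>i. i \<le> length gs \<Longrightarrow> \<sigma> i \<in> sos"
    "\<And>j. j < length hs \<Longrightarrow> real_polynomial_function (\<rho> j)"
    "\<And>w. p w = \<sigma> 0 w + (\<Sum>i<length gs. \<sigma> (Suc i) w * (gs ! i) w)
      + (\<Sum>j<length hs. \<rho> j w * (hs ! j) w)"
    using assms(2) by (rule quadratic_moduleE) blast
  show ?thesis
    by (rule quadratic_moduleI[where \<sigma> = "\<lambda>i w. s w * \<sigma> i w" and \<rho> = "\<lambda>j w. s w * \<rho> j w"])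
      (use 1 assms(1) in \<open>auto intro: sos_mult real_polynomial_function.intros sos_imp_real_polynomial_function
        simp: distrib_left sum_distrib_left mult.assoc\<close>)
qed

lemma quadratic_module_sum:
  assumes "\<And>i. i \<in> I \<Longrightarrow> p i \<in> quadratic_module gs hs"
  shows "(\<lambda>w. \<Sum>i\<in>I. p i w) \<in> quadratic_module gs hs"
  using assms
  by (induction I rule: infinite_finite_induct)
    (auto intro: sos_const sos_subset_quadratic_module quadratic_module_add)

text \<open>Only finitely many multipliers occur, so the maximum of their degree bounds serves all
  of them. This lets the infimum over \<open>\<nu>'\<close> reach every element of the full
  module.\<close>

lemma quadratic_module_imp_upto:
  assumes "p \<in> quadratic_module gs hs"
  shows "\<exists>\<nu>. p \<in> quadratic_module_upto \<nu> gs hs"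
proof -
  obtain \<sigma> \<rho> where p: "p = qm_combination gs hs \<sigma> \<rho>"
    "\<forall>i\<le>length gs. \<sigma> i \<in> sos" "\<forall>j<length hs. real_polynomial_function (\<rho> j)"
    using assms unfolding quadratic_module_def by blast
  have "\<exists>\<nu>. \<forall>q\<in>Q. q \<in> polys_upto \<nu>" if "finite Q" "\<forall>q\<in>Q. real_polynomial_function q"
    for Q :: "('a \<Rightarrow> real) set"
    using that
  proof (induction Q)
    case (insert q Q)
    then obtain \<nu> \<mu> where "\<forall>q\<in>Q. q \<in> polys_upto \<nu>" "q \<in> polys_upto \<mu>"
      using real_polynomial_function_imp_polys_upto[of q] by auto
    then have "\<forall>q\<in>insert q Q. q \<in> polys_upto (max \<nu> \<mu>)"
      using polys_upto_mono[of \<nu> "max \<nu> \<mu>"] polys_upto_mono[of \<mu> "max \<nu> \<mu>"] by auto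
    then show ?case by blast
  qed simp
  moreover have "\<forall>q\<in>\<sigma> ` {..length gs} \<union> \<rho> ` {..<length hs}. real_polynomial_function q"
    using p(2,3) by (auto intro: sos_imp_real_polynomial_function)
  ultimately obtain \<nu> where "\<forall>q\<in>\<sigma> ` {..length gs} \<union> \<rho> ` {..<length hs}. q \<in> polys_upto \<nu>"
    by (meson finite_UnI finite_atMost finite_imageI finite_lessThan)
  then have "p \<in> quadratic_module_upto \<nu> gs hs"
    using p unfolding quadratic_module_upto_def
    by (intro CollectI exI[of _ \<sigma>] exI[of _ \<rho>]) auto
  then show ?thesis ..
qed

lemma quadratic_module_upto_nonneg:
  assumes "p \<in> quadratic_module_upto \<nu> gs hs" and "w \<in> semialgebraic_set gs hs"
  shows "0 \<le> p w"
proof -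
  obtain \<sigma> \<rho> where p: "p = qm_combination gs hs \<sigma> \<rho>" "\<forall>i\<le>length gs. \<sigma> i \<in> sos"
    using assms(1) unfolding quadratic_module_upto_def by blast
  have "0 \<le> \<sigma> 0 w + (\<Sum>i<length gs. \<sigma> (Suc i) w * (gs ! i) w)"
    using sos_nonneg[of "\<sigma> _" w] p(2) assms(2) unfolding semialgebraic_set_def
    by (intro add_nonneg_nonneg sum_nonneg mult_nonneg_nonneg) auto
  moreover have "(\<Sum>j<length hs. \<rho> j w * (hs ! j) w) = 0"
    using assms(2) unfolding semialgebraic_set_def by (intro sum.neutral) auto
  ultimately show ?thesis unfolding p(1) qm_combination_def by simp
qed

section \<open>Positivity on a compact set modulo the constraints\<close>

lemma mult_one_minus_power_le:
  fixes t :: real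
  assumes "t \<le> 1" and "0 < n"
  shows "t * (1 - t) ^ n \<le> 1 / n"
proof (cases "0 \<le> t")
  case True
  \<comment> \<open>Bernoulli replaces \<open>1 + n * t\<close> by \<open>(1 + t) ^ n\<close>, and
    the product with \<open>(1 - t) ^ n\<close> collapses to a power of \<open>1 - t^2\<close>,
    which is at most 1.\<close>
  have "(1 - t) ^ n * (1 + n * t) \<le> (1 - t) ^ n * (1 + t) ^ n"
    using assms True Bernoulli_inequality[of t n] by (intro mult_left_mono) auto
  also have "\<dots> = (1 - t\<^sup>2) ^ n"
    by (simp add: power_mult_distrib[symmetric] power2_eq_square algebra_simps)
  also have "\<dots> \<le> 1"
    using assms True by (intro power_le_one) (auto simp: abs_square_le_1)
  finally have "(1 - t) ^ n * (1 + n * t) \<le> 1" .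
  moreover have "0 \<le> (1 - t) ^ n" using assms by simp
  ultimately have "n * (t * (1 - t) ^ n) \<le> 1" by (simp add: algebra_simps)
  then show ?thesis using assms by (simp add: field_simps)
next
  case False
  then have "t * (1 - t) ^ n \<le> 0" using assms by (simp add: mult_nonpos_nonneg)
  also have "0 \<le> 1 / real n" by simp
  finally show ?thesis .
qed

text \<open>
  The terms \<open>(1 - g)\<^sup>2\<^sup>k g\<close> are uniformly small where \<open>0 \<le> g \<le> 1\<close>, but remain below
  \<open>g\<close> where \<open>g < 0\<close>; a large multiple of them therefore repairs \<open>p\<close> outside the semialgebraic
  set without spoiling it inside.
\<close>

lemma positive_on_compact_modulo_scaled:
  fixes G :: "('a::euclidean_space \<Rightarrow> real) set"
  assumes "finite G" and "compact C"
    and G: "\<And>g. g \<in> G \<Longrightarrow> continuous_on C g" "\<And>g x. g \<in> G \<Longrightarrow> x \<in> C \<Longrightarrow> g x \<le> 1"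
    and p: "continuous_on C p" "\<And>x. x \<in> C \<Longrightarrow> (\<forall>g\<in>G. 0 \<le> g x) \<Longrightarrow> 0 < p x"
  shows "\<exists>c k. 0 \<le> c \<and> (\<forall>x\<in>C. 0 < p x - c * (\<Sum>g\<in>G. (1 - g x) ^ (2 * k) * g x))"
proof (cases "C = {}")
  case False
  \<comment> \<open>\<open>\<psi>\<close> is positive on \<open>C\<close>: where all constraints
    hold \<open>p\<close> is positive, and elsewhere some negative part is. Compactness turns this
    into a uniform margin.\<close>
  define \<psi> where "\<psi> = (\<lambda>x. max 0 (p x) + (\<Sum>g\<in>G. max 0 (- g x)))"
  have "continuous_on C \<psi>"
    unfolding \<psi>_def using G(1) p(1) by (intro continuous_intros) auto
  from continuous_attains_inf[OF \<open>compact C\<close> False this]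
  obtain x0 where x0: "x0 \<in> C" "\<And>x. x \<in> C \<Longrightarrow> \<psi> x0 \<le> \<psi> x" by blast
  have "0 < \<psi> x0"
  proof (cases "\<forall>g\<in>G. 0 \<le> g x0")
    case True
    then have "0 < p x0" using p(2) x0 by blast
    then show ?thesis unfolding \<psi>_def by (intro add_pos_nonneg sum_nonneg) auto
  next
    case False
    then have "0 < (\<Sum>g\<in>G. max 0 (- g x0))"
      using \<open>finite G\<close> False by (auto intro!: sum_pos2)
    then show ?thesis unfolding \<psi>_def by (intro add_nonneg_pos) auto
  qed
  \<comment> \<open>Half of the minimum is shared among the \<open>1 + card G\<close> summands of
    \<open>\<psi>\<close>, so they cannot all be at most \<open>\<delta>\<close>.\<close>
  define \<delta> where "\<delta> = \<psi> x0 / (2 * (1 + real (card G)))"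
  have \<delta>: "0 < \<delta>" "(1 + real (card G)) * \<delta> = \<psi> x0 / 2"
    using \<open>0 < \<psi> x0\<close> unfolding \<delta>_def by (auto simp: field_simps)
  have dich: "\<delta> \<le> p x \<or> (\<exists>g\<in>G. g x \<le> - \<delta>)" if "x \<in> C" for x
  proof (rule ccontr)
    assume "\<not> ?thesis"
    then have "\<psi> x \<le> \<delta> + (\<Sum>g\<in>G. \<delta>)"
      unfolding \<psi>_def using \<open>0 < \<delta>\<close> by (intro add_mono sum_mono) (auto simp: not_le max_def less_imp_le)
    also have "\<dots> = (1 + real (card G)) * \<delta>" by (simp add: distrib_right)
    finally show False using x0(2)[OF that] \<delta>(2) \<open>0 < \<psi> x0\<close> by linarith
  qed
  have "bounded (p ` C)" using p(1) \<open>compact C\<close> by (intro compact_imp_bounded compact_continuous_image)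
  then obtain P where P: "\<And>x. x \<in> C \<Longrightarrow> \<bar>p x\<bar> \<le> P" unfolding bounded_iff real_norm_def by blast
  have "0 \<le> P" using P[OF x0(1)] by linarith
  \<comment> \<open>One constraint violated by \<open>\<delta>\<close> then outweighs the lowest
    possible value \<open>- P\<close> of \<open>p\<close> with \<open>1 + \<delta>\<close> to spare;
    the \<open>\<delta>\<close> pays for the terms of the other constraints.\<close>
  define c where "c = (P + 1 + \<delta>) / \<delta>"
  have c: "0 < c" "c * \<delta> = P + 1 + \<delta>" unfolding c_def using \<open>0 \<le> P\<close> \<open>0 < \<delta>\<close> by auto
  \<comment> \<open>\<open>k\<close> is chosen after \<open>c\<close>, since it has to make even
    \<open>c\<close> times the sum of the small terms less than \<open>\<delta>\<close>.\<close>
  obtain k :: nat where k: "c * real (card G) / \<delta> < real k" using reals_Archimedean2 by blast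
  moreover have "0 \<le> c * real (card G) / \<delta>" using c \<open>0 < \<delta>\<close> by simp
  ultimately have "0 < k" by (metis le_less_trans of_nat_0_less_iff)
  have small: "c * (real (card G) / (2 * k)) < \<delta>"
  proof -
    have "c * real (card G) < \<delta> * real k"
      using k \<open>0 < \<delta>\<close> by (simp add: pos_divide_less_eq mult.commute)
    moreover have "0 < \<delta> * real k" using \<open>0 < \<delta>\<close> \<open>0 < k\<close> by simp
    ultimately have "c * real (card G) < \<delta> * (2 * real k)" by linarith
    then show ?thesis using \<open>0 < k\<close> by (simp add: pos_divide_less_eq)
  qed
  have "0 < p x - c * (\<Sum>g\<in>G. (1 - g x) ^ (2 * k) * g x)" if "x \<in> C" for x
  proof -
    have tm: "(1 - g x) ^ (2 * k) * g x \<le> 1 / real (2 * k)" if "g \<in> G" for g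
      using mult_one_minus_power_le[of "g x" "2 * k"] G(2)[OF that \<open>x \<in> C\<close>] \<open>0 < k\<close>
      by (simp add: mult.commute)
    from dich[OF that] show ?thesis
    proof
      assume "\<delta> \<le> p x"
      have "(\<Sum>g\<in>G. (1 - g x) ^ (2 * k) * g x) \<le> (\<Sum>g\<in>G. 1 / real (2 * k))"
        by (intro sum_mono tm)
      then have "c * (\<Sum>g\<in>G. (1 - g x) ^ (2 * k) * g x) \<le> c * (real (card G) / (2 * k))"
        using c by (intro mult_left_mono) auto
      then show ?thesis using small \<open>\<delta> \<le> p x\<close> by linarith
    next
      assume "\<exists>g\<in>G. g x \<le> - \<delta>"
      then obtain g where g: "g \<in> G" "g x \<le> - \<delta>" by blast
      have "1 \<le> (1 - g x) ^ (2 * k)" using g \<open>0 < \<delta>\<close> by (intro one_le_power) auto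
      then have "(1 - g x) ^ (2 * k) * g x \<le> 1 * g x"
        using g \<open>0 < \<delta>\<close> by (intro mult_right_mono_neg) auto
      then have "(1 - g x) ^ (2 * k) * g x \<le> - \<delta>" using g by simp
      moreover have "(\<Sum>g\<in>G - {g}. (1 - g x) ^ (2 * k) * g x) \<le> (\<Sum>g\<in>G - {g}. 1 / real (2 * k))"
        by (intro sum_mono tm) auto
      moreover have "(\<Sum>g\<in>G - {g}. 1 / real (2 * k)) \<le> (\<Sum>g\<in>G. 1 / real (2 * k))"
        using \<open>finite G\<close> by (intro sum_mono2) auto
      ultimately have "(\<Sum>g\<in>G. (1 - g x) ^ (2 * k) * g x) \<le> - \<delta> + real (card G) / (2 * k)"
        using \<open>finite G\<close> g by (simp add: sum.remove[of G g])
      then have "c * (\<Sum>g\<in>G. (1 - g x) ^ (2 * k) * g x) \<le> c * (- \<delta> + real (card G) / (2 * k))"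
        using c by (intro mult_left_mono) auto
      then have "c * (\<Sum>g\<in>G. (1 - g x) ^ (2 * k) * g x) \<le> - (c * \<delta>) + c * (real (card G) / real (2 * k))"
        by (simp only: distrib_left mult_minus_right)
      then show ?thesis using small P[OF that] c(2) by linarith
    qed
  qed
  then show ?thesis using c by (intro exI[of _ c] exI[of _ k]) auto
qed (intro exI[of _ 0] exI[of _ 0], auto)

text \<open>A common rescaling brings all constraints below 1 on \<open>C\<close>. The multipliers
  remain even powers, and the factor \<open>d\<close> left on each constraint is moved into
  \<open>c\<close>.\<close>

lemma positive_on_compact_modulo:
  fixes G :: "('a::euclidean_space \<Rightarrow> real) set"
  assumes "finite G" and "compact C"
    and G: "\<And>g. g \<in> G \<Longrightarrow> continuous_on C g"
    and p: "continuous_on C p" "\<And>x. x \<in> C \<Longrightarrow> (\<forall>g\<in>G. 0 \<le> g x) \<Longrightarrow> 0 < p x"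
  shows "\<exists>c d k. 0 \<le> c \<and> 0 \<le> d \<and> (\<forall>x\<in>C. 0 < p x - c * (\<Sum>g\<in>G. (1 - d * g x) ^ (2 * k) * g x))"
proof -
  have "\<exists>K. \<forall>g\<in>G. \<forall>x\<in>C. g x \<le> K"
    using assms(1) G
  proof (induction G)
    case (insert g G)
    then obtain K where "\<forall>g\<in>G. \<forall>x\<in>C. g x \<le> K" by auto
    moreover have "bounded (g ` C)"
      using insert.prems \<open>compact C\<close> by (intro compact_imp_bounded compact_continuous_image) auto
    then obtain K' where "\<forall>x\<in>C. g x \<le> K'" unfolding bounded_iff by (auto dest: abs_le_D1)
    ultimately have "\<forall>g\<in>insert g G. \<forall>x\<in>C. g x \<le> max K K'" by (auto simp: le_max_iff_disj)
    then show ?case by blast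
  qed simp
  then obtain K where K: "\<And>g x. g \<in> G \<Longrightarrow> x \<in> C \<Longrightarrow> g x \<le> K" by blast
  \<comment> \<open>The maximum with 1 keeps \<open>d\<close> positive whatever the sign of the
    bound \<open>K\<close>.\<close>
  define d where "d = 1 / max K 1"
  have d: "0 < d" unfolding d_def by simp
  have "d * g x \<le> 1" if "g \<in> G" "x \<in> C" for g x
    using K[OF that] unfolding d_def by (auto simp: field_simps)
  moreover have inj: "inj_on (\<lambda>g x. d * g x) G"
    using d by (auto simp: inj_on_def fun_eq_iff)
  moreover have "0 < p x" if "x \<in> C" "\<forall>g\<in>(\<lambda>g x. d * g x) ` G. 0 \<le> g x" for x
    using p(2)[OF that(1)] that(2) d by (auto simp: zero_le_mult_iff)
  ultimately have "\<exists>c k. 0 \<le> c \<and> (\<forall>x\<in>C. 0 < p x - c * (\<Sum>g\<in>(\<lambda>g x. d * g x) ` G. (1 - g x) ^ (2 * k) * g x))"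
    using assms(1,2) G p(1)
    by (intro positive_on_compact_modulo_scaled) (auto intro!: continuous_intros)
  then obtain c k where ck: "0 \<le> c"
    "\<And>x. x \<in> C \<Longrightarrow> 0 < p x - c * (\<Sum>g\<in>G. (1 - d * g x) ^ (2 * k) * (d * g x))"
    by (auto simp: sum.reindex[OF inj] o_def)
  have "c * (\<Sum>g\<in>G. (1 - d * g x) ^ (2 * k) * (d * g x)) = c * d * (\<Sum>g\<in>G. (1 - d * g x) ^ (2 * k) * g x)" for x
    by (simp add: sum_distrib_left mult_ac)
  with ck d show ?thesis
    by (intro exI[of _ "c * d"] exI[of _ d] exI[of _ k]) auto
qed

section \<open>Putinar's Positivstellensatz\<close>

text \<open>For \<open>k \<le> j\<close> the ratio is the product of
  \<open>(j - i) / (n - i)\<close> over \<open>i < k\<close>. Each factor lies in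
  \<open>[0, 1]\<close> and differs from \<open>j / n\<close> by at most \<open>i / n\<close>, and
  these errors add up to at most \<open>k^2 / n\<close>. By \<open>power_eq_Bernstein\<close> the
  ratio is a coefficient of the monomial \<open>s ^ k\<close> in the Bernstein basis, so these
  coefficients approach the values at the grid points \<open>j / n\<close>.\<close>

lemma choose_ratio_approx:
  assumes "k \<le> n" and "j \<le> n" and "0 < n"
  shows "\<bar>real (j choose k) / real (n choose k) - (j / n) ^ k\<bar> \<le> (real k)\<^sup>2 / n"
  using assms(1)
proof (induction k)
  case (Suc k)
  have jn: "0 \<le> real j / n" "real j / n \<le> 1" using assms by auto
  show ?case
  proof (cases "j \<le> k")
    case True
    have "(real j / n) ^ Suc k \<le> (real j / n) ^ 1" using jn by (intro power_decreasing) auto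
    also have "\<dots> \<le> real (Suc k) / n" using True by (simp add: divide_right_mono)
    also have "\<dots> \<le> (real (Suc k))\<^sup>2 / n"
      by (intro divide_right_mono) (auto simp: power2_eq_square)
    finally show ?thesis using True jn by (simp add: binomial_eq_0)
  next
    case False
    define a where "a = real (j choose k) / real (n choose k)"
    define q where "q = (real j - k) / (real n - k)"
    have kn: "k < n" using Suc.prems by simp
    have step: "real (Suc k) * real (m choose Suc k) = (real m - k) * real (m choose k)" if "k < m" for m
    proof -
      have "Suc k * (m choose Suc k) = (m - k) * (m choose k)"
        by (simp only: binomial_absorption binomial_absorb_comp)
      then have "real (Suc k * (m choose Suc k)) = real ((m - k) * (m choose k))" by simp
      then show ?thesis unfolding of_nat_mult of_nat_diff[OF less_imp_le[OF that]] .
    qed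
    have "real (Suc k) * real (j choose Suc k) / (real (Suc k) * real (n choose Suc k)) = q * a"
      unfolding step[OF kn] step[of j, OF False[unfolded not_le]] a_def q_def by simp
    then have eq: "real (j choose Suc k) / real (n choose Suc k) = q * a" by simp
    have q: "0 \<le> q" "q \<le> 1" unfolding q_def using False assms kn by auto
    have "real j / n - q = k * (real n - j) / (n * (real n - k))"
      unfolding q_def using kn by (simp add: field_simps)
    also have "\<dots> \<le> k * (real n - k) / (n * (real n - k))"
      using kn False by (intro divide_right_mono mult_left_mono) auto
    also have "\<dots> = k / n" using kn by simp
    finally have "real j / n - q \<le> k / n" .
    moreover have "0 \<le> real j / n - q"
      unfolding \<open>real j / n - q = k * (real n - j) / (n * (real n - k))\<close> using assms kn by auto
    ultimately have jq: "\<bar>q - real j / n\<bar> \<le> k / n" by linarith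
    have "q * a - (real j / n) ^ Suc k = q * (a - (real j / n) ^ k) + (real j / n) ^ k * (q - real j / n)"
      by (simp add: algebra_simps)
    also have "\<bar>\<dots>\<bar> \<le> q * \<bar>a - (real j / n) ^ k\<bar> + (real j / n) ^ k * \<bar>q - real j / n\<bar>"
      using q jn by (intro order_trans[OF abs_triangle_ineq]) (auto simp: abs_mult)
    also have "\<dots> \<le> 1 * ((real k)\<^sup>2 / n) + 1 * (k / n)"
      using Suc q jn jq unfolding a_def by (intro add_mono mult_mono power_le_one) auto
    also have "\<dots> \<le> (real (Suc k))\<^sup>2 / n"
      using assms by (simp add: field_simps power2_eq_square)
    finally show ?thesis unfolding eq .
  qed
qed simp

text \<open>Since \<open>(n choose j) * (j choose k) = (n choose k) * ((n - k) choose (j -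
  k))\<close>, the right side is \<open>s ^ k\<close> times the binomial expansion of
  \<open>(s + (1 - s)) ^ (n - k) = 1\<close>.\<close>

lemma power_eq_Bernstein:
  fixes s :: real
  assumes "k \<le> n"
  shows "s ^ k = (\<Sum>j\<le>n. (real (j choose k) / real (n choose k)) * ((n choose j) * (s ^ j * (1 - s) ^ (n - j))))"
proof -
  have "(\<Sum>j\<le>n. (real (j choose k) / real (n choose k)) * ((n choose j) * (s ^ j * (1 - s) ^ (n - j))))
      = (\<Sum>j=k..n. (real (j choose k) / real (n choose k)) * ((n choose j) * (s ^ j * (1 - s) ^ (n - j))))"
    by (intro sum.mono_neutral_right) (auto simp: binomial_eq_0)
  also have "\<dots> = (\<Sum>j=k..n. s ^ k * (((n - k) choose (j - k)) * s ^ (j - k) * (1 - s) ^ (n - k - (j - k))))"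
  proof (intro sum.cong refl)
    fix j assume j: "j \<in> {k..n}"
    have "real (n choose j) * real (j choose k) = real (n choose k) * real ((n - k) choose (j - k))"
      using choose_mult[of k j n] j by (metis atLeastAtMost_iff of_nat_mult)
    moreover have "real (n choose k) \<noteq> 0" using assms by simp
    ultimately have "real (j choose k) / real (n choose k) * real (n choose j) = real ((n - k) choose (j - k))"
      by (simp add: nonzero_eq_divide_eq mult.commute[of "real (j choose k)"])
    moreover have "s ^ j = s ^ k * s ^ (j - k)" "n - k - (j - k) = n - j"
      using j by (auto simp: power_add[symmetric])
    moreover have "real (j choose k) / real (n choose k) * ((n choose j) * (s ^ j * (1 - s) ^ (n - j)))
        = real (j choose k) / real (n choose k) * (n choose j) * (s ^ j * (1 - s) ^ (n - j))"
      by (simp only: mult.assoc)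
    ultimately show "real (j choose k) / real (n choose k) * ((n choose j) * (s ^ j * (1 - s) ^ (n - j)))
        = s ^ k * (((n - k) choose (j - k)) * s ^ (j - k) * (1 - s) ^ (n - k - (j - k)))"
      by (simp only: mult_ac)
  qed
  also have "\<dots> = s ^ k * (\<Sum>i\<le>n - k. ((n - k) choose i) * s ^ i * (1 - s) ^ (n - k - i))"
    unfolding sum_distrib_left[symmetric] using assms
    by (intro arg_cong2[of _ _ _ _ "(*)"] refl sum.reindex_bij_witness[of _ "\<lambda>i. i + k" "\<lambda>j. j - k"]) auto
  also have "\<dots> = s ^ k" using binomial_ring[of s "1 - s" "n - k"] by simp
  finally show ?thesis ..
qed

text \<open>The coefficient at \<open>j\<close> is within \<open>K / n\<close> of the value of
  \<open>q\<close> at the grid point \<open>j / n\<close> of the cube, and that value is at least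
  the positive minimum of \<open>q\<close>.\<close>

lemma Bernstein_coefficients_nonneg:
  fixes q :: "'a::euclidean_space \<Rightarrow> real"
  assumes "real_polynomial_function q" and "\<And>t. t \<in> cbox 0 One \<Longrightarrow> 0 < q t"
  shows "\<exists>n \<beta>. (\<forall>j\<in>Basis \<rightarrow>\<^sub>E {..n}. 0 \<le> \<beta> j) \<and>
    (\<forall>t. q t = (\<Sum>j\<in>Basis \<rightarrow>\<^sub>E {..n}. \<beta> j * (\<Prod>b\<in>Basis. real (n choose j b) * ((t \<bullet> b) ^ j b * (1 - t \<bullet> b) ^ (n - j b)))))"
proof -
  obtain \<nu> where "q \<in> polys_upto \<nu>" using assms(1) real_polynomial_function_imp_polys_upto by blast
  then obtain S :: "('a \<Rightarrow> nat) set" and c where S: "finite S" "\<And>\<alpha>. \<alpha> \<in> S \<Longrightarrow> (\<Sum>b\<in>Basis. \<alpha> b) \<le> \<nu>"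
    "q = (\<lambda>w. \<Sum>\<alpha>\<in>S. c \<alpha> * (\<Prod>b\<in>Basis. (w \<bullet> b) ^ \<alpha> b))"
    by (rule polys_uptoE) blast
  have deg: "\<alpha> b \<le> \<nu>" if "\<alpha> \<in> S" "b \<in> Basis" for \<alpha> b
    using member_le_sum[of b Basis \<alpha>] S(2)[OF that(1)] that(2) by auto
  have "continuous_on (cbox 0 One) q"
    using assms(1) by (simp add: real_polynomial_function_eq continuous_on_polymonial_function)
  then obtain t0 where t0: "t0 \<in> cbox 0 One" "\<And>t. t \<in> cbox 0 One \<Longrightarrow> q t0 \<le> q t"
    using continuous_attains_inf[of "cbox 0 One" q] by (auto simp: compact_cbox)
  have "0 < q t0" using assms(2) t0(1) .
  define K where "K = (\<Sum>\<alpha>\<in>S. \<bar>c \<alpha>\<bar> * (\<Sum>b\<in>Basis. (real (\<alpha> b))\<^sup>2))"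
  obtain m :: nat where m: "K / q t0 < real m" using reals_Archimedean2 by blast
  \<comment> \<open>\<open>m\<close> pushes the coefficient error below the minimum of
    \<open>q\<close>, \<open>\<nu>\<close> makes every exponent at most \<open>n\<close> as the
    Bernstein expansion of powers demands, and \<open>Suc\<close> makes \<open>n\<close>
    positive.\<close>
  define n where "n = Suc (max m \<nu>)"
  have n: "0 < n" "\<nu> \<le> n" "K / n < q t0"
  proof -
    have "K / q t0 < n" using m unfolding n_def by linarith
    then show "K / n < q t0" using \<open>0 < q t0\<close> by (simp add: n_def field_simps)
  qed (auto simp: n_def)
  define R where "R = (\<lambda>j k. real (j choose k) / real (n choose k))"
  define \<beta> where "\<beta> = (\<lambda>j. \<Sum>\<alpha>\<in>S. c \<alpha> * (\<Prod>b\<in>Basis. R (j b) (\<alpha> b)))"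
  have "0 \<le> \<beta> j" if "j \<in> Basis \<rightarrow>\<^sub>E {..n}" for j
  proof -
    have jb: "j b \<le> n" if "b \<in> Basis" for b using \<open>j \<in> _\<close> that by auto
    define t where "t = (\<Sum>b\<in>Basis. (real (j b) / n) *\<^sub>R b)"
    have tb: "t \<bullet> b = real (j b) / n" if "b \<in> Basis" for b
      unfolding t_def using that by (simp add: inner_sum_left inner_Basis if_distrib sum.delta cong: if_cong)
    have "t \<in> cbox 0 One" using jb n by (auto simp: mem_box tb)
    have "\<bar>\<beta> j - q t\<bar> = \<bar>\<Sum>\<alpha>\<in>S. c \<alpha> * ((\<Prod>b\<in>Basis. R (j b) (\<alpha> b)) - (\<Prod>b\<in>Basis. (real (j b) / n) ^ \<alpha> b))\<bar>"
      unfolding \<beta>_def S(3) by (simp add: tb sum_subtractf right_diff_distrib)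
    also have "\<dots> \<le> (\<Sum>\<alpha>\<in>S. \<bar>c \<alpha>\<bar> * ((\<Sum>b\<in>Basis. (real (\<alpha> b))\<^sup>2) / n))"
    proof (intro sum_abs[THEN order_trans] sum_mono, unfold abs_mult, intro mult_left_mono)
      fix \<alpha> assume \<alpha>: "\<alpha> \<in> S"
      have R1: "norm (R (j b) (\<alpha> b)) \<le> 1" if "b \<in> Basis" for b
        unfolding R_def using jb[OF that] deg[OF \<alpha> that] n(2)
        by (auto simp: divide_le_eq_1 intro!: binomial_right_mono)
      have J1: "norm ((real (j b) / n) ^ \<alpha> b) \<le> 1" if "b \<in> Basis" for b
        using jb[OF that] n(1) by (auto intro!: power_le_one)
      \<comment> \<open>All factors have norm at most 1, so replacing them one at a time costs only
        the sum of their differences.\<close>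
      have "norm ((\<Prod>b\<in>Basis. R (j b) (\<alpha> b)) - (\<Prod>b\<in>Basis. (real (j b) / n) ^ \<alpha> b))
          \<le> (\<Sum>b\<in>Basis. norm (R (j b) (\<alpha> b) - (real (j b) / n) ^ \<alpha> b))"
        using R1 J1 by (intro norm_prod_diff) auto
      also have "\<dots> \<le> (\<Sum>b\<in>Basis. (real (\<alpha> b))\<^sup>2 / n)"
        unfolding R_def real_norm_def using jb deg[OF \<alpha>] n
        by (intro sum_mono choose_ratio_approx) (auto intro: order_trans)
      finally show "\<bar>(\<Prod>b\<in>Basis. R (j b) (\<alpha> b)) - (\<Prod>b\<in>Basis. (real (j b) / n) ^ \<alpha> b)\<bar>
          \<le> (\<Sum>b\<in>Basis. (real (\<alpha> b))\<^sup>2) / n"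
        by (simp add: sum_divide_distrib)
    qed simp
    also have "\<dots> = K / n" unfolding K_def sum_divide_distrib[of _ S] by simp
    finally show ?thesis using n(3) t0(2)[OF \<open>t \<in> _\<close>] by linarith
  qed
  moreover have "q t = (\<Sum>j\<in>Basis \<rightarrow>\<^sub>E {..n}. \<beta> j * (\<Prod>b\<in>Basis. real (n choose j b) * ((t \<bullet> b) ^ j b * (1 - t \<bullet> b) ^ (n - j b))))" for t
  proof -
    define B where "B = (\<lambda>b j. real (n choose j) * ((t \<bullet> b) ^ j * (1 - t \<bullet> b) ^ (n - j)))"
    have "(\<Prod>b\<in>Basis. (t \<bullet> b) ^ \<alpha> b) = (\<Sum>j\<in>Basis \<rightarrow>\<^sub>E {..n}. (\<Prod>b\<in>Basis. R (j b) (\<alpha> b)) * (\<Prod>b\<in>Basis. B b (j b)))"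
      if "\<alpha> \<in> S" for \<alpha>
    proof -
      have "(\<Prod>b\<in>Basis. (t \<bullet> b) ^ \<alpha> b) = (\<Prod>b\<in>Basis. \<Sum>j\<le>n. R j (\<alpha> b) * B b j)"
        unfolding R_def B_def using deg[OF that] n(2)
        by (intro prod.cong refl power_eq_Bernstein) (auto intro: order_trans)
      also have "\<dots> = (\<Sum>j\<in>Basis \<rightarrow>\<^sub>E {..n}. \<Prod>b\<in>Basis. R (j b) (\<alpha> b) * B b (j b))"
        by (rule prod_sum_PiE) auto
      finally show ?thesis by (simp add: prod.distrib)
    qed
    then have "q t = (\<Sum>\<alpha>\<in>S. \<Sum>j\<in>Basis \<rightarrow>\<^sub>E {..n}. c \<alpha> * (\<Prod>b\<in>Basis. R (j b) (\<alpha> b)) * (\<Prod>b\<in>Basis. B b (j b)))"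
      unfolding S(3) by (simp add: sum_distrib_left mult.assoc)
    also have "\<dots> = (\<Sum>j\<in>Basis \<rightarrow>\<^sub>E {..n}. \<beta> j * (\<Prod>b\<in>Basis. B b (j b)))"
      unfolding \<beta>_def by (subst sum.swap) (simp add: sum_distrib_right)
    finally show ?thesis unfolding B_def .
  qed
  ultimately show ?thesis by blast
qed

text \<open>The Bernstein expansion is built by sums and products from nonnegative constants, the
  coordinates of \<open>u\<close> and their complements to 1. Any \<open>T\<close> closed under
  these operations therefore contains it; the algebra of squares enters only when \<open>T\<close>
  is chosen.\<close>

lemma positive_on_cube_in_semiring:
  fixes q :: "'a::euclidean_space \<Rightarrow> real" and T :: "('c \<Rightarrow> real) set"
  assumes "real_polynomial_function q" and "\<And>t. t \<in> cbox 0 One \<Longrightarrow> 0 < q t"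
    and const: "\<And>c. 0 \<le> c \<Longrightarrow> (\<lambda>_. c) \<in> T"
    and add: "\<And>f g. f \<in> T \<Longrightarrow> g \<in> T \<Longrightarrow> (\<lambda>x. f x + g x) \<in> T"
    and mult: "\<And>f g. f \<in> T \<Longrightarrow> g \<in> T \<Longrightarrow> (\<lambda>x. f x * g x) \<in> T"
    and u: "\<And>b. b \<in> Basis \<Longrightarrow> (\<lambda>x. u x \<bullet> b) \<in> T" "\<And>b. b \<in> Basis \<Longrightarrow> (\<lambda>x. 1 - u x \<bullet> b) \<in> T"
  shows "(\<lambda>x. q (u x)) \<in> T"
proof -
  obtain n \<beta> where \<beta>: "\<forall>j\<in>Basis \<rightarrow>\<^sub>E {..n}. 0 \<le> \<beta> j"
    "\<forall>t. q t = (\<Sum>j\<in>Basis \<rightarrow>\<^sub>E {..n}. \<beta> j * (\<Prod>b\<in>Basis. real (n choose j b) * ((t \<bullet> b) ^ j b * (1 - t \<bullet> b) ^ (n - j b))))"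
    using Bernstein_coefficients_nonneg[OF assms(1,2)] by blast
  have sum: "(\<lambda>x. \<Sum>i\<in>I. f i x) \<in> T" if "\<And>i. i \<in> I \<Longrightarrow> f i \<in> T" for I :: "('a \<Rightarrow> nat) set" and f
    using that by (induction I rule: infinite_finite_induct) (auto intro: const add)
  have prod: "(\<lambda>x. \<Prod>i\<in>I. f i x) \<in> T" if "\<And>i. i \<in> I \<Longrightarrow> f i \<in> T" for I :: "'a set" and f
    using that by (induction I rule: infinite_finite_induct) (auto intro: const mult)
  have power: "(\<lambda>x. f x ^ i) \<in> T" if "f \<in> T" for f i
    using that by (induction i) (auto intro: const mult)
  show ?thesis
    unfolding \<beta>(2)[rule_format] by (intro sum mult const \<beta>(1)[rule_format] prod power u) auto
qed

lemma putinar: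
  fixes gs hs :: "('a::euclidean_space \<Rightarrow> real) list"
  assumes gs: "\<And>g. g \<in> set gs \<Longrightarrow> real_polynomial_function g"
    and hs: "\<And>h. h \<in> set hs \<Longrightarrow> real_polynomial_function h"
    and "archimedean_spec gs hs"
    and p: "real_polynomial_function p" "\<And>x. x \<in> semialgebraic_set gs hs \<Longrightarrow> 0 < p x"
  shows "p \<in> quadratic_module gs hs"
proof -
  let ?M = "quadratic_module gs hs"
  obtain R where R: "(\<lambda>x. R\<^sup>2 - (norm x)\<^sup>2) \<in> ?M"
    using assms(3) unfolding archimedean_spec_def by blast
  \<comment> \<open>\<open>r\<close> is positive even if \<open>R\<close> is 0, and it makes the
    constant \<open>r^2 - R^2\<close> nonnegative in the identity behind
    \<open>Tcoord\<close>.\<close>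
  define r where "r = \<bar>R\<bar> + 1"
  have r: "0 < r" "0 \<le> r\<^sup>2 - R\<^sup>2" unfolding r_def by (auto simp: power2_eq_square algebra_simps)
  have coord: "real_polynomial_function (\<lambda>x::'a. x \<bullet> b)" for b
    by (intro real_polynomial_function.intros(1) bounded_linear_inner_left)

  \<comment> \<open>An equation \<open>h = 0\<close> enters as the inequality
    \<open>- h^2 \<ge> 0\<close>, which lies in the module with multiplier \<open>- h\<close>. All
    constraints then have the same shape.\<close>
  define G where "G = set gs \<union> (\<lambda>h x. - (h x)\<^sup>2) ` set hs"
  have Gpoly: "real_polynomial_function g" if "g \<in> G" for g
    using that gs hs unfolding G_def by (auto intro!: real_polynomial_function_minus real_polynomial_function_power)
  have GM: "g \<in> ?M" if "g \<in> G" for g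
  proof (cases "g \<in> set gs")
    case False
    then obtain h where h: "h \<in> set hs" "g = (\<lambda>x. - (h x)\<^sup>2)"
      using \<open>g \<in> G\<close> unfolding G_def by blast
    then show ?thesis
      using eq_in_quadratic_module[OF h(1), of "\<lambda>x. - h x" gs] hs[OF h(1)]
      by (auto simp: power2_eq_square)
  qed (rule ineq_in_quadratic_module)
  have semi: "x \<in> semialgebraic_set gs hs" if "\<forall>g\<in>G. 0 \<le> g x" for x
    unfolding semialgebraic_set_def
  proof safe
    fix h assume "h \<in> set hs"
    then have "(\<lambda>x. - (h x)\<^sup>2) \<in> G" unfolding G_def by blast
    from bspec[OF that this] show "h x = 0" by simp
  qed (use that in \<open>auto simp: G_def\<close>)
  have "\<exists>c d k. 0 \<le> c \<and> 0 \<le> d \<and> (\<forall>x\<in>cbox (- r *\<^sub>R One) (r *\<^sub>R One).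
      0 < p x - c * (\<Sum>g\<in>G. (1 - d * g x) ^ (2 * k) * g x))"
    using Gpoly p semi
    by (intro positive_on_compact_modulo)
      (auto simp: G_def compact_cbox real_polynomial_function_eq continuous_on_polymonial_function)
  then obtain c d k where "0 \<le> c" and pos: "\<And>x. x \<in> cbox (- r *\<^sub>R One) (r *\<^sub>R One) \<Longrightarrow>
      0 < p x - c * (\<Sum>g\<in>G. (1 - d * g x) ^ (2 * k) * g x)"
    by blast
  \<comment> \<open>Even powers make the multipliers squares, so \<open>m\<close> belongs to the
    module, while \<open>p - m\<close> is positive on the whole cube and the constraints can be
    forgotten.\<close>
  define m where "m = (\<lambda>x. c * (\<Sum>g\<in>G. ((1 - d * g x) ^ k)\<^sup>2 * g x))"
  have powpoly: "real_polynomial_function (\<lambda>w. (1 - d * g w) ^ k)" if "g \<in> G" for g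
    using Gpoly[OF that] by (intro real_polynomial_function_power real_polynomial_function_diff real_polynomial_function.intros(2,4))
  have "m \<in> ?M"
    unfolding m_def using \<open>0 \<le> c\<close> GM
    by (intro quadratic_module_mult quadratic_module_sum sos_const sos_square powpoly)
  have mpoly: "real_polynomial_function m"
    unfolding m_def
    by (intro real_polynomial_function.intros(2,4) real_polynomial_function_sum
        real_polynomial_function_power[of _ 2] powpoly Gpoly) (auto simp: G_def)
  have pm: "0 < p x - m x" if "x \<in> cbox (- r *\<^sub>R One) (r *\<^sub>R One)" for x
    using pos[OF that] by (simp add: m_def power_mult[symmetric] mult.commute[of k])

  \<comment> \<open>The quadratic module of the single generator \<open>R^2 - |x|^2\<close>. In a
    product the square of the generator is a square and goes into the first summand, so
    \<open>T\<close> is closed under multiplication.\<close>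
  define T where "T = {\<lambda>x. s x + t x * (R\<^sup>2 - (norm x)\<^sup>2) | s t :: 'a \<Rightarrow> real. s \<in> sos \<and> t \<in> sos}"
  have TI: "f \<in> T" if "s \<in> sos" "t \<in> sos" "\<And>x. f x = s x + t x * (R\<^sup>2 - (norm x)\<^sup>2)" for f s t
    using that unfolding T_def by blast
  have norm2: "(norm x)\<^sup>2 = (\<Sum>i\<in>Basis. (x \<bullet> i)\<^sup>2)" for x :: 'a
    unfolding power2_norm_eq_inner by (subst euclidean_inner) (simp add: power2_eq_square)
  have normpoly: "real_polynomial_function (\<lambda>x::'a. R\<^sup>2 - (norm x)\<^sup>2)"
    unfolding norm2
    by (intro real_polynomial_function_diff real_polynomial_function.intros(2)
        real_polynomial_function_power real_polynomial_function_sum coord finite_Basis)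
  have Tadd: "(\<lambda>x. f x + g x) \<in> T" if "f \<in> T" "g \<in> T" for f g
  proof -
    obtain s t s' t' where "s \<in> sos" "t \<in> sos" "f = (\<lambda>x. s x + t x * (R\<^sup>2 - (norm x)\<^sup>2))"
      "s' \<in> sos" "t' \<in> sos" "g = (\<lambda>x. s' x + t' x * (R\<^sup>2 - (norm x)\<^sup>2))"
      using \<open>f \<in> T\<close> \<open>g \<in> T\<close> unfolding T_def by blast
    then show ?thesis
      by (intro TI[of "\<lambda>x. s x + s' x" "\<lambda>x. t x + t' x"] sos_add) (auto simp: algebra_simps)
  qed
  have Tmult: "(\<lambda>x. f x * g x) \<in> T" if "f \<in> T" "g \<in> T" for f g
  proof -
    obtain s t s' t' where "s \<in> sos" "t \<in> sos" "f = (\<lambda>x. s x + t x * (R\<^sup>2 - (norm x)\<^sup>2))"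
      "s' \<in> sos" "t' \<in> sos" "g = (\<lambda>x. s' x + t' x * (R\<^sup>2 - (norm x)\<^sup>2))"
      using \<open>f \<in> T\<close> \<open>g \<in> T\<close> unfolding T_def by blast
    then show ?thesis
      by (intro TI[of "\<lambda>x. s x * s' x + t x * t' x * (R\<^sup>2 - (norm x)\<^sup>2)\<^sup>2" "\<lambda>x. s x * t' x + t x * s' x"]
          sos_add sos_mult sos_square normpoly) (auto simp: algebra_simps power2_eq_square)
  qed
  have Tconst: "(\<lambda>_. c) \<in> T" if "0 \<le> c" for c
    using that by (intro TI[of "\<lambda>_. c" "\<lambda>_. 0"] sos_const) auto
  \<comment> \<open>The identity is \<open>2 r (r + \<epsilon> x_b) = (r + \<epsilon> x_b)^2 + (r^2
    - R^2) + s + (R^2 - |x|^2)\<close>, where \<open>s\<close> is the sum of the squares of the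
    other coordinates; it is divided by \<open>(2 r)^2\<close>.\<close>
  have Tcoord: "(\<lambda>x. (r + \<epsilon> * (x \<bullet> b)) / (2 * r)) \<in> T" if "b \<in> Basis" "\<epsilon> = 1 \<or> \<epsilon> = -1" for b \<epsilon>
  proof (rule TI)
    have "\<epsilon>\<^sup>2 = 1" using that(2) by auto
    fix x :: 'a
    have "(norm x)\<^sup>2 = (x \<bullet> b)\<^sup>2 + (\<Sum>i\<in>Basis - {b}. (x \<bullet> i)\<^sup>2)"
      unfolding norm2 using that(1) by (simp add: sum.remove)
    moreover have "(r + \<epsilon> * (x \<bullet> b))\<^sup>2 = r\<^sup>2 + 2 * r * (\<epsilon> * (x \<bullet> b)) + (x \<bullet> b)\<^sup>2"
      using \<open>\<epsilon>\<^sup>2 = 1\<close> by (simp add: power2_sum power_mult_distrib)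
    ultimately have "2 * r * (r + \<epsilon> * (x \<bullet> b)) = (r + \<epsilon> * (x \<bullet> b))\<^sup>2
        + (r\<^sup>2 - R\<^sup>2 + (\<Sum>i\<in>Basis - {b}. (x \<bullet> i)\<^sup>2)) + (R\<^sup>2 - (norm x)\<^sup>2)"
      by (simp add: algebra_simps power2_eq_square)
    then have eq: "1 / (2 * r)\<^sup>2 * (2 * r * (r + \<epsilon> * (x \<bullet> b))) = 1 / (2 * r)\<^sup>2 * ((r + \<epsilon> * (x \<bullet> b))\<^sup>2
        + (r\<^sup>2 - R\<^sup>2 + (\<Sum>i\<in>Basis - {b}. (x \<bullet> i)\<^sup>2)) + (R\<^sup>2 - (norm x)\<^sup>2))"
      by simp
    have "1 / (2 * r)\<^sup>2 * (2 * r * y) = y / (2 * r)" for y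
      using r(1) by (simp add: power2_eq_square)
    from eq[unfolded this] show "(r + \<epsilon> * (x \<bullet> b)) / (2 * r) = 1 / (2 * r)\<^sup>2 * ((r + \<epsilon> * (x \<bullet> b))\<^sup>2
        + (r\<^sup>2 - R\<^sup>2 + (\<Sum>i\<in>Basis - {b}. (x \<bullet> i)\<^sup>2))) + 1 / (2 * r)\<^sup>2 * (R\<^sup>2 - (norm x)\<^sup>2)"
      by (simp only: distrib_left[of "1 / (2 * r)\<^sup>2" _ "R\<^sup>2 - (norm x)\<^sup>2"])
  qed (intro sos_mult sos_add sos_const sos_sum sos_square coord
      real_polynomial_function.intros(2,3,4), use r in \<open>auto intro: sos_const\<close>)

  \<comment> \<open>\<open>q\<close> is \<open>p - m\<close> in coordinates that turn the cube of
    half-width \<open>r\<close> into the unit cube, and \<open>u\<close> is the change of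
    coordinates. The coordinates of \<open>u\<close> and their complements are the two signs in
    \<open>Tcoord\<close>.\<close>
  define q where "q = (\<lambda>t::'a. p ((2 * r) *\<^sub>R t - r *\<^sub>R One) - m ((2 * r) *\<^sub>R t - r *\<^sub>R One))"
  define u where "u = (\<lambda>x::'a. (1 / (2 * r)) *\<^sub>R (x + r *\<^sub>R One))"
  have "polynomial_function (\<lambda>t::'a. (2 * r) *\<^sub>R t - r *\<^sub>R One)"
    by (intro polynomial_function_diff polynomial_function_cmul polynomial_function_id polynomial_function_const)
  then have qpoly: "real_polynomial_function q"
    unfolding q_def using p(1) mpoly real_polynomial_function_compose[unfolded o_def]
    by (intro real_polynomial_function_diff) blast+
  have qpos: "0 < q t" if "t \<in> cbox 0 One" for t
  proof -
    have "0 \<le> 2 * r * (t \<bullet> b)" "2 * r * (t \<bullet> b) \<le> 2 * r" if "b \<in> Basis" for b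
      using \<open>t \<in> _\<close> that r(1) by (auto simp: mem_box)
    then show ?thesis unfolding q_def by (intro pm) (force simp: mem_box inner_diff_left)
  qed
  have uT: "(\<lambda>x. u x \<bullet> b) \<in> T" "(\<lambda>x. 1 - u x \<bullet> b) \<in> T" if "b \<in> Basis" for b
  proof -
    have ub: "u x \<bullet> b = (x \<bullet> b + r) / (2 * r)" for x
      using that unfolding u_def by (simp add: inner_add_left)
    show "(\<lambda>x. u x \<bullet> b) \<in> T"
      using Tcoord[OF that, of 1] by (simp add: ub add.commute)
    have "1 - u x \<bullet> b = (r + (- 1) * (x \<bullet> b)) / (2 * r)" for x
      using r(1) unfolding ub by (simp add: divide_simps)
    then show "(\<lambda>x. 1 - u x \<bullet> b) \<in> T"
      using Tcoord[OF that, of "- 1"] by simp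
  qed
  have "(\<lambda>x. q (u x)) \<in> T"
    by (rule positive_on_cube_in_semiring) (fact qpoly qpos Tconst Tadd Tmult uT)+
  moreover have "(2 * r) *\<^sub>R u x - r *\<^sub>R One = x" for x
    using r(1) unfolding u_def by (simp add: scaleR_add_right)
  ultimately have "(\<lambda>x. p x - m x) \<in> T" unfolding q_def by simp
  moreover have "T \<subseteq> ?M"
    unfolding T_def using R
    by (auto intro!: quadratic_module_add quadratic_module_mult intro: sos_subset_quadratic_module)
  ultimately have "(\<lambda>x. (p x - m x) + m x) \<in> ?M"
    using \<open>m \<in> ?M\<close> by (intro quadratic_module_add) auto
  then show ?thesis by simp
qed

section \<open>Taylor estimates for polynomial maps\<close>

text \<open>The quadratic remainder comes from a Lipschitz gradient: the mean value bound, applied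
  to the components of \<open>G\<close>, controls how far the derivative varies along the segment
  from \<open>x\<close> to \<open>y\<close>.\<close>

lemma real_polynomial_function_estimates:
  fixes p :: "'a::euclidean_space \<Rightarrow> real"
  assumes "real_polynomial_function p"
  shows "\<exists>G. (\<forall>x. GDERIV p x :> G x) \<and> (\<forall>R. \<exists>L\<ge>0.
    (\<forall>x\<in>cball 0 R. norm (G x) \<le> L) \<and>
    (\<forall>x\<in>cball 0 R. \<forall>y\<in>cball 0 R. \<bar>p y - p x\<bar> \<le> L * norm (y - x)) \<and>
    (\<forall>x\<in>cball 0 R. \<forall>y\<in>cball 0 R. \<bar>p y - p x - (y - x) \<bullet> G x\<bar> \<le> L * (norm (y - x))\<^sup>2))"
proof -
  \<comment> \<open>Stated for every polynomial, since it is applied first to \<open>p\<close> and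
    then to each component of the gradient of \<open>p\<close>.\<close>
  have lip: "\<exists>G. polynomial_function G \<and> (\<forall>x. GDERIV p x :> G x) \<and> (\<forall>R. \<exists>L\<ge>0. (\<forall>x\<in>cball 0 R. norm (G x) \<le> L) \<and>
      (\<forall>x\<in>cball 0 R. \<forall>y\<in>cball 0 R. \<bar>p y - p x\<bar> \<le> L * norm (y - x)))"
    if rp: "real_polynomial_function p" for p :: "'a \<Rightarrow> real"
  proof -
    obtain G where G: "polynomial_function G" "\<And>x. GDERIV p x :> G x"
      using real_polynomial_function_gderiv[OF rp] by blast
    have "\<exists>L\<ge>0. (\<forall>x\<in>cball 0 R. norm (G x) \<le> L) \<and>
      (\<forall>x\<in>cball 0 R. \<forall>y\<in>cball 0 R. \<bar>p y - p x\<bar> \<le> L * norm (y - x))" for R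
    proof -
      have "bounded (G ` cball 0 R)"
        using G(1) by (intro compact_imp_bounded compact_continuous_image continuous_on_polymonial_function) auto
      then obtain L where L: "0 < L" "\<And>x. x \<in> cball 0 R \<Longrightarrow> norm (G x) \<le> L"
        unfolding bounded_pos by blast
      have "\<bar>p y - p x\<bar> \<le> L * norm (y - x)" if "x \<in> cball 0 R" "y \<in> cball 0 R" for x y
      proof -
        have "norm (p y - p x) \<le> L * norm (y - x)"
        proof (rule differentiable_bound[of "cball 0 R"])
          fix x :: 'a assume x: "x \<in> cball 0 R"
          show "(p has_derivative (\<lambda>h. h \<bullet> G x)) (at x within cball 0 R)"
            using G(2)[of x] unfolding gderiv_def by (rule has_derivative_at_withinI)
          show "onorm (\<lambda>h. h \<bullet> G x) \<le> L"
          proof (rule onorm_le)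
            fix h
            have "norm (h \<bullet> G x) \<le> norm h * norm (G x)" using Cauchy_Schwarz_ineq2 by simp
            also have "\<dots> \<le> norm h * L" using L(2)[OF x] by (intro mult_left_mono) auto
            finally show "norm (h \<bullet> G x) \<le> L * norm h" by (simp add: mult.commute)
          qed
        qed (use that in auto)
        then show ?thesis by simp
      qed
      then show ?thesis using L by (intro exI[of _ L]) auto
    qed
    then show ?thesis using G by blast
  qed
  from lip[OF assms] obtain G where G: "polynomial_function G" "\<And>x. GDERIV p x :> G x"
    and G_lip: "\<And>R. \<exists>L\<ge>0. (\<forall>x\<in>cball 0 R. norm (G x) \<le> L) \<and>
      (\<forall>x\<in>cball 0 R. \<forall>y\<in>cball 0 R. \<bar>p y - p x\<bar> \<le> L * norm (y - x))"
    by blast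
  have "\<exists>L\<ge>0. (\<forall>x\<in>cball 0 R. norm (G x) \<le> L) \<and>
    (\<forall>x\<in>cball 0 R. \<forall>y\<in>cball 0 R. \<bar>p y - p x\<bar> \<le> L * norm (y - x)) \<and>
    (\<forall>x\<in>cball 0 R. \<forall>y\<in>cball 0 R. \<bar>p y - p x - (y - x) \<bullet> G x\<bar> \<le> L * (norm (y - x))\<^sup>2)" for R
  proof -
    have "\<exists>L\<ge>0. \<forall>x\<in>cball 0 R. \<forall>y\<in>cball 0 R. \<bar>G y \<bullet> b - G x \<bullet> b\<bar> \<le> L * norm (y - x)"
      if "b \<in> Basis" for b
      using lip[of "\<lambda>x. G x \<bullet> b"] G(1) that unfolding polynomial_function_iff_Basis_inner by blast
    then obtain l where l: "\<And>b. b \<in> Basis \<Longrightarrow> 0 \<le> l b"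
      "\<And>b x y. b \<in> Basis \<Longrightarrow> x \<in> cball 0 R \<Longrightarrow> y \<in> cball 0 R \<Longrightarrow> \<bar>G y \<bullet> b - G x \<bullet> b\<bar> \<le> l b * norm (y - x)"
      by metis
    define M where "M = sum l Basis"
    have "0 \<le> M" unfolding M_def using l(1) by (intro sum_nonneg)
    have GL: "norm (G y - G x) \<le> M * norm (y - x)" if "x \<in> cball 0 R" "y \<in> cball 0 R" for x y
    proof -
      have "norm (G y - G x) \<le> (\<Sum>b\<in>Basis. \<bar>(G y - G x) \<bullet> b\<bar>)" by (rule norm_le_l1)
      also have "\<dots> \<le> (\<Sum>b\<in>Basis. l b * norm (y - x))"
        using l(2) that by (intro sum_mono) (auto simp: inner_diff_left)
      finally show ?thesis by (simp add: M_def sum_distrib_right)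
    qed
    have taylor: "\<bar>p y - p x - (y - x) \<bullet> G x\<bar> \<le> M * (norm (y - x))\<^sup>2" if "x \<in> cball 0 R" "y \<in> cball 0 R" for x y
    proof -
      have seg: "closed_segment x y \<subseteq> cball 0 R"
        using that by (intro closed_segment_subset) auto
      have "norm (p y - p x - (\<lambda>z h. h \<bullet> G z) x (y - x)) \<le> norm (y - x) * (M * norm (y - x))"
      proof (rule differentiable_bound_linearization[where S = "closed_segment x y"
            and f' = "\<lambda>z h. h \<bullet> G z" and ?x0.0 = x])
        show "x + t *\<^sub>R (y - x) \<in> closed_segment x y" if "t \<in> {0..1}" for t
          using that unfolding closed_segment_def by (auto simp: algebra_simps intro!: exI[of _ t])
        show "(p has_derivative (\<lambda>h. h \<bullet> G z)) (at z within closed_segment x y)" for z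
          using G(2)[of z] unfolding gderiv_def by (rule has_derivative_at_withinI)
        fix z assume z: "z \<in> closed_segment x y"
        have "norm (z - x) \<le> norm (y - x)" using z
          by (metis dist_commute dist_in_closed_segment dist_norm)
        then have "norm (G z - G x) \<le> M * norm (y - x)"
          using GL[OF that(1), of z] z seg \<open>0 \<le> M\<close> by (meson mult_left_mono order_trans subsetD)
        show "onorm ((\<lambda>h. h \<bullet> G z) - (\<lambda>h. h \<bullet> G x)) \<le> M * norm (y - x)"
        proof (rule onorm_le)
          fix h
          have "norm (h \<bullet> (G z - G x)) \<le> norm h * norm (G z - G x)" using Cauchy_Schwarz_ineq2 by simp
          also have "\<dots> \<le> norm h * (M * norm (y - x))"
            using \<open>norm (G z - G x) \<le> _\<close> by (intro mult_left_mono) auto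
          finally show "norm (((\<lambda>h. h \<bullet> G z) - (\<lambda>h. h \<bullet> G x)) h) \<le> M * norm (y - x) * norm h"
            by (simp add: inner_diff_right mult_ac)
        qed
      qed simp
      then show ?thesis by (simp add: power2_eq_square mult_ac)
    qed
    obtain L where L: "0 \<le> L" "\<And>x. x \<in> cball 0 R \<Longrightarrow> norm (G x) \<le> L"
      "\<And>x y. x \<in> cball 0 R \<Longrightarrow> y \<in> cball 0 R \<Longrightarrow> \<bar>p y - p x\<bar> \<le> L * norm (y - x)"
      using G_lip[of R] by blast
    have "L * norm (y - x) \<le> (L + M) * norm (y - x)" for x y :: 'a
      using \<open>0 \<le> M\<close> by (intro mult_right_mono) auto
    moreover have "M * (norm (y - x))\<^sup>2 \<le> (L + M) * (norm (y - x))\<^sup>2" for x y :: 'a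
      using \<open>0 \<le> L\<close> by (intro mult_right_mono) auto
    moreover have "L \<le> L + M" "0 \<le> L + M" using \<open>0 \<le> M\<close> \<open>0 \<le> L\<close> by auto
    ultimately show ?thesis using L taylor
      by (intro exI[of _ "L + M"]) (meson order_trans)
  qed
  then show ?thesis using G by blast
qed

lemma polynomial_function_estimates:
  fixes F :: "'a::euclidean_space \<Rightarrow> 'b::euclidean_space"
  assumes "polynomial_function F"
  shows "\<exists>DF. (\<forall>x. (F has_derivative DF x) (at x)) \<and> (\<forall>R. \<exists>L\<ge>0.
    (\<forall>x\<in>cball 0 R. \<forall>u. norm (DF x u) \<le> L * norm u) \<and>
    (\<forall>x\<in>cball 0 R. \<forall>y\<in>cball 0 R. norm (F y - F x) \<le> L * norm (y - x)) \<and>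
    (\<forall>x\<in>cball 0 R. \<forall>y\<in>cball 0 R. norm (F y - F x - DF x (y - x)) \<le> L * (norm (y - x))\<^sup>2))"
proof -
  have "\<forall>b\<in>Basis. real_polynomial_function (\<lambda>x. F x \<bullet> b)"
    using assms unfolding polynomial_function_iff_Basis_inner .
  then have "\<forall>b\<in>Basis. \<exists>G. (\<forall>x. GDERIV (\<lambda>x. F x \<bullet> b) x :> G x) \<and> (\<forall>R. \<exists>L\<ge>0.
    (\<forall>x\<in>cball 0 R. norm (G x) \<le> L) \<and>
    (\<forall>x\<in>cball 0 R. \<forall>y\<in>cball 0 R. \<bar>F y \<bullet> b - F x \<bullet> b\<bar> \<le> L * norm (y - x)) \<and>
    (\<forall>x\<in>cball 0 R. \<forall>y\<in>cball 0 R. \<bar>F y \<bullet> b - F x \<bullet> b - (y - x) \<bullet> G x\<bar> \<le> L * (norm (y - x))\<^sup>2))"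
    using real_polynomial_function_estimates by blast
  then obtain G where G: "\<And>b x. b \<in> Basis \<Longrightarrow> GDERIV (\<lambda>x. F x \<bullet> b) x :> G b x"
    and est: "\<And>b R. b \<in> Basis \<Longrightarrow> \<exists>L\<ge>0. (\<forall>x\<in>cball 0 R. norm (G b x) \<le> L) \<and>
    (\<forall>x\<in>cball 0 R. \<forall>y\<in>cball 0 R. \<bar>F y \<bullet> b - F x \<bullet> b\<bar> \<le> L * norm (y - x)) \<and>
    (\<forall>x\<in>cball 0 R. \<forall>y\<in>cball 0 R. \<bar>F y \<bullet> b - F x \<bullet> b - (y - x) \<bullet> G b x\<bar> \<le> L * (norm (y - x))\<^sup>2)"
    unfolding bchoice_iff by blast
  define DF where "DF = (\<lambda>x u. \<Sum>b\<in>Basis. (u \<bullet> G b x) *\<^sub>R b)"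
  have DFb: "DF x u \<bullet> b = u \<bullet> G b x" if "b \<in> Basis" for x u b
    unfolding DF_def using that by (simp add: inner_sum_left inner_Basis if_distrib sum.delta cong: if_cong)
  have "(F has_derivative DF x) (at x)" for x
    using G unfolding has_derivative_componentwise_within[of F] gderiv_def by (simp add: DFb)
  moreover have "\<exists>L\<ge>0. (\<forall>x\<in>cball 0 R. \<forall>u. norm (DF x u) \<le> L * norm u) \<and>
    (\<forall>x\<in>cball 0 R. \<forall>y\<in>cball 0 R. norm (F y - F x) \<le> L * norm (y - x)) \<and>
    (\<forall>x\<in>cball 0 R. \<forall>y\<in>cball 0 R. norm (F y - F x - DF x (y - x)) \<le> L * (norm (y - x))\<^sup>2)" for R
  proof -
    have "\<forall>b\<in>Basis. \<exists>L\<ge>0. (\<forall>x\<in>cball 0 R. norm (G b x) \<le> L) \<and>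
      (\<forall>x\<in>cball 0 R. \<forall>y\<in>cball 0 R. \<bar>F y \<bullet> b - F x \<bullet> b\<bar> \<le> L * norm (y - x)) \<and>
      (\<forall>x\<in>cball 0 R. \<forall>y\<in>cball 0 R. \<bar>F y \<bullet> b - F x \<bullet> b - (y - x) \<bullet> G b x\<bar> \<le> L * (norm (y - x))\<^sup>2)"
      using est by blast
    then obtain l where l: "\<forall>b\<in>Basis. 0 \<le> l b \<and> (\<forall>x\<in>cball 0 R. norm (G b x) \<le> l b) \<and>
      (\<forall>x\<in>cball 0 R. \<forall>y\<in>cball 0 R. \<bar>F y \<bullet> b - F x \<bullet> b\<bar> \<le> l b * norm (y - x)) \<and>
      (\<forall>x\<in>cball 0 R. \<forall>y\<in>cball 0 R. \<bar>F y \<bullet> b - F x \<bullet> b - (y - x) \<bullet> G b x\<bar> \<le> l b * (norm (y - x))\<^sup>2)"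
      unfolding bchoice_iff by blast
    have l1: "norm z \<le> sum l Basis * c" if "\<And>b. b \<in> Basis \<Longrightarrow> \<bar>z \<bullet> b\<bar> \<le> l b * c" for z :: 'b and c
      using norm_le_l1[of z] sum_mono[of Basis "\<lambda>b. \<bar>z \<bullet> b\<bar>" "\<lambda>b. l b * c"] that
      by (simp add: sum_distrib_right)
    have "norm (DF x u) \<le> sum l Basis * norm u" if "x \<in> cball 0 R" for x u
    proof (rule l1, unfold DFb)
      fix b :: 'b assume b: "b \<in> Basis"
      have "\<bar>u \<bullet> G b x\<bar> \<le> norm u * norm (G b x)" by (rule Cauchy_Schwarz_ineq2)
      also have "\<dots> \<le> norm u * l b" using l b that by (intro mult_left_mono) auto
      finally show "\<bar>u \<bullet> G b x\<bar> \<le> l b * norm u" by (simp add: mult.commute)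
    qed
    moreover have "norm (F y - F x) \<le> sum l Basis * norm (y - x)" if "x \<in> cball 0 R" "y \<in> cball 0 R" for x y
      using l that by (intro l1) (simp add: inner_diff_left)
    moreover have "norm (F y - F x - DF x (y - x)) \<le> sum l Basis * (norm (y - x))\<^sup>2"
      if "x \<in> cball 0 R" "y \<in> cball 0 R" for x y
      using l that by (intro l1) (simp add: inner_diff_left[of _ "DF x (y - x)"] inner_diff_left[of "F y" "F x"] DFb)
    moreover have "0 \<le> sum l Basis" using l by (intro sum_nonneg) auto
    ultimately show ?thesis by blast
  qed
  ultimately show ?thesis by blast
qed

section \<open>Explicit Euler iterates\<close>

text \<open>\<open>I\<close> accumulates the rate, so \<open>I t / t\<close> is the time average of
  \<open>P\<close>. It is characterised by its derivative instead of as an integral: then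
  \<open>ln (norm (y t))\<close> fits directly, and mean value bounds treat \<open>x\<close> and
  \<open>I\<close> alike.\<close>

definition averaged_solution ::
  "('a::real_normed_vector \<Rightarrow> 'a) \<Rightarrow> ('a \<Rightarrow> real) \<Rightarrow> 'a set \<Rightarrow> (real \<Rightarrow> 'a) \<Rightarrow> (real \<Rightarrow> real) \<Rightarrow> bool" where
  "averaged_solution F P S x I \<longleftrightarrow>
    (\<forall>t\<ge>0. x t \<in> S \<and> (x has_vector_derivative F (x t)) (at t within {0..})) \<and>
    I 0 = 0 \<and> (\<forall>t\<ge>0. (I has_vector_derivative P (x t)) (at t within {0..}))"

lemma averaged_solutionD:
  assumes "averaged_solution F P S x I" and "0 \<le> t"
  shows "x t \<in> S" and "T \<subseteq> {0..} \<Longrightarrow> (x has_vector_derivative F (x t)) (at t within T)"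
    and "T \<subseteq> {0..} \<Longrightarrow> (I has_vector_derivative P (x t)) (at t within T)" and "I 0 = 0"
  using assms unfolding averaged_solution_def
  by (blast intro: has_vector_derivative_within_subset)+

lemma abs_triangle3: "\<bar>a + b + c\<bar> \<le> \<bar>a\<bar> + \<bar>b\<bar> + \<bar>c\<bar>" for a b c :: real
  by linarith

text \<open>The estimates are asked for on the ball of radius \<open>R + 1\<close> because Euler
  iterates leave \<open>S\<close>; for small steps they remain within distance 1 of the solution
  that they follow.\<close>

locale euler_scheme =
  fixes F :: "'a::euclidean_space \<Rightarrow> 'a" and P :: "'a \<Rightarrow> real"
    and DF :: "'a \<Rightarrow> 'a \<Rightarrow> 'a" and DP :: "'a \<Rightarrow> 'a \<Rightarrow> real"
    and L K R :: real and S :: "'a set"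
  assumes DF: "\<And>x. (F has_derivative DF x) (at x)"
    and DP: "\<And>x. (P has_derivative DP x) (at x)"
    and L: "0 < L" and K: "0 < K" and S: "S \<subseteq> cball 0 R"
    and F_bound: "\<And>x. x \<in> cball 0 (R + 1) \<Longrightarrow> norm (F x) \<le> K"
    and P_bound: "\<And>x. x \<in> cball 0 (R + 1) \<Longrightarrow> \<bar>P x\<bar> \<le> K"
    and DF_bound: "\<And>x u. x \<in> cball 0 (R + 1) \<Longrightarrow> norm (DF x u) \<le> L * norm u"
    and DP_bound: "\<And>x u. x \<in> cball 0 (R + 1) \<Longrightarrow> \<bar>DP x u\<bar> \<le> L * norm u"
    and F_lip: "\<And>x y. x \<in> cball 0 (R + 1) \<Longrightarrow> y \<in> cball 0 (R + 1) \<Longrightarrow> norm (F y - F x) \<le> L * norm (y - x)"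
    and P_lip: "\<And>x y. x \<in> cball 0 (R + 1) \<Longrightarrow> y \<in> cball 0 (R + 1) \<Longrightarrow> \<bar>P y - P x\<bar> \<le> L * norm (y - x)"
    and F_taylor: "\<And>x y. x \<in> cball 0 (R + 1) \<Longrightarrow> y \<in> cball 0 (R + 1) \<Longrightarrow>
      norm (F y - F x - DF x (y - x)) \<le> L * (norm (y - x))\<^sup>2"
    and P_taylor: "\<And>x y. x \<in> cball 0 (R + 1) \<Longrightarrow> y \<in> cball 0 (R + 1) \<Longrightarrow>
      \<bar>P y - P x - DP x (y - x)\<bar> \<le> L * (norm (y - x))\<^sup>2"
begin

definition euler :: "real \<Rightarrow> nat \<Rightarrow> 'a \<Rightarrow> 'a" where
  "euler h j = ((\<lambda>w. w + h *\<^sub>R F w) ^^ j)"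

lemma euler_0 [simp]: "euler h 0 w = w"
  and euler_Suc: "euler h (Suc j) w = euler h j w + h *\<^sub>R F (euler h j w)"
  by (simp_all add: euler_def)

lemma S_subset: "x \<in> S \<Longrightarrow> x \<in> cball 0 (R + 1)"
  using S by force

lemma growth_le_exp:
  assumes "0 \<le> h" and "real j * h \<le> T"
  shows "(1 + h * L) ^ j \<le> exp (L * T)"
proof -
  have "(1 + h * L) ^ j \<le> exp (h * L) ^ j"
    using assms L by (intro power_mono) (auto simp: exp_ge_add_one_self add_nonneg_nonneg)
  also have "\<dots> = exp (L * (real j * h))"
    by (simp add: exp_of_nat_mult[symmetric] mult_ac)
  also have "\<dots> \<le> exp (L * T)" using assms L by simp
  finally show ?thesis .
qed

lemma solution_lipschitz:
  assumes "averaged_solution F P S x I" and "0 \<le> s" and "s \<le> t"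
  shows "norm (x t - x s) \<le> K * (t - s)"
proof -
  have "norm (x t - x s) \<le> K * norm (t - s)"
  proof (rule differentiable_bound[of "{s..t}" x "\<lambda>r h. h *\<^sub>R F (x r)"])
    fix r assume r: "r \<in> {s..t}"
    then have *: "x r \<in> S" "(x has_vector_derivative F (x r)) (at r within {0..})"
      using assms unfolding averaged_solution_def by auto
    show "(x has_derivative (\<lambda>h. h *\<^sub>R F (x r))) (at r within {s..t})"
      using *(2) assms unfolding has_vector_derivative_def
      by (elim has_derivative_subset) auto
    show "onorm (\<lambda>h. h *\<^sub>R F (x r)) \<le> K"
      using F_bound[OF S_subset[OF *(1)]]
      by (intro onorm_le) (metis abs_ge_zero mult.commute mult_left_mono norm_scaleR real_norm_def)
  qed (use assms in auto)
  then show ?thesis using assms by simp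
qed

text \<open>One step magnifies the error by at most \<open>1 + h L\<close> and adds a truncation
  error of at most \<open>h^2 K L\<close>. The Lipschitz bound holds only on the larger ball, so the
  induction also has to keep the iterates there, which is what the condition on \<open>h\<close> is
  for.\<close>

lemma euler_close:
  assumes sol: "averaged_solution F P S x I" and "0 < h" and "h * K * exp (L * T) \<le> 1"
    and "real j * h \<le> T"
  shows "norm (euler h j (x 0) - x (real j * h)) \<le> h * K * exp (L * T)"
    and "euler h j (x 0) \<in> cball 0 (R + 1)"
proof -
  have 1: "e \<le> h * K * exp (L * T)" if "e \<le> h * K * ((1 + h * L) ^ j - 1)" "real j * h \<le> T" for e j
  proof -
    have "(1 + h * L) ^ j - 1 \<le> exp (L * T)" using growth_le_exp[of h j T] that \<open>0 < h\<close> by simp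
    then have "h * K * ((1 + h * L) ^ j - 1) \<le> h * K * exp (L * T)"
      using \<open>0 < h\<close> K by (intro mult_left_mono) auto
    then show ?thesis using that(1) by simp
  qed
  have 2: "w \<in> cball 0 (R + 1)" if "norm (w - x t) \<le> h * K * exp (L * T)" "0 \<le> t" for w t
  proof -
    have "x t \<in> cball 0 R" using S averaged_solutionD(1)[OF sol that(2)] by blast
    then show ?thesis using that(1) assms(3) norm_triangle_sub[of w "x t"] by (simp add: dist_norm)
  qed
  \<comment> \<open>The bound \<open>h K ((1 + h L)^j - 1)\<close> solves the error recursion
    exactly; the cruder exponential bound would not reproduce itself under induction.\<close>
  have main: "norm (euler h j (x 0) - x (real j * h)) \<le> h * K * ((1 + h * L) ^ j - 1)"
    if "real j * h \<le> T" for j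
    using that
  proof (induction j)
    case (Suc j)
    let ?t = "real j * h" and ?w = "euler h j (x 0)"
    have "?t \<le> T" using Suc.prems \<open>0 < h\<close> by (simp add: distrib_right)
    have "0 \<le> ?t" using \<open>0 < h\<close> by simp
    note IH = Suc.IH[OF \<open>?t \<le> T\<close>]
    have w: "?w \<in> cball 0 (R + 1)" using 2[OF 1[OF IH \<open>?t \<le> T\<close>] \<open>0 \<le> ?t\<close>] .
    have xS: "x t \<in> cball 0 (R + 1)" if "0 \<le> t" for t
      using S_subset[OF averaged_solutionD(1)[OF sol that]] .
    have pos: "0 \<le> s" if "s \<in> {?t..?t + h}" for s
      using that \<open>0 \<le> ?t\<close> unfolding atLeastAtMost_iff by linarith
    have "norm (x (?t + h) - x ?t - (?t + h - ?t) *\<^sub>R F (x ?t)) \<le> norm (?t + h - ?t) * (h * K * L)"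
    proof (rule vector_differentiable_bound_linearization[where f = x and f' = "\<lambda>s. F (x s)"
          and S = "{?t..?t + h}" and ?x0.0 = ?t])
      show "(x has_vector_derivative F (x s)) (at s within {?t..?t + h})" if "s \<in> {?t..?t + h}" for s
        using averaged_solutionD(2)[OF sol pos[OF that]] pos by blast
      show "closed_segment ?t (?t + h) \<subseteq> {?t..?t + h}"
        using \<open>0 < h\<close> by (simp add: closed_segment_eq_real_ivl)
      fix s assume s: "s \<in> {?t..?t + h}"
      have "norm (F (x s) - F (x ?t)) \<le> L * norm (x s - x ?t)"
        using pos[OF s] \<open>0 \<le> ?t\<close> by (intro F_lip xS)
      also have "\<dots> \<le> L * (K * (s - ?t))"
        using s \<open>0 \<le> ?t\<close> L by (intro mult_left_mono solution_lipschitz[OF sol]) auto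
      also have "\<dots> \<le> L * (K * h)" using s L K by (intro mult_left_mono) auto
      finally show "norm (F (x s) - F (x ?t)) \<le> h * K * L" by (simp add: mult_ac)
    qed (use \<open>0 < h\<close> in auto)
    then have trunc: "norm (x ?t + h *\<^sub>R F (x ?t) - x (?t + h)) \<le> h * (h * K * L)"
      using \<open>0 < h\<close> by (simp add: norm_minus_commute diff_diff_eq)
    have "euler h (Suc j) (x 0) - x (?t + h) = (?w - x ?t) + h *\<^sub>R (F ?w - F (x ?t))
        + (x ?t + h *\<^sub>R F (x ?t) - x (?t + h))"
      by (simp add: euler_Suc algebra_simps)
    also have "norm \<dots> \<le> norm (?w - x ?t) + h * norm (F ?w - F (x ?t)) + h * (h * K * L)"
      using \<open>0 < h\<close> by (intro norm_triangle_le add_mono trunc norm_triangle_ineq[THEN order_trans]) auto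
    also have "\<dots> \<le> norm (?w - x ?t) + h * (L * norm (?w - x ?t)) + h * (h * K * L)"
      using F_lip[OF xS[OF \<open>0 \<le> ?t\<close>] w] \<open>0 < h\<close> by (intro add_mono order_refl mult_left_mono) auto
    also have "\<dots> = (1 + h * L) * norm (?w - x ?t) + h * (h * K * L)" by (simp add: algebra_simps)
    also have "\<dots> \<le> (1 + h * L) * (h * K * ((1 + h * L) ^ j - 1)) + h * (h * K * L)"
      using \<open>0 < h\<close> L by (intro add_mono order_refl mult_left_mono IH) auto
    also have "\<dots> = h * K * ((1 + h * L) ^ Suc j - 1)" by (simp add: algebra_simps)
    finally show ?case by (simp add: algebra_simps)
  qed simp
  from main[OF assms(4)] have 3: "norm (euler h j (x 0) - x (real j * h)) \<le> h * K * ((1 + h * L) ^ j - 1)" .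
  from 1[OF this assms(4)] show 4: "norm (euler h j (x 0) - x (real j * h)) \<le> h * K * exp (L * T)" .
  show "euler h j (x 0) \<in> cball 0 (R + 1)" using 2[OF 4] \<open>0 < h\<close> by simp
qed

text \<open>Each step contributes two errors of order \<open>h^2\<close>: one from freezing
  \<open>P\<close> at the left end of the step, one from evaluating it at the Euler iterate instead
  of the solution.\<close>

lemma euler_average:
  assumes sol: "averaged_solution F P S x I" and "0 < h" and "h * K * exp (L * T) \<le> 1"
    and "real n * h \<le> T"
  shows "\<bar>I (real n * h) - h * (\<Sum>j<n. P (euler h j (x 0)))\<bar> \<le> real n * h * (h * (K * L * (1 + exp (L * T))))"
  using assms(4)
proof (induction n)
  case 0
  then show ?case using sol by (simp add: averaged_solution_def)
next
  case (Suc n)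
  let ?t = "real n * h" and ?w = "euler h n (x 0)"
  have "?t \<le> T" using Suc.prems \<open>0 < h\<close> by (simp add: distrib_right)
  have "0 \<le> ?t" using \<open>0 < h\<close> by simp
  have xS: "x t \<in> cball 0 (R + 1)" if "0 \<le> t" for t
    using S_subset[OF averaged_solutionD(1)[OF sol that]] .
  have pos: "0 \<le> s" if "s \<in> {?t..?t + h}" for s
    using that \<open>0 \<le> ?t\<close> unfolding atLeastAtMost_iff by linarith
  have "norm (I (?t + h) - I ?t - (?t + h - ?t) *\<^sub>R P (x ?t)) \<le> norm (?t + h - ?t) * (h * K * L)"
  proof (rule vector_differentiable_bound_linearization[where f = I and f' = "\<lambda>s. P (x s)"
        and S = "{?t..?t + h}" and ?x0.0 = ?t])
    show "(I has_vector_derivative P (x s)) (at s within {?t..?t + h})" if "s \<in> {?t..?t + h}" for s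
      using averaged_solutionD(3)[OF sol pos[OF that]] pos by blast
    show "closed_segment ?t (?t + h) \<subseteq> {?t..?t + h}"
      using \<open>0 < h\<close> by (simp add: closed_segment_eq_real_ivl)
    fix s assume s: "s \<in> {?t..?t + h}"
    have "norm (P (x s) - P (x ?t)) \<le> L * norm (x s - x ?t)"
      unfolding real_norm_def using pos[OF s] \<open>0 \<le> ?t\<close> by (intro P_lip xS)
    also have "\<dots> \<le> L * (K * (s - ?t))"
      using s \<open>0 \<le> ?t\<close> L by (intro mult_left_mono solution_lipschitz[OF sol]) auto
    also have "\<dots> \<le> L * (K * h)" using s L K by (intro mult_left_mono) auto
    finally show "norm (P (x s) - P (x ?t)) \<le> h * K * L" by (simp add: mult_ac)
  qed (use \<open>0 < h\<close> in auto)
  then have 1: "\<bar>I (?t + h) - I ?t - h * P (x ?t)\<bar> \<le> h * (h * K * L)"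
    using \<open>0 < h\<close> by simp
  have "\<bar>P ?w - P (x ?t)\<bar> \<le> L * norm (?w - x ?t)"
    using euler_close(2)[OF sol assms(2,3) \<open>?t \<le> T\<close>] xS[OF \<open>0 \<le> ?t\<close>] by (intro P_lip)
  also have "\<dots> \<le> L * (h * K * exp (L * T))"
    using L by (intro mult_left_mono euler_close(1)[OF sol assms(2,3) \<open>?t \<le> T\<close>]) auto
  finally have "h * \<bar>P ?w - P (x ?t)\<bar> \<le> h * (L * (h * K * exp (L * T)))"
    using \<open>0 < h\<close> by (intro mult_left_mono) auto
  then have 2: "\<bar>h * P (x ?t) - h * P ?w\<bar> \<le> h * (L * (h * K * exp (L * T)))"
    using \<open>0 < h\<close> by (simp add: right_diff_distrib[symmetric] abs_mult abs_minus_commute)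
  let ?B = "h * (K * L * (1 + exp (L * T)))"
  have t: "real (Suc n) * h = ?t + h" by (simp add: distrib_right)
  define X where "X = (\<Sum>j<n. P (euler h j (x 0)))"
  have eq: "I (real (Suc n) * h) - h * (\<Sum>j<Suc n. P (euler h j (x 0)))
      = (I ?t - h * X) + (I (?t + h) - I ?t - h * P (x ?t)) + (h * P (x ?t) - h * P ?w)"
    unfolding t sum.lessThan_Suc X_def[symmetric] by (simp add: distrib_left)
  have "\<bar>I (real (Suc n) * h) - h * (\<Sum>j<Suc n. P (euler h j (x 0)))\<bar>
      \<le> \<bar>I ?t - h * X\<bar> + \<bar>I (?t + h) - I ?t - h * P (x ?t)\<bar> + \<bar>h * P (x ?t) - h * P ?w\<bar>"
    unfolding eq by (rule abs_triangle3)
  also have "\<dots> \<le> ?t * ?B + h * (h * K * L) + h * (L * (h * K * exp (L * T)))"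
    by (rule add_mono[OF add_mono[OF Suc.IH[OF \<open>?t \<le> T\<close>, folded X_def] 1] 2])
  also have "\<dots> = real (Suc n) * h * ?B" unfolding t by (simp add: algebra_simps)
  finally show ?case .
qed

text \<open>
  \<open>velocity h w j\<close> is the derivative of the Euler iterate in the direction \<open>F w\<close>; up to \<open>O(h)\<close> it
  is \<open>F\<close> at that iterate, just as a flow transports its own vector field.
\<close>

primrec velocity :: "real \<Rightarrow> 'a \<Rightarrow> nat \<Rightarrow> 'a" where
  "velocity h w 0 = F w"
| "velocity h w (Suc j) = velocity h w j + h *\<^sub>R DF (euler h j w) (velocity h w j)"

lemma euler_has_vector_derivative:
  "((\<lambda>s. euler h j (w + s *\<^sub>R F w)) has_vector_derivative velocity h w j) (at 0)"
proof (induction j)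
  case 0
  show ?case by (auto intro!: derivative_eq_intros simp: has_vector_derivative_def)
next
  case (Suc j)
  have "(F has_derivative DF (euler h j w)) (at (euler h j (w + 0 *\<^sub>R F w)))"
    using DF by simp
  from has_derivative_compose[OF Suc[unfolded has_vector_derivative_def] this]
  have "((\<lambda>s. F (euler h j (w + s *\<^sub>R F w))) has_vector_derivative DF (euler h j w) (velocity h w j)) (at 0)"
    unfolding has_vector_derivative_def
    using linear_scale[OF has_derivative_linear[OF DF[of "euler h j w"]]] by simp
  from has_vector_derivative_add[OF Suc has_vector_derivative_scaleR[OF DERIV_const this, of h]]
  show ?case by (simp add: euler_Suc)
qed

text \<open>Because \<open>h F(w_j)\<close> is the increment \<open>w_{j+1} - w_j\<close>, the
  difference obeys the same linear recursion as the Euler error, with the Taylor remainder of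
  \<open>F\<close> over one step, at most \<open>L h^2 K^2\<close>, as its source.\<close>

lemma velocity_close:
  assumes "0 < h" and "\<And>i. i \<le> j \<Longrightarrow> euler h i w \<in> cball 0 (R + 1)"
  shows "norm (velocity h w j - F (euler h j w)) \<le> h * K\<^sup>2 * ((1 + h * L) ^ j - 1)"
  using assms(2)
proof (induction j)
  case (Suc j)
  let ?w = "euler h j w" and ?w' = "euler h (Suc j) w" and ?v = "velocity h w j"
  have w: "?w \<in> cball 0 (R + 1)" "?w' \<in> cball 0 (R + 1)" using Suc.prems by auto
  have hF: "?w' - ?w = h *\<^sub>R F ?w" by (simp add: euler_Suc)
  interpret DFw: linear "DF ?w" using DF by (rule has_derivative_linear)
  have nF: "(norm (?w' - ?w))\<^sup>2 \<le> h\<^sup>2 * K\<^sup>2"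
    unfolding hF using F_bound[OF w(1)] \<open>0 < h\<close> by (simp add: power_mult_distrib power_mono)
  have eq: "velocity h w (Suc j) - F ?w' = (?v - F ?w) + h *\<^sub>R DF ?w (?v - F ?w)
      - (F ?w' - F ?w - DF ?w (?w' - ?w))"
    unfolding hF by (simp add: DFw.diff DFw.scale algebra_simps)
  have "norm (velocity h w (Suc j) - F ?w') \<le> norm (?v - F ?w) + h * norm (DF ?w (?v - F ?w)) + norm (F ?w' - F ?w - DF ?w (?w' - ?w))"
    unfolding eq
    using norm_triangle_ineq4[of "?v - F ?w + h *\<^sub>R DF ?w (?v - F ?w)" "F ?w' - F ?w - DF ?w (?w' - ?w)"]
      norm_triangle_ineq[of "?v - F ?w" "h *\<^sub>R DF ?w (?v - F ?w)"] \<open>0 < h\<close> by simp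
  also have "\<dots> \<le> norm (?v - F ?w) + h * (L * norm (?v - F ?w)) + L * (norm (?w' - ?w))\<^sup>2"
    using \<open>0 < h\<close> by (intro add_mono order_refl mult_left_mono DF_bound F_taylor w) auto
  also have "\<dots> \<le> norm (?v - F ?w) + h * (L * norm (?v - F ?w)) + L * (h\<^sup>2 * K\<^sup>2)"
    using L nF by (intro add_mono order_refl mult_left_mono) auto
  also have "\<dots> = (1 + h * L) * norm (?v - F ?w) + L * (h\<^sup>2 * K\<^sup>2)"
    by (simp add: algebra_simps)
  also have "\<dots> \<le> (1 + h * L) * (h * K\<^sup>2 * ((1 + h * L) ^ j - 1)) + L * (h\<^sup>2 * K\<^sup>2)"
    using \<open>0 < h\<close> L Suc by (intro add_mono order_refl mult_left_mono) auto
  also have "\<dots> = h * K\<^sup>2 * ((1 + h * L) ^ Suc j - 1)"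
    by (simp add: algebra_simps power2_eq_square)
  finally show ?case .
qed simp

text \<open>Summation by parts: from one term to the next the weight drops by \<open>1 / N\<close>,
  and it reaches 0 at the right end. This is the discrete form of the integration by parts behind
  the storage function.\<close>

lemma weighted_telescope:
  fixes a :: "nat \<Rightarrow> real"
  assumes "0 < N"
  shows "(\<Sum>j<N. (1 - real (Suc j) / N) * (a (Suc j) - a j)) = - a 0 + (\<Sum>j<N. a j) / N"
proof -
  \<comment> \<open>For a partial sum a boundary term remains, which vanishes at
    \<open>n = N\<close>.\<close>
  have "(\<Sum>j<n. (1 - real (Suc j) / N) * (a (Suc j) - a j))
      = - a 0 + (\<Sum>j<n. a j) / N + (1 - real n / N) * a n" for n
  proof (induction n)
    case (Suc n)
    show ?case unfolding sum.lessThan_Suc Suc.IH by (simp add: add_divide_distrib algebra_simps)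
  qed simp
  from this[of N] show ?thesis using assms by simp
qed

text \<open>A Riemann sum for the weighted integral over \<open>[0, N h]\<close>. The weight is
  taken at the right end \<open>Suc j\<close> of each step, which is the choice that lets the
  telescoping leave exactly the mean of the \<open>N\<close> values.\<close>

definition storage :: "real \<Rightarrow> nat \<Rightarrow> 'a \<Rightarrow> real" where
  "storage h N w = h * (\<Sum>j<N. (1 - real (Suc j) / N) * P (euler h j w))"

definition storage_rate :: "real \<Rightarrow> nat \<Rightarrow> 'a \<Rightarrow> real" where
  "storage_rate h N w = h * (\<Sum>j<N. (1 - real (Suc j) / N) * DP (euler h j w) (velocity h w j))"

lemma storage_has_real_derivative:
  "((\<lambda>s. storage h N (w + s *\<^sub>R F w)) has_real_derivative storage_rate h N w) (at 0)"
proof -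
  have "((\<lambda>s. P (euler h j (w + s *\<^sub>R F w))) has_real_derivative DP (euler h j w) (velocity h w j)) (at 0)" for j
  proof -
    have "(P has_derivative DP (euler h j w)) (at (euler h j (w + 0 *\<^sub>R F w)))"
      using DP by simp
    from has_derivative_compose[OF euler_has_vector_derivative[unfolded has_vector_derivative_def] this]
    show ?thesis
      using linear_scale[OF has_derivative_linear[OF DP[of "euler h j w"]]]
      unfolding has_field_derivative_def by (simp add: mult_commute_abs)
  qed
  then show ?thesis
    unfolding storage_def storage_rate_def
    by (intro DERIV_cmult DERIV_sum)
qed

text \<open>Up to \<open>O(h^2)\<close>, \<open>h\<close> times the derivative of \<open>P\<close>
  along \<open>velocity\<close> is the increment of \<open>P\<close> from one iterate to the next:
  one error is that of the velocity, the other the Taylor remainder of \<open>P\<close>. The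
  weighted increments telescope, and \<open>N\<close> such errors amount to \<open>O(h)\<close> on a
  fixed horizon.\<close>

lemma storage_rate_close:
  assumes "0 < h" and "0 < N" and "real N * h \<le> T"
    and E: "\<And>j. j \<le> N \<Longrightarrow> euler h j w \<in> cball 0 (R + 1)"
  shows "\<bar>P w + storage_rate h N w - (\<Sum>j<N. P (euler h j w)) / N\<bar>
    \<le> real N * h * (h * (L * K\<^sup>2 * (1 + exp (L * T))))"
proof -
  let ?e = "\<lambda>j. euler h j w" and ?v = "velocity h w" and ?c = "\<lambda>j. 1 - real (Suc j) / N"
  have tm: "\<bar>h * DP (?e j) (?v j) - (P (?e (Suc j)) - P (?e j))\<bar> \<le> h * (h * (L * K\<^sup>2 * (1 + exp (L * T))))"
    if "j < N" for j
  proof -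
    interpret DPe: linear "DP (?e j)" using DP by (rule has_derivative_linear)
    have e: "?e j \<in> cball 0 (R + 1)" "?e (Suc j) \<in> cball 0 (R + 1)" using E that by auto
    have hF: "?e (Suc j) - ?e j = h *\<^sub>R F (?e j)" by (simp add: euler_Suc)
    have nF: "(norm (?e (Suc j) - ?e j))\<^sup>2 \<le> h\<^sup>2 * K\<^sup>2"
      unfolding hF using F_bound[OF e(1)] \<open>0 < h\<close> by (simp add: power_mult_distrib power_mono)
    have "real j * h \<le> real N * h" using that \<open>0 < h\<close> by (intro mult_right_mono) auto
    then have "real j * h \<le> T" using assms(3) by linarith
    then have "(1 + h * L) ^ j - 1 \<le> exp (L * T)"
      using growth_le_exp[of h j T] assms(1) by simp
    then have "h * K\<^sup>2 * ((1 + h * L) ^ j - 1) \<le> h * K\<^sup>2 * exp (L * T)"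
      using \<open>0 < h\<close> by (intro mult_left_mono) auto
    then have vF: "norm (?v j - F (?e j)) \<le> h * K\<^sup>2 * exp (L * T)"
      using velocity_close[of h j w] assms(1) E that by (meson less_imp_le order_trans)
    have "\<bar>DP (?e j) (?v j - F (?e j))\<bar> \<le> L * (h * K\<^sup>2 * exp (L * T))"
      using DP_bound[OF e(1), of "?v j - F (?e j)"] mult_left_mono[OF vF, of L] L by linarith
    then have 1: "\<bar>h * DP (?e j) (?v j - F (?e j))\<bar> \<le> h * (L * (h * K\<^sup>2 * exp (L * T)))"
      using \<open>0 < h\<close> by (simp add: abs_mult)
    have 2: "\<bar>P (?e (Suc j)) - P (?e j) - DP (?e j) (?e (Suc j) - ?e j)\<bar> \<le> L * (h\<^sup>2 * K\<^sup>2)"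
      using P_taylor[OF e] mult_left_mono[OF nF, of L] L by linarith
    have eq: "h * DP (?e j) (?v j) - (P (?e (Suc j)) - P (?e j)) = h * DP (?e j) (?v j - F (?e j))
        - (P (?e (Suc j)) - P (?e j) - DP (?e j) (?e (Suc j) - ?e j))"
      unfolding hF by (simp add: DPe.diff DPe.scale algebra_simps)
    have "\<bar>h * DP (?e j) (?v j) - (P (?e (Suc j)) - P (?e j))\<bar>
        \<le> h * (L * (h * K\<^sup>2 * exp (L * T))) + L * (h\<^sup>2 * K\<^sup>2)"
      unfolding eq using 1 2 by linarith
    also have "\<dots> = h * (h * (L * K\<^sup>2 * (1 + exp (L * T))))" by (simp add: algebra_simps power2_eq_square)
    finally show ?thesis .
  qed
  have c: "\<bar>?c j\<bar> \<le> 1" if "j < N" for j using that by auto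
  have "P w + storage_rate h N w - (\<Sum>j<N. P (?e j)) / N
      = (\<Sum>j<N. ?c j * (h * DP (?e j) (?v j))) - (\<Sum>j<N. ?c j * (P (?e (Suc j)) - P (?e j)))"
    unfolding weighted_telescope[OF \<open>0 < N\<close>, of "\<lambda>j. P (?e j)"] storage_rate_def
    by (simp add: sum_distrib_left mult_ac)
  also have "\<dots> = (\<Sum>j<N. ?c j * (h * DP (?e j) (?v j) - (P (?e (Suc j)) - P (?e j))))"
    by (simp only: sum_subtractf right_diff_distrib)
  finally have "\<bar>P w + storage_rate h N w - (\<Sum>j<N. P (?e j)) / N\<bar>
      = \<bar>\<Sum>j<N. ?c j * (h * DP (?e j) (?v j) - (P (?e (Suc j)) - P (?e j)))\<bar>"
    by (rule arg_cong)
  also have "\<dots> \<le> (\<Sum>j<N. 1 * (h * (h * (L * K\<^sup>2 * (1 + exp (L * T))))))"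
    by (intro sum_abs[THEN order_trans] sum_mono, unfold abs_mult)
      (intro mult_mono c tm, auto)
  finally show ?thesis by (simp add: mult_ac)
qed

end

section \<open>Storage polynomials from time averages\<close>

lemma averaged_solution_shift:
  assumes "averaged_solution F P S x I" and "0 \<le> s"
  shows "averaged_solution F P S (\<lambda>t. x (s + t)) (\<lambda>t. I (s + t) - I s)"
proof -
  have shift: "((\<lambda>t. y (s + t)) has_vector_derivative y') (at t within {0..})"
    if "(y has_vector_derivative y') (at (s + t) within {0..})" "0 \<le> t"
    for y :: "real \<Rightarrow> 'c::real_normed_vector" and y' t
  proof -
    have "(y has_vector_derivative y') (at (s + t) within (\<lambda>t. s + t) ` {0..})"
      using that assms(2) by (intro has_vector_derivative_within_subset[OF that(1)]) auto
    moreover have "((\<lambda>t. s + t) has_vector_derivative 1) (at t within {0..})"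
      by (auto intro!: derivative_eq_intros simp: has_vector_derivative_def)
    ultimately show ?thesis using vector_diff_chain_within[of "\<lambda>t. s + t" 1] by (force simp: o_def)
  qed
  show ?thesis
    unfolding averaged_solution_def
  proof (intro conjI allI impI)
    fix t :: real assume "0 \<le> t"
    then have "0 \<le> s + t" using assms(2) by simp
    from averaged_solutionD[OF assms(1) this]
    have D: "x (s + t) \<in> S" "(x has_vector_derivative F (x (s + t))) (at (s + t) within {0..})"
      "(I has_vector_derivative P (x (s + t))) (at (s + t) within {0..})" by auto
    show "x (s + t) \<in> S" by (rule D(1))
    show "((\<lambda>t. x (s + t)) has_vector_derivative F (x (s + t))) (at t within {0..})"
      by (rule shift[OF D(2) \<open>0 \<le> t\<close>])
    have "((\<lambda>t. I (s + t) - I s) has_vector_derivative P (x (s + t)) - 0) (at t within {0..})"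
      by (intro has_vector_derivative_diff shift[OF D(3) \<open>0 \<le> t\<close>] has_vector_derivative_const)
    then show "((\<lambda>t. I (s + t) - I s) has_vector_derivative P (x (s + t))) (at t within {0..})" by simp
  qed simp
qed

section \<open>From time averages on a compact set to one storage function\<close>

context euler_scheme
begin

lemma continuous_on_euler: "continuous_on X (euler h j)"
proof (induction j)
  case 0
  show ?case by (simp add: euler_def id_def)
next
  case (Suc j)
  have "continuous_on Y F" for Y
    by (rule has_derivative_continuous_on[OF has_derivative_at_withinI[OF DF]])
  then have "continuous_on X (\<lambda>w. F (euler h j w))"
    by (rule continuous_on_compose2[OF _ Suc]) auto
  then show ?case unfolding euler_Suc[abs_def] by (intro continuous_intros Suc)
qed

text \<open>The steps must fill the horizon exactly, so \<open>N\<close> is chosen first and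
  \<open>h\<close> is \<open>T / N\<close>. The parameter \<open>c\<close> stands for whatever
  constant multiplies \<open>h\<close> in an error bound.\<close>

lemma exists_small_step:
  assumes "0 < T" and "0 < \<epsilon>"
  shows "\<exists>h N. 0 < h \<and> 0 < N \<and> real N * h = T \<and> h * c \<le> \<epsilon> \<and> h * K * exp (L * T) \<le> 1"
proof -
  define d where "d = max (max c 0 * T / \<epsilon>) (K * exp (L * T) * T)"
  obtain n :: nat where "d < real n" using reals_Archimedean2 by blast
  define N where "N = Suc n"
  have N: "0 < N" "d \<le> N" using \<open>d < real n\<close> unfolding N_def by auto
  have "max c 0 * T / \<epsilon> \<le> N" "K * exp (L * T) * T \<le> N" using N unfolding d_def by auto
  then have "max c 0 * T \<le> \<epsilon> * N" "T / N * K * exp (L * T) \<le> 1"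
    using N(1) assms by (simp_all add: field_simps)
  moreover have "c * T \<le> max c 0 * T" using assms by (intro mult_right_mono) auto
  ultimately have "T / N * c \<le> \<epsilon>" "T / N * K * exp (L * T) \<le> 1"
    using N(1) by (auto simp: field_simps)
  then show ?thesis using N(1) assms by (intro exI[of _ "T / N"] exI[of _ N]) auto
qed

text \<open>The order of the quantifiers is the point: \<open>h\<close> and \<open>N\<close> depend
  only on \<open>T\<close>, \<open>\<epsilon>\<close> and the constants of the scheme, so one
  function serves all solutions in \<open>S\<close>.\<close>

lemma exists_storage:
  assumes "0 < T" and "0 < \<epsilon>"
  shows "\<exists>h N. \<forall>x I. averaged_solution F P S x I \<longrightarrow> P (x 0) + storage_rate h N (x 0) \<le> I T / T + \<epsilon>"
proof -
  define C1 where "C1 = L * K\<^sup>2 * (1 + exp (L * T))"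
  define C2 where "C2 = K * L * (1 + exp (L * T))"
  obtain h N where h: "0 < h" "0 < N" "real N * h = T" "h * (T * C1 + C2) \<le> \<epsilon>" "h * K * exp (L * T) \<le> 1"
    using exists_small_step[OF assms] by blast
  have "P (x 0) + storage_rate h N (x 0) \<le> I T / T + \<epsilon>" if sol: "averaged_solution F P S x I" for x I
  proof -
    let ?A = "\<Sum>j<N. P (euler h j (x 0))"
    have "euler h j (x 0) \<in> cball 0 (R + 1)" if "j \<le> N" for j
    proof (rule euler_close(2)[OF sol h(1,5)])
      show "real j * h \<le> T" unfolding h(3)[symmetric] using h(1) that by (intro mult_right_mono) auto
    qed
    then have 1: "\<bar>P (x 0) + storage_rate h N (x 0) - ?A / N\<bar> \<le> T * (h * C1)"
      using storage_rate_close[of h N T "x 0"] h unfolding C1_def by simp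
    have "\<bar>I T - h * ?A\<bar> \<le> T * (h * C2)"
      using euler_average[OF sol h(1,5), of N] h(3) unfolding C2_def by simp
    then have "(h * ?A) / T \<le> (I T + T * (h * C2)) / T" using assms by (intro divide_right_mono) auto
    moreover have "(h * ?A) / T = ?A / N" using h by (simp flip: h(3))
    moreover have "(I T + T * (h * C2)) / T = I T / T + h * C2" using assms by (simp add: add_divide_distrib)
    ultimately have 2: "?A / N \<le> I T / T + h * C2" by simp
    have 3: "h * C2 + T * (h * C1) \<le> \<epsilon>" using h(4) by (simp add: algebra_simps)
    have "P (x 0) + storage_rate h N (x 0) \<le> ?A / N + T * (h * C1)" using abs_le_D1[OF 1] by simp
    also have "\<dots> \<le> I T / T + (h * C2 + T * (h * C1))" using 2 by simp
    also have "\<dots> \<le> I T / T + \<epsilon>" using 3 by simp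
    finally show ?thesis .
  qed
  then show ?thesis by blast
qed

text \<open>The Euler sum is a continuous function of the starting point and approximates the
  accumulated rate uniformly, so it takes the place of continuous dependence of solutions on initial
  data.\<close>

lemma average_less_open:
  assumes sol: "averaged_solution F P S x I" and "0 < T" and "I T < c"
  shows "\<exists>U. open U \<and> x 0 \<in> U \<and> (\<forall>x' I'. averaged_solution F P S x' I' \<longrightarrow> x' 0 \<in> U \<longrightarrow> I' T < c)"
proof -
  \<comment> \<open>Two of the three parts pay for comparing \<open>I\<close> and \<open>I'\<close>
    with the Euler sum; the third keeps the inequality strict.\<close>
  define \<epsilon> where "\<epsilon> = (c - I T) / 3"
  have \<epsilon>: "0 < \<epsilon>" using assms(3) unfolding \<epsilon>_def by simp
  have c: "c = I T + 3 * \<epsilon>" unfolding \<epsilon>_def by (simp add: field_simps)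
  obtain h N where h: "0 < h" "0 < N" "real N * h = T" "h * (T * (K * L * (1 + exp (L * T)))) \<le> \<epsilon>"
    "h * K * exp (L * T) \<le> 1"
    using exists_small_step[OF \<open>0 < T\<close> \<epsilon>] by blast
  define A where "A = (\<lambda>w. h * (\<Sum>j<N. P (euler h j w)))"
  have close: "\<bar>I' T - A (x' 0)\<bar> \<le> \<epsilon>" if "averaged_solution F P S x' I'" for x' I'
  proof -
    have "real N * h * (h * (K * L * (1 + exp (L * T)))) \<le> \<epsilon>"
      using h(4) unfolding h(3) by (simp add: mult.left_commute)
    then show ?thesis
      using euler_average[OF that h(1,5), of N] h(3) unfolding A_def by simp
  qed
  have "continuous_on Y P" for Y
    by (rule has_derivative_continuous_on[OF has_derivative_at_withinI[OF DP]])
  then have "continuous_on UNIV A"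
    unfolding A_def by (intro continuous_intros continuous_on_compose2[OF _ continuous_on_euler]) auto
  then have "open {w. A w < c - \<epsilon>}"
    by (intro open_Collect_less continuous_on_const)
  moreover have "A (x 0) < c - \<epsilon>" using abs_le_D2[OF close[OF sol]] \<epsilon> c by linarith
  moreover have "I' T < c" if "averaged_solution F P S x' I'" "A (x' 0) < c - \<epsilon>" for x' I'
    using abs_le_D1[OF close[OF that(1)]] that(2) by linarith
  ultimately show ?thesis by (intro exI[of _ "{w. A w < c - \<epsilon>}"]) auto
qed

lemma integral_le:
  assumes "averaged_solution F P S x I" and "0 \<le> T"
  shows "I T \<le> K * T"
proof -
  have "norm (I T - I 0) \<le> K * norm (T - 0)"
  proof (rule differentiable_bound[of "{0..T}" I "\<lambda>r h. h *\<^sub>R P (x r)"])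
    fix r assume r: "r \<in> {0..T}"
    then have "0 \<le> r" by simp
    show "(I has_derivative (\<lambda>h. h *\<^sub>R P (x r))) (at r within {0..T})"
      using averaged_solutionD(3)[OF assms(1) \<open>0 \<le> r\<close>, of "{0..T}"] unfolding has_vector_derivative_def by auto
    show "onorm (\<lambda>h. h *\<^sub>R P (x r)) \<le> K"
      using P_bound[OF S_subset[OF averaged_solutionD(1)[OF assms(1) \<open>0 \<le> r\<close>]]]
      by (intro onorm_le) (metis abs_ge_zero mult.commute mult_left_mono norm_scaleR real_norm_def)
  qed (use assms in auto)
  then show ?thesis using assms averaged_solutionD(4)[OF assms(1,2)] by simp
qed

text \<open>A long solution is cut greedily: from wherever it is, some piece has accumulated rate
  below \<open>b\<close> times its length, and by the finite subcover the length lies between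
  \<open>tmin\<close> and \<open>tmax\<close>. Only the last, incomplete piece can exceed the rate
  \<open>b\<close>.\<close>

lemma average_bound:
  assumes "compact S"
    and ex: "\<And>w. w \<in> S \<Longrightarrow> \<exists>x I. averaged_solution F P S x I \<and> x 0 = w"
    and less: "\<And>x I. averaged_solution F P S x I \<Longrightarrow> \<exists>t>0. I t < b * t"
  shows "\<exists>C. \<forall>x I T. averaged_solution F P S x I \<longrightarrow> 0 \<le> T \<longrightarrow> I T \<le> b * T + C"
proof (cases "S = {}")
  case True
  then show ?thesis unfolding averaged_solution_def by auto
next
  case False
  define Q where "Q = (\<lambda>w t U. 0 < t \<and> open U \<and> w \<in> U \<and>
    (\<forall>x I. averaged_solution F P S x I \<longrightarrow> x 0 \<in> U \<longrightarrow> I t < b * t))"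
  have "\<exists>t U. Q w t U" if w: "w \<in> S" for w
  proof -
    obtain x I where sol: "averaged_solution F P S x I" "x 0 = w" using ex[OF w] by blast
    obtain t where t: "0 < t" "I t < b * t" using less[OF sol(1)] by blast
    from average_less_open[OF sol(1) t] obtain U where "open U" "x 0 \<in> U"
      "\<forall>x' I'. averaged_solution F P S x' I' \<longrightarrow> x' 0 \<in> U \<longrightarrow> I' t < b * t" by (elim exE conjE)
    then have "Q w t U" using t(1) sol(2) unfolding Q_def by simp
    then show ?thesis by blast
  qed
  then have "\<exists>t U. \<forall>w\<in>S. Q w (t w) (U w)" by metis
  then obtain t U where Q: "\<And>w. w \<in> S \<Longrightarrow> Q w (t w) (U w)" by blast
  have tU: "0 < t w" "open (U w)" "w \<in> U w"
    "averaged_solution F P S x I \<Longrightarrow> x 0 \<in> U w \<Longrightarrow> I (t w) < b * t w" if "w \<in> S" for w x I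
    using Q[OF that] unfolding Q_def by simp_all
  have "S \<subseteq> (\<Union>w\<in>S. U w)" using tU(3) by blast
  then obtain W where W: "W \<subseteq> S" "finite W" "S \<subseteq> (\<Union>w\<in>W. U w)"
    using compactE_image[OF \<open>compact S\<close>, of S U] tU(2) by blast
  then have "W \<noteq> {}" using False by auto
  define tmin tmax where "tmin = Min (t ` W)" and "tmax = Max (t ` W)"
  have tmm: "tmin \<le> t w" "t w \<le> tmax" if "w \<in> W" for w
    using that W(2) unfolding tmin_def tmax_def by auto
  have "0 < tmin" unfolding tmin_def using W \<open>W \<noteq> {}\<close> tU(1) by (subst Min_gr_iff) auto
  have step: "\<exists>s. tmin \<le> s \<and> s \<le> tmax \<and> I s < b * s" if sol: "averaged_solution F P S x I" for x I
  proof -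
    obtain w where "w \<in> W" "x 0 \<in> U w" using averaged_solutionD(1)[OF sol order_refl] W(3) by blast
    then show ?thesis using tmm tU(4)[OF _ sol] W(1) by blast
  qed
  \<comment> \<open>On a remainder of length at most \<open>tmax\<close> the rate is at most
    \<open>K\<close>, hence exceeds \<open>b\<close> by at most \<open>K + |b|\<close>.\<close>
  define C where "C = (K + \<bar>b\<bar>) * tmax"
  \<comment> \<open>\<open>n\<close> bounds the number of pieces, since each one uses up at least
    \<open>tmin\<close>. Solution and time are arbitrary in the induction because the remainder is a
    shifted solution.\<close>
  have "I T \<le> b * T + C" if "averaged_solution F P S x I" "0 \<le> T" "T \<le> real n * tmin" for n T x I
    using that
  proof (induction n arbitrary: T x I)
    case 0
    then have "T = 0" by simp
    obtain w where "w \<in> W" using \<open>W \<noteq> {}\<close> by blast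
    then have "0 \<le> tmax" using tmm[of w] \<open>0 < tmin\<close> by linarith
    then have "0 \<le> C" using K unfolding C_def by simp
    then show ?case using averaged_solutionD(4)[OF 0(1) order_refl] \<open>T = 0\<close> by simp
  next
    case (Suc n)
    show ?case
    proof (cases "T \<le> tmax")
      case True
      have "I T \<le> b * T + (K + \<bar>b\<bar>) * T"
        using integral_le[OF Suc.prems(1,2)] mult_right_mono[OF abs_ge_minus_self[of b] Suc.prems(2)]
        by (simp add: distrib_right)
      also have "\<dots> \<le> b * T + C"
        unfolding C_def using True K by (intro add_left_mono mult_left_mono) auto
      finally show ?thesis .
    next
      case False
      obtain s where s: "tmin \<le> s" "s \<le> tmax" "I s < b * s" using step[OF Suc.prems(1)] by blast
      then have "0 \<le> s" using \<open>0 < tmin\<close> by simp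
      have "T - s \<le> real n * tmin" using s(1) Suc.prems(3) by (simp add: distrib_right)
      moreover have "0 \<le> T - s" using False s by simp
      ultimately have "I (s + (T - s)) - I s \<le> b * (T - s) + C"
        using Suc.IH[OF averaged_solution_shift[OF Suc.prems(1) \<open>0 \<le> s\<close>]] by blast
      then show ?thesis using s(3) by (simp add: right_diff_distrib)
    qed
  qed
  moreover have "\<exists>n. T \<le> real n * tmin" for T
    using reals_Archimedean3[OF \<open>0 < tmin\<close>] less_imp_le by blast
  ultimately show ?thesis by blast
qed

lemma storage_decrease:
  assumes "compact S"
    and ex: "\<And>w. w \<in> S \<Longrightarrow> \<exists>x I. averaged_solution F P S x I \<and> x 0 = w"
    and less: "\<And>x I. averaged_solution F P S x I \<Longrightarrow> \<exists>t>0. I t < b * t"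
    and "b < b'"
  shows "\<exists>h N. \<forall>w\<in>S. P w + storage_rate h N w < b'"
proof -
  have "\<exists>C. \<forall>x I T. averaged_solution F P S x I \<longrightarrow> 0 \<le> T \<longrightarrow> I T \<le> b * T + C"
    by (rule average_bound[OF assms(1) ex less])
  then obtain C where C: "\<And>x I T. averaged_solution F P S x I \<Longrightarrow> 0 \<le> T \<Longrightarrow> I T \<le> b * T + C"
    by blast
  \<comment> \<open>One part goes to the excess \<open>C / T\<close>, one to the discretisation, and
    the third leaves strict inequality.\<close>
  define \<epsilon> where "\<epsilon> = (b' - b) / 3"
  have "0 < \<epsilon>" using assms(4) unfolding \<epsilon>_def by simp
  define T where "T = (\<bar>C\<bar> + 1) / \<epsilon>"
  have "0 < T" unfolding T_def using \<open>0 < \<epsilon>\<close> by simp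
  have "C / T \<le> \<epsilon>"
  proof -
    have "\<epsilon> * T = \<bar>C\<bar> + 1" unfolding T_def using \<open>0 < \<epsilon>\<close> by simp
    then have "C \<le> \<epsilon> * T" by linarith
    then show ?thesis using \<open>0 < T\<close> by (simp add: pos_divide_le_eq)
  qed
  obtain h N where hN: "\<And>x I. averaged_solution F P S x I \<Longrightarrow> P (x 0) + storage_rate h N (x 0) \<le> I T / T + \<epsilon>"
    using exists_storage[OF \<open>0 < T\<close> \<open>0 < \<epsilon>\<close>] by blast
  have "P w + storage_rate h N w < b'" if w: "w \<in> S" for w
  proof -
    obtain x I where sol: "averaged_solution F P S x I" "x 0 = w" using ex[OF w] by blast
    have "I T / T \<le> (b * T + C) / T" using C[OF sol(1), of T] \<open>0 < T\<close> by (intro divide_right_mono) auto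
    also have "\<dots> = b + C / T" using \<open>0 < T\<close> by (simp add: add_divide_distrib)
    finally have "P w + storage_rate h N w \<le> b + \<epsilon> + \<epsilon>" using hN[OF sol(1)] sol(2) \<open>C / T \<le> \<epsilon>\<close> by simp
    also have "\<dots> < b'" using \<open>b < b'\<close> unfolding \<epsilon>_def by (simp add: field_simps)
    finally show ?thesis .
  qed
  then show ?thesis by blast
qed

text \<open>Euler iterates are compositions of polynomial maps, whereas the flow of a polynomial
  field is in general not polynomial.\<close>

lemma storage_polynomial:
  assumes "polynomial_function F" and "real_polynomial_function P"
  shows "real_polynomial_function (storage h N)"
proof -
  have "polynomial_function (euler h j)" for j
  proof (induction j)
    case 0
    show ?case by (simp add: euler_def id_def)
  next
    case (Suc j)
    show ?case unfolding euler_Suc[abs_def]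
      by (intro polynomial_function_add polynomial_function_cmul Suc
          polynomial_function_compose[OF Suc assms(1), unfolded o_def])
  qed
  then have "real_polynomial_function (\<lambda>w. P (euler h j w))" for j
    using real_polynomial_function_compose[OF _ assms(2), unfolded o_def] by blast
  then show ?thesis unfolding storage_def[abs_def]
    by (intro real_polynomial_function.intros(2,4) real_polynomial_function_sum) auto
qed

end

theorem exists_polynomial_storage:
  fixes F :: "'a::euclidean_space \<Rightarrow> 'a" and P :: "'a \<Rightarrow> real"
  assumes F: "polynomial_function F" and P: "real_polynomial_function P" and "compact S"
    and ex: "\<And>w. w \<in> S \<Longrightarrow> \<exists>x I. averaged_solution F P S x I \<and> x 0 = w"
    and less: "\<And>x I. averaged_solution F P S x I \<Longrightarrow> \<exists>t>0. I t < b * t"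
    and "b < b'"
  shows "\<exists>V. real_polynomial_function V \<and> (\<forall>w\<in>S. \<forall>G. GDERIV V w :> G \<longrightarrow> P w + F w \<bullet> G < b')"
proof -
  obtain R where R: "S \<subseteq> cball 0 R"
    using bounded_subset_ballD[OF compact_imp_bounded[OF \<open>compact S\<close>], of 0] ball_subset_cball by blast
  let ?D = "cball 0 (R + 1) :: 'a set"
  obtain DF where DF: "\<forall>x. (F has_derivative DF x) (at x)"
    and estF: "\<forall>R. \<exists>L\<ge>0. (\<forall>x\<in>cball 0 R. \<forall>u. norm (DF x u) \<le> L * norm u) \<and>
      (\<forall>x\<in>cball 0 R. \<forall>y\<in>cball 0 R. norm (F y - F x) \<le> L * norm (y - x)) \<and>
      (\<forall>x\<in>cball 0 R. \<forall>y\<in>cball 0 R. norm (F y - F x - DF x (y - x)) \<le> L * (norm (y - x))\<^sup>2)"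
    using polynomial_function_estimates[OF F] by (elim exE conjE)
  obtain LF where LF: "0 \<le> LF" "\<forall>x\<in>?D. \<forall>u. norm (DF x u) \<le> LF * norm u"
    "\<forall>x\<in>?D. \<forall>y\<in>?D. norm (F y - F x) \<le> LF * norm (y - x)"
    "\<forall>x\<in>?D. \<forall>y\<in>?D. norm (F y - F x - DF x (y - x)) \<le> LF * (norm (y - x))\<^sup>2"
    using spec[OF estF, of "R + 1"] by (elim exE conjE)
  obtain DP where DP: "\<forall>x. (P has_derivative DP x) (at x)"
    and estP: "\<forall>R. \<exists>L\<ge>0. (\<forall>x\<in>cball 0 R. \<forall>u. norm (DP x u) \<le> L * norm u) \<and>
      (\<forall>x\<in>cball 0 R. \<forall>y\<in>cball 0 R. norm (P y - P x) \<le> L * norm (y - x)) \<and>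
      (\<forall>x\<in>cball 0 R. \<forall>y\<in>cball 0 R. norm (P y - P x - DP x (y - x)) \<le> L * (norm (y - x))\<^sup>2)"
    using polynomial_function_estimates[OF P[unfolded real_polynomial_function_eq]] by (elim exE conjE)
  obtain LP where LP: "0 \<le> LP" "\<forall>x\<in>?D. \<forall>u. norm (DP x u) \<le> LP * norm u"
    "\<forall>x\<in>?D. \<forall>y\<in>?D. norm (P y - P x) \<le> LP * norm (y - x)"
    "\<forall>x\<in>?D. \<forall>y\<in>?D. norm (P y - P x - DP x (y - x)) \<le> LP * (norm (y - x))\<^sup>2"
    using spec[OF estP, of "R + 1"] by (elim exE conjE)
  have "bounded (F ` ?D)" "bounded (P ` ?D)"
    using F P by (auto intro!: compact_imp_bounded compact_continuous_image
        continuous_on_polymonial_function simp: real_polynomial_function_eq)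
  then obtain KF KP where K: "0 < KF" "\<And>x. x \<in> ?D \<Longrightarrow> norm (F x) \<le> KF"
    "0 < KP" "\<And>x. x \<in> ?D \<Longrightarrow> \<bar>P x\<bar> \<le> KP"
    unfolding bounded_pos real_norm_def by blast
  \<comment> \<open>One constant for field and rate; the summand 1 makes it positive.\<close>
  define L where "L = LF + LP + 1"
  have "LF \<le> L" "LP \<le> L" "0 < L" using LF(1) LP(1) unfolding L_def by auto
  then have LL: "LF * norm u \<le> L * norm u" "LP * norm u \<le> L * norm u"
      "LF * (norm u)\<^sup>2 \<le> L * (norm u)\<^sup>2" "LP * (norm u)\<^sup>2 \<le> L * (norm u)\<^sup>2" for u :: 'a
    by (simp_all add: mult_right_mono)
  interpret euler_scheme F P DF DP L "KF + KP" R S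
  proof
    show "(F has_derivative DF x) (at x)" "(P has_derivative DP x) (at x)" for x
      using DF DP by auto
    show "0 < L" "0 < KF + KP" "S \<subseteq> cball 0 R" using \<open>0 < L\<close> K(1,3) R by auto
    fix x assume x: "x \<in> ?D"
    show "norm (F x) \<le> KF + KP" "\<bar>P x\<bar> \<le> KF + KP" using K(1,3) K(2,4)[OF x] by auto
    show "norm (DF x u) \<le> L * norm u" for u
      using LF(2) x LL(1)[of u] by (blast intro: order_trans)
    show "\<bar>DP x u\<bar> \<le> L * norm u" for u
      using LP(2) x LL(2)[of u] unfolding real_norm_def by (blast intro: order_trans)
    fix y assume y: "y \<in> ?D"
    show "norm (F y - F x) \<le> L * norm (y - x)"
      using LF(3) x y LL(1)[of "y - x"] by (blast intro: order_trans)
    show "\<bar>P y - P x\<bar> \<le> L * norm (y - x)"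
      using LP(3) x y LL(2)[of "y - x"] unfolding real_norm_def by (blast intro: order_trans)
    show "norm (F y - F x - DF x (y - x)) \<le> L * (norm (y - x))\<^sup>2"
      using LF(4) x y LL(3)[of "y - x"] by (blast intro: order_trans)
    show "\<bar>P y - P x - DP x (y - x)\<bar> \<le> L * (norm (y - x))\<^sup>2"
      using LP(4) x y LL(4)[of "y - x"] unfolding real_norm_def by (blast intro: order_trans)
  qed
  have "\<exists>h N. \<forall>w\<in>S. P w + storage_rate h N w < b'"
    by (rule storage_decrease[OF \<open>compact S\<close> ex less \<open>b < b'\<close>])
  then obtain h N where hN: "\<And>w. w \<in> S \<Longrightarrow> P w + storage_rate h N w < b'" by blast
  \<comment> \<open>Both \<open>F w \<bullet> G\<close> and \<open>storage_rate\<close> are the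
    derivative at 0 along the line through \<open>w\<close> in direction \<open>F w\<close>, so they
    agree.\<close>
  have "P w + F w \<bullet> G < b'" if "w \<in> S" "GDERIV (storage h N) w :> G" for w G
  proof -
    have line: "((\<lambda>s. w + s *\<^sub>R F w) has_derivative (\<lambda>s. s *\<^sub>R F w)) (at 0)"
      by (auto intro!: derivative_eq_intros)
    have "(storage h N has_derivative (\<lambda>v. v \<bullet> G)) (at (w + 0 *\<^sub>R F w))"
      using that(2) unfolding gderiv_def by simp
    from has_derivative_compose[OF line this]
    have "((\<lambda>s. storage h N (w + s *\<^sub>R F w)) has_real_derivative F w \<bullet> G) (at 0)"
      unfolding has_field_derivative_def by (simp add: mult_commute_abs)
    from DERIV_unique[OF this storage_has_real_derivative] show ?thesis using hN[OF that(1)] by simp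
  qed
  then show ?thesis using storage_polynomial[OF F P] by blast
qed

section \<open>Existence of solutions\<close>

lemma indefinite_integral_has_vector_derivative:
  fixes f :: "real \<Rightarrow> 'a::banach"
  assumes "continuous_on {0..} f" and "0 \<le> t"
  shows "((\<lambda>u. integral {0..u} f) has_vector_derivative f t) (at t within {0..})"
proof -
  have "((\<lambda>u. integral {0..u} f) has_vector_derivative f t) (at t within {0..t + 1})"
    using assms by (intro integral_has_vector_derivative) (auto intro: continuous_on_subset)
  moreover have "at t within {0..t + 1} = at t within {0..}"
    by (rule at_within_nhd[of _ "{..<t + 1}"]) auto
  ultimately show ?thesis by simp
qed

text \<open>
  The exponentially weighted unknown \<open>v t = exp (- 2 L t) x t\<close> makes the integral equation a
  contraction on all of \<open>[0, \<infinity>)\<close> at once, so that no continuation of local solutions is needed.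
\<close>

lemma lipschitz_ode_solution:
  fixes F :: "'a::euclidean_space \<Rightarrow> 'a"
  assumes "0 < L" and lip: "\<And>x y. norm (F x - F y) \<le> L * norm (x - y)" and bd: "\<And>x. norm (F x) \<le> K"
  shows "\<exists>x. x 0 = x0 \<and> (\<forall>t\<ge>0. (x has_vector_derivative F (x t)) (at t within {0..}))"
proof -
  \<comment> \<open>Integrating \<open>L * exp (\<mu> * s)\<close> and removing the weight leaves
    the factor \<open>L / \<mu> = 1/2\<close> of the contraction.\<close>
  define \<mu> where "\<mu> = 2 * L"
  have "0 < \<mu>" using \<open>0 < L\<close> unfolding \<mu>_def by simp
  have "0 \<le> K" using bd[of 0] norm_ge_zero order_trans by blast
  have contF: "continuous_on X F" for X
  proof -
    have "L-lipschitz_on X F" using \<open>0 < L\<close> lip by (intro lipschitz_onI) (auto simp: dist_norm)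
    then show ?thesis by (rule lipschitz_on_continuous_on)
  qed
  define g where "g = (\<lambda>v s. F (exp (\<mu> * s) *\<^sub>R apply_bcontfun v s))"
  have contg: "continuous_on X (g v)" for X and v :: "real \<Rightarrow>\<^sub>C 'a"
    unfolding g_def by (intro continuous_on_compose2[OF contF] continuous_intros) auto
  \<comment> \<open>With \<open>max 0 t\<close> the function is constant for negative times, so it
    is a bounded continuous function on the whole line as the type of \<open>v\<close>
    demands.\<close>
  define A where "A = (\<lambda>v t. exp (- (\<mu> * max 0 t)) *\<^sub>R (x0 + integral {0..max 0 t} (g v)))"
  have int: "g v integrable_on {0..t}" for v t by (intro integrable_continuous_real contg)
  \<comment> \<open>The bound \<open>K\<close> on the field makes the integral grow at most
    linearly, which the exponential weight outweighs.\<close>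
  have A_bound: "norm (A v t) \<le> norm x0 + K / \<mu>" for v t
  proof -
    let ?\<tau> = "max 0 t"
    have "norm (integral {0..?\<tau>} (g v)) \<le> K * (?\<tau> - 0)"
      using bd \<open>0 \<le> K\<close> contg by (intro integral_bound) (auto simp: g_def)
    then have "norm (x0 + integral {0..?\<tau>} (g v)) \<le> norm x0 + K * ?\<tau>"
      by (intro norm_triangle_le) simp
    then have "norm (A v t) \<le> exp (- (\<mu> * ?\<tau>)) * (norm x0 + K * ?\<tau>)"
      unfolding A_def by (simp add: mult_left_mono)
    also have "\<dots> = exp (- (\<mu> * ?\<tau>)) * norm x0 + K * (?\<tau> * exp (- (\<mu> * ?\<tau>)))"
      by (simp add: algebra_simps)
    also have "\<dots> \<le> 1 * norm x0 + K * (1 / \<mu>)"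
    proof (intro add_mono mult_right_mono mult_left_mono)
      have "\<mu> * ?\<tau> \<le> exp (\<mu> * ?\<tau>)" using exp_ge_add_one_self[of "\<mu> * ?\<tau>"] by linarith
      then have "\<mu> * ?\<tau> * exp (- (\<mu> * ?\<tau>)) \<le> exp (\<mu> * ?\<tau>) * exp (- (\<mu> * ?\<tau>))"
        by (intro mult_right_mono) auto
      then have "\<mu> * (?\<tau> * exp (- (\<mu> * ?\<tau>))) \<le> 1" by (simp add: exp_minus mult.assoc)
      then show "?\<tau> * exp (- (\<mu> * ?\<tau>)) \<le> 1 / \<mu>" using \<open>0 < \<mu>\<close> by (simp add: pos_le_divide_eq mult.commute)
    qed (use \<open>0 < \<mu>\<close> \<open>0 \<le> K\<close> in auto)
    finally show ?thesis by simp
  qed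
  have A_cont: "continuous_on UNIV (A v)" for v
  proof -
    have "continuous_on {0..} (\<lambda>u. integral {0..u} (g v))"
    proof (rule continuous_on_vector_derivative)
      show "((\<lambda>u. integral {0..u} (g v)) has_vector_derivative g v t) (at t within {0..})" if "t \<in> {0..}" for t
        using that by (intro indefinite_integral_has_vector_derivative contg) auto
    qed
    then have "continuous_on UNIV (\<lambda>t. integral {0..max 0 t} (g v))"
      by (rule continuous_on_compose2) (auto intro!: continuous_intros)
    then show ?thesis unfolding A_def by (intro continuous_intros)
  qed
  have A_in: "A v \<in> bcontfun" for v
    using A_cont A_bound by (rule bcontfun_normI)
  define \<Psi> where "\<Psi> = (\<lambda>v. Bcontfun (A v))"
  have \<Psi>: "apply_bcontfun (\<Psi> v) = A v" for v
    unfolding \<Psi>_def using A_in by (rule Bcontfun_inverse)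
  have "dist (\<Psi> v) (\<Psi> w) \<le> 1 / 2 * dist v w" for v w
  proof (rule dist_bound, unfold \<Psi>)
    fix t :: real
    let ?\<tau> = "max 0 t" and ?d = "dist v w"
    have "((\<lambda>s. L * ?d * exp (\<mu> * s)) has_integral
        (L * ?d * exp (\<mu> * ?\<tau>) / \<mu> - L * ?d * exp (\<mu> * 0) / \<mu>)) {0..?\<tau>}"
      using \<open>0 < \<mu>\<close>
      by (intro fundamental_theorem_of_calculus)
        (auto intro!: derivative_eq_intros simp: has_real_derivative_iff_has_vector_derivative[symmetric])
    then have hi: "((\<lambda>s. L * ?d * exp (\<mu> * s)) has_integral (?d * (exp (\<mu> * ?\<tau>) - 1) / 2)) {0..?\<tau>}"
      using \<open>0 < L\<close> by (simp add: \<mu>_def diff_divide_distrib[symmetric] right_diff_distrib)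
    have "norm (integral {0..?\<tau>} (\<lambda>s. g v s - g w s)) \<le> integral {0..?\<tau>} (\<lambda>s. L * ?d * exp (\<mu> * s))"
    proof (rule integral_norm_bound_integral)
      fix s :: real
      have "norm (g v s - g w s) \<le> L * norm (exp (\<mu> * s) *\<^sub>R (apply_bcontfun v s - apply_bcontfun w s))"
        unfolding g_def scaleR_diff_right by (rule lip)
      also have "\<dots> = L * (exp (\<mu> * s) * dist (apply_bcontfun v s) (apply_bcontfun w s))"
        by (simp add: dist_norm)
      also have "\<dots> \<le> L * (exp (\<mu> * s) * ?d)"
        using \<open>0 < L\<close> by (intro mult_left_mono dist_bounded) auto
      finally show "norm (g v s - g w s) \<le> L * ?d * exp (\<mu> * s)" by (simp add: mult_ac)
    qed (use int hi in \<open>auto intro: integrable_diff\<close>)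
    also have "\<dots> = ?d * (exp (\<mu> * ?\<tau>) - 1) / 2" using hi by (rule integral_unique)
    finally have "norm (integral {0..?\<tau>} (g v) - integral {0..?\<tau>} (g w)) \<le> ?d * (exp (\<mu> * ?\<tau>) - 1) / 2"
      using int by (simp add: integral_diff)
    moreover have "A v t - A w t = exp (- (\<mu> * ?\<tau>)) *\<^sub>R (integral {0..?\<tau>} (g v) - integral {0..?\<tau>} (g w))"
      unfolding A_def by (simp add: algebra_simps)
    ultimately have "dist (A v t) (A w t) \<le> exp (- (\<mu> * ?\<tau>)) * (?d * (exp (\<mu> * ?\<tau>) - 1) / 2)"
      by (simp add: dist_norm mult_left_mono)
    also have "\<dots> = ?d / 2 * (1 - exp (- (\<mu> * ?\<tau>)))"
      by (simp add: exp_minus field_simps)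
    also have "\<dots> \<le> ?d / 2 * 1" by (intro mult_left_mono) auto
    finally show "dist (A v t) (A w t) \<le> 1 / 2 * ?d" by simp
  qed
  then have "\<exists>!v. \<Psi> v = v" by (intro banach_fix_type[of "1 / 2"]) auto
  then obtain v where v: "\<Psi> v = v" by blast
  define x where "x = (\<lambda>t. x0 + integral {0..t} (g v))"
  have x: "exp (\<mu> * t) *\<^sub>R apply_bcontfun v t = x t" if "0 \<le> t" for t
  proof -
    have "apply_bcontfun v t = A v t" using \<Psi>[of v] v by simp
    then show ?thesis using that unfolding A_def x_def by (simp add: exp_minus)
  qed
  have "(x has_vector_derivative F (x t)) (at t within {0..})" if "0 \<le> t" for t
  proof -
    have "(x has_vector_derivative 0 + g v t) (at t within {0..})"
      unfolding x_def using that
      by (intro has_vector_derivative_add has_vector_derivative_const indefinite_integral_has_vector_derivative contg)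
    then show ?thesis using x[OF that] unfolding g_def by simp
  qed
  moreover have "x 0 = x0" unfolding x_def by simp
  ultimately show ?thesis by blast
qed

text \<open>A polynomial field is neither bounded nor globally Lipschitz, so the equation is first
  solved for a field truncated outside a ball whose interior contains \<open>S\<close>. Forward
  invariance then shows that the solution never meets the truncation.\<close>

lemma forward_invariant_solution:
  fixes F :: "'a::euclidean_space \<Rightarrow> 'a"
  assumes F: "polynomial_function F" and P: "real_polynomial_function P" and "compact S"
    and inv: "forward_invariant F S" and w: "w \<in> S"
  shows "\<exists>x I. averaged_solution F P S x I \<and> x 0 = w"
proof -
  obtain R where R: "0 < R" "S \<subseteq> ball 0 R"
    using bounded_subset_ballD[OF compact_imp_bounded[OF \<open>compact S\<close>], of 0] by blast
  obtain DF L where L: "0 \<le> L"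
    "\<And>x y. x \<in> cball 0 R \<Longrightarrow> y \<in> cball 0 R \<Longrightarrow> norm (F y - F x) \<le> L * norm (y - x)"
    using polynomial_function_estimates[OF F] by meson
  \<comment> \<open>The nearest-point projection does not increase distances and fixes the ball, so
    the truncated field is bounded, globally Lipschitz, and unchanged on the ball.\<close>
  define p where "p = closest_point (cball (0::'a) R)"
  have p: "p x \<in> cball 0 R" "dist (p x) (p y) \<le> dist x y" for x y
    using R(1) unfolding p_def by (intro closest_point_in_set closest_point_lipschitz; simp)+
  have p_id: "p x = x" if "x \<in> cball 0 R" for x
    using that unfolding p_def by (rule closest_point_self)
  have "bounded (F ` cball 0 R)"
    using F by (intro compact_imp_bounded compact_continuous_image continuous_on_polymonial_function) auto
  then obtain K where K: "\<And>x. x \<in> cball 0 R \<Longrightarrow> norm (F x) \<le> K" unfolding bounded_iff by blast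
  have "norm (F (p x) - F (p y)) \<le> (L + 1) * norm (x - y)" for x y
  proof -
    have "norm (F (p x) - F (p y)) \<le> L * norm (p x - p y)" by (rule L(2)[OF p(1) p(1)])
    also have "\<dots> \<le> (L + 1) * norm (x - y)"
      using p(2)[of x y] L(1) unfolding dist_norm by (intro mult_mono) auto
    finally show ?thesis .
  qed
  then obtain x where x: "x 0 = w" "\<And>t. 0 \<le> t \<Longrightarrow> (x has_vector_derivative F (p (x t))) (at t within {0..})"
    using lipschitz_ode_solution[of "L + 1" "\<lambda>x. F (p x)" K w] L(1) K p(1) by auto
  have contx: "continuous_on {0..} x"
    by (rule continuous_on_vector_derivative) (use x(2) in auto)
  have in_ball: "x t \<in> ball 0 R" if "0 \<le> t" for t
  proof (rule ccontr)
    assume "x t \<notin> ball 0 R"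
    \<comment> \<open>The times up to \<open>t\<close> at which the sphere of radius
      \<open>R\<close> has been reached or crossed; compactness provides a first one.\<close>
    define E where "E = {0..t} \<inter> {s \<in> {0..}. R \<le> norm (x s)}"
    have "closed {s \<in> {0..}. R \<le> norm (x s)}"
      using contx by (intro continuous_on_closed_Collect_le continuous_intros) auto
    then have "compact E" unfolding E_def by (intro compact_Int_closed) auto
    moreover have "t \<in> E" using \<open>x t \<notin> _\<close> that unfolding E_def by auto
    ultimately obtain \<tau> where \<tau>: "\<tau> \<in> E" "\<And>s. s \<in> E \<Longrightarrow> \<tau> \<le> s"
      using compact_attains_inf[of E] by blast
    have before: "x s \<in> ball 0 R" if "0 \<le> s" "s < \<tau>" for s
      using \<tau>(2)[of s] \<tau>(1) that unfolding E_def by force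
    have "(x has_vector_derivative F (x s)) (at s within {0..})" if "0 \<le> s" "s < \<tau>" for s
      using x(2)[OF that(1)] before[OF that] p_id[of "x s"] by (simp add: dist_norm)
    then have "trajectory F w (ereal \<tau>) x"
      unfolding trajectory_def using x(1) by simp
    then have inS: "x s \<in> S" if "0 \<le> s" "s < \<tau>" for s
      using inv w that unfolding forward_invariant_def by force
    have "0 < \<tau>"
    proof (rule ccontr)
      assume "\<not> 0 < \<tau>"
      then have "\<tau> = 0" using \<tau>(1) unfolding E_def by auto
      then show False using \<tau>(1) x(1) w R(2) unfolding E_def by auto
    qed
    \<comment> \<open>The half-open interval misses \<open>\<tau>\<close>, so the closedness of
      \<open>S\<close> is used; \<open>S\<close> lies in the open ball, which contradicts the choice
      of \<open>\<tau>\<close>.\<close>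
    have "x \<tau> \<in> S"
    proof (rule closed_sequentially[OF compact_imp_closed[OF \<open>compact S\<close>], of "\<lambda>n. x (\<tau> - \<tau> / real (Suc n))"])
      show "x (\<tau> - \<tau> / real (Suc n)) \<in> S" for n
        using \<open>0 < \<tau>\<close> by (intro inS) (auto simp: field_simps)
      have "(\<lambda>n. \<tau> - \<tau> * (1 / real (Suc n))) \<longlonglongrightarrow> \<tau> - \<tau> * 0"
        by (intro tendsto_intros LIMSEQ_Suc[OF lim_1_over_n])
      then have "(\<lambda>n. \<tau> - \<tau> / real (Suc n)) \<longlonglongrightarrow> \<tau>" by simp
      then show "(\<lambda>n. x (\<tau> - \<tau> / real (Suc n))) \<longlonglongrightarrow> x \<tau>"
        using \<open>0 < \<tau>\<close> by (intro continuous_on_tendsto_compose[OF contx]) (auto simp: field_simps)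
    qed
    then show False using R(2) \<tau>(1) unfolding E_def by auto
  qed
  have deriv: "(x has_vector_derivative F (x t)) (at t within {0..})" if "0 \<le> t" for t
    using x(2)[OF that] in_ball[OF that] p_id[of "x t"] by (simp add: dist_norm)
  then have "trajectory F w \<infinity> x" unfolding trajectory_def using x(1) by blast
  then have "x t \<in> S" if "0 \<le> t" for t
    using inv w that unfolding forward_invariant_def by force
  moreover have "continuous_on {0..} (\<lambda>t. P (x t))"
    using P by (intro continuous_on_compose2[OF continuous_on_polymonial_function contx])
      (auto simp: real_polynomial_function_eq)
  ultimately have "averaged_solution F P S x (\<lambda>t. integral {0..t} (\<lambda>s. P (x s)))"
    unfolding averaged_solution_def using deriv indefinite_integral_has_vector_derivative by auto
  then show ?thesis using x(1) by blast
qed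

section \<open>Additive compounds of polynomial Jacobians\<close>

lemma polynomial_function_iff_nth:
  fixes F :: "'a::euclidean_space \<Rightarrow> 'i::finite rvec"
  shows "polynomial_function F \<longleftrightarrow> (\<forall>i. real_polynomial_function (\<lambda>x. F x $ i))"
  unfolding polynomial_function_iff_Basis_inner by (auto simp: Basis_vec_def inner_axis)

lemma polynomial_function_Pair:
  fixes F :: "'a::euclidean_space \<Rightarrow> 'b::euclidean_space" and G :: "'a \<Rightarrow> 'c::euclidean_space"
  assumes "polynomial_function F" and "polynomial_function G"
  shows "polynomial_function (\<lambda>x. (F x, G x))"
  using assms unfolding polynomial_function_iff_Basis_inner by (auto simp: Basis_prod_def inner_Pair)

lemma has_vector_derivative_nth:
  fixes f :: "real \<Rightarrow> ('b::euclidean_space, 'i::finite) Finite_Cartesian_Product.vec"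
  assumes "\<And>i. ((\<lambda>t. f t $ i) has_vector_derivative D $ i) (at t within T)"
  shows "(f has_vector_derivative D) (at t within T)"
  unfolding has_vector_derivative_def has_derivative_componentwise_within[of f]
proof
  fix b :: "('b, 'i) Finite_Cartesian_Product.vec" assume "b \<in> Basis"
  then obtain i u where b: "b = axis i u" by (auto simp: Basis_vec_def)
  have "((\<lambda>t. f t $ i \<bullet> u) has_derivative (\<lambda>h. (h *\<^sub>R D $ i) \<bullet> u)) (at t within T)"
    using assms[of i] unfolding has_vector_derivative_def by (rule has_derivative_inner_left)
  then show "((\<lambda>t. f t \<bullet> b) has_derivative (\<lambda>h. (h *\<^sub>R D) \<bullet> b)) (at t within T)"
    unfolding b by (simp add: inner_axis)
qed

lemma mult_compound_nth:
  fixes A :: "'n::{finite,linorder} rmat"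
  shows "(mult_compound k A :: 'm::{finite,linorder} rmat) $ r $ s
    = (\<Sum>p | p permutes {0..<k}. signof p * (\<Prod>i\<in>{0..<k}. A $ (ktuple k r ! i) $ (ktuple k s ! p i)))"
proof -
  have "p i < k" if "p permutes {0..<k}" "i < k" for p i
    using permutes_in_image[OF that(1), of i] that(2) by auto
  then show ?thesis
    unfolding mult_compound_def Determinant.det_def by (auto intro!: sum.cong prod.cong)
qed

text \<open>This is the product rule on the Leibniz sum at \<open>\<delta> = 0\<close>. Each entry
  is a linear combination of entries of \<open>A\<close> with constant coefficients, so the additive
  compound of a polynomial Jacobian is polynomial.\<close>

lemma add_compound_nth:
  fixes A :: "'n::{finite,linorder} rmat"
  shows "(add_compound k A :: 'm::{finite,linorder} rmat) $ r $ s
    = (\<Sum>p | p permutes {0..<k}. signof p * (\<Sum>i\<in>{0..<k}. A $ (ktuple k r ! i) $ (ktuple k s ! p i) *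
        (\<Prod>j\<in>{0..<k} - {i}. (Finite_Cartesian_Product.mat 1 :: 'n rmat) $ (ktuple k r ! j) $ (ktuple k s ! p j))))"
    (is "_ = ?D r s")
proof -
  have "((\<lambda>\<delta>. (mult_compound k (Finite_Cartesian_Product.mat 1 + \<delta> *\<^sub>R A) :: 'm rmat) $ r $ s)
      has_real_derivative ?D r s) (at 0)" for r s
  proof -
    have "((\<lambda>\<delta>. \<Sum>p | p permutes {0..<k}. signof p * (\<Prod>i\<in>{0..<k}.
          (Finite_Cartesian_Product.mat 1 :: 'n rmat) $ (ktuple k r ! i) $ (ktuple k s ! p i)
            + \<delta> * A $ (ktuple k r ! i) $ (ktuple k s ! p i)))
        has_real_derivative (\<Sum>p | p permutes {0..<k}. signof p * (\<Sum>i\<in>{0..<k}. A $ (ktuple k r ! i) $ (ktuple k s ! p i) *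
          (\<Prod>j\<in>{0..<k} - {i}. (Finite_Cartesian_Product.mat 1 :: 'n rmat) $ (ktuple k r ! j) $ (ktuple k s ! p j)
            + 0 * A $ (ktuple k r ! j) $ (ktuple k s ! p j))))) (at 0)"
      by (intro DERIV_sum DERIV_cmult has_field_derivative_prod) (auto intro!: derivative_eq_intros)
    then show ?thesis unfolding mult_compound_nth by simp
  qed
  then have "((\<lambda>\<delta>. mult_compound k (Finite_Cartesian_Product.mat 1 + \<delta> *\<^sub>R A) :: 'm rmat)
      has_vector_derivative (\<chi> r s. ?D r s)) (at 0)"
    by (intro has_vector_derivative_nth) (simp add: has_real_derivative_iff_has_vector_derivative)
  then have "(add_compound k A :: 'm rmat) = (\<chi> r s. ?D r s)"
    unfolding add_compound_def by (rule vector_derivative_at)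
  then show ?thesis by simp
qed

lemma real_polynomial_function_jacobian:
  fixes f :: "'n::finite rvec \<Rightarrow> 'n rvec"
  assumes "polynomial_function f"
  shows "real_polynomial_function (\<lambda>x. jacobian f (at x) $ i $ j)"
proof -
  have "\<forall>i. \<exists>G. polynomial_function G \<and> (\<forall>x. GDERIV (\<lambda>x. f x $ i) x :> G x)"
    using assms[unfolded polynomial_function_iff_nth] by (intro allI real_polynomial_function_gderiv) simp
  from choice[OF this] obtain G
    where G: "\<And>i. polynomial_function (G i)" "\<And>i x. GDERIV (\<lambda>x. f x $ i) x :> G i x"
    by blast
  have "(f has_derivative (\<lambda>h. \<chi> i. h \<bullet> G i x)) (at x)" for x
    unfolding has_derivative_componentwise_within[of f]
    using G(2)[of _ x] by (auto simp: Basis_vec_def inner_axis gderiv_def)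
  \<comment> \<open>\<open>jacobian\<close> refers to a derivative obtained by choice; uniqueness
    identifies it with the one assembled from the gradients.\<close>
  from frechet_derivative_at[OF this, symmetric]
  have "jacobian f (at x) $ i $ j = axis j 1 \<bullet> G i x" for x
    unfolding jacobian_def matrix_def by simp
  then have "(\<lambda>x. jacobian f (at x) $ i $ j) = (\<lambda>x. G i x $ j)"
    by (simp add: inner_axis')
  then show ?thesis using G(1)[of i] unfolding polynomial_function_iff_nth by simp
qed

lemma real_polynomial_function_jac_compound:
  fixes f :: "'n::{finite,linorder} rvec \<Rightarrow> 'n rvec"
  assumes "polynomial_function f"
  shows "real_polynomial_function (\<lambda>x. (jac_compound k f x :: 'm::{finite,linorder} rmat) $ r $ s)"
  unfolding jac_compound_def add_compound_nth
  by (intro real_polynomial_function_sum real_polynomial_function.intros(2,4)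
      real_polynomial_function_jacobian assms finite_permutations finite_atLeastLessThan)

context
  fixes f :: "'n::{finite,linorder} rvec \<Rightarrow> 'n rvec" and k :: nat
  assumes f: "polynomial_function f"
begin

lemma polynomial_function_jac_compound_mult:
  "polynomial_function (\<lambda>w. (jac_compound k f (fst w) :: 'm::{finite,linorder} rmat) *v snd w)"
proof -
  have fst: "polynomial_function (fst :: 'n rvec \<times> 'm rvec \<Rightarrow> _)"
    and snd: "polynomial_function (snd :: 'n rvec \<times> 'm rvec \<Rightarrow> _)"
    by (intro polynomial_function_bounded_linear bounded_linear_fst bounded_linear_snd)+
  show ?thesis
    unfolding polynomial_function_iff_nth matrix_vector_mult_def vec_lambda_beta
    using real_polynomial_function_compose[OF fst real_polynomial_function_jac_compound[OF f], unfolded o_def]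
      snd[unfolded polynomial_function_iff_nth]
    by (intro allI real_polynomial_function_sum real_polynomial_function.intros(4)) auto
qed

lemma real_polynomial_function_\<Phi>:
  "real_polynomial_function (\<lambda>w. \<Phi> k f (fst w) (snd w :: 'm::{finite,linorder} rvec))"
proof -
  have snd: "polynomial_function (snd :: 'n rvec \<times> 'm rvec \<Rightarrow> _)"
    by (intro polynomial_function_bounded_linear bounded_linear_snd)
  show ?thesis
    unfolding \<Phi>_def inner_vec_def inner_real_def
    using snd[unfolded polynomial_function_iff_nth]
      polynomial_function_jac_compound_mult[unfolded polynomial_function_iff_nth]
    by (intro real_polynomial_function_sum real_polynomial_function.intros(4)) auto
qed

lemma polynomial_function_projected_field:
  "polynomial_function (\<lambda>w. (f (fst w), ell k f (fst w) (snd w :: 'm::{finite,linorder} rvec)))"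
proof -
  have fst: "polynomial_function (fst :: 'n rvec \<times> 'm rvec \<Rightarrow> _)"
    and snd: "polynomial_function (snd :: 'n rvec \<times> 'm rvec \<Rightarrow> _)"
    by (intro polynomial_function_bounded_linear bounded_linear_fst bounded_linear_snd)+
  show ?thesis
    unfolding ell_def
    by (intro polynomial_function_Pair polynomial_function_diff polynomial_function_mult snd
        polynomial_function_jac_compound_mult real_polynomial_function_\<Phi>[unfolded real_polynomial_function_eq]
        polynomial_function_compose[OF fst f, unfolded o_def])
qed

end

section \<open>The projected flow\<close>

text \<open>The inequality makes \<open>q s * exp (- (c * s))\<close> nonincreasing. Neither
  \<open>q\<close> nor \<open>c\<close> has a prescribed sign: the lemma is also applied to minus a
  squared norm, which gives a lower bound, and with \<open>c = 0\<close>, which gives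
  monotonicity.\<close>

lemma gronwall:
  fixes q :: "real \<Rightarrow> real"
  assumes "0 \<le> t"
    and deriv: "\<And>s. 0 \<le> s \<Longrightarrow> s \<le> t \<Longrightarrow> (q has_real_derivative q' s) (at s within {0..})"
    and le: "\<And>s. 0 \<le> s \<Longrightarrow> s \<le> t \<Longrightarrow> q' s \<le> c * q s"
  shows "q t \<le> q 0 * exp (c * t)"
proof -
  let ?u = "\<lambda>s. q s * exp (- (c * s))"
  let ?u' = "\<lambda>s. (q' s - c * q s) * exp (- (c * s))"
  have "(?u has_derivative (*) (?u' s)) (at s within {0..t})" if "0 \<le> s" "s \<le> t" for s
  proof -
    have "(q has_real_derivative q' s) (at s within {0..t})"
      using deriv[OF that] by (rule DERIV_subset) auto
    then have "(?u has_real_derivative ?u' s) (at s within {0..t})"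
      by (auto intro!: derivative_eq_intros simp: algebra_simps)
    then show ?thesis by (simp add: has_field_derivative_def)
  qed
  from mvt_very_simple[OF \<open>0 \<le> t\<close> this]
  obtain s where s: "s \<in> {0..t}" "?u t - ?u 0 = ?u' s * (t - 0)" by blast
  have "(q' s - c * q s) * (exp (- (c * s)) * t) \<le> 0"
    using le[of s] s(1) \<open>0 \<le> t\<close> by (intro mult_nonpos_nonneg) auto
  then have "?u t \<le> q 0" using s(2) by (simp add: mult.assoc)
  then have "?u t * exp (c * t) \<le> q 0 * exp (c * t)" by (intro mult_right_mono) auto
  moreover have "?u t * exp (c * t) = q t" by (simp add: mult.assoc flip: exp_add)
  ultimately show ?thesis by simp
qed

section \<open>The specification of the product with the sphere\<close>

lemma semialgebraic_set_\<Omega>: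
  "semialgebraic_set (\<Omega>_ineqs gs) (\<Omega>_eqs hs :: ('a::euclidean_space \<times> 'b::euclidean_space \<Rightarrow> real) list)
    = semialgebraic_set gs hs \<times> sphere 0 1"
  unfolding semialgebraic_set_def \<Omega>_ineqs_def \<Omega>_eqs_def
  by (auto simp: power2_eq_1_iff) (use norm_ge_zero in \<open>smt (verit)\<close>)

lemma quadratic_module_\<Omega>_fst:
  assumes "p \<in> quadratic_module gs hs"
  shows "(\<lambda>w::'a::euclidean_space \<times> 'b::euclidean_space. p (fst w)) \<in> quadratic_module (\<Omega>_ineqs gs) (\<Omega>_eqs hs)"
proof -
  obtain \<sigma> \<rho> where p: "\<And>i. i \<le> length gs \<Longrightarrow> \<sigma> i \<in> sos"
    "\<And>j. j < length hs \<Longrightarrow> real_polynomial_function (\<rho> j)"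
    "\<And>w. p w = \<sigma> 0 w + (\<Sum>i<length gs. \<sigma> (Suc i) w * (gs ! i) w)
      + (\<Sum>j<length hs. \<rho> j w * (hs ! j) w)"
    using assms by (rule quadratic_moduleE) blast
  have fst: "polynomial_function (fst :: 'a \<times> 'b \<Rightarrow> _)"
    by (intro polynomial_function_bounded_linear bounded_linear_fst)
  have sos_fst: "(\<lambda>w::'a \<times> 'b. s (fst w)) \<in> sos" if "s \<in> sos" for s
  proof -
    obtain qs where "\<forall>q\<in>set qs. real_polynomial_function q" "s = (\<lambda>w. \<Sum>q\<leftarrow>qs. (q w)\<^sup>2)"
      using \<open>s \<in> sos\<close> unfolding sos_def by blast
    then show ?thesis
      using real_polynomial_function_compose[OF fst, unfolded o_def] unfolding sos_def
      by (intro CollectI exI[of _ "map (\<lambda>q w. q (fst w)) qs"]) (auto simp: o_def)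
  qed
  have "(\<lambda>w::'a \<times> 'b. \<sigma> (Suc i) (fst w) * (gs ! i) (fst w)) \<in> quadratic_module (\<Omega>_ineqs gs) (\<Omega>_eqs hs)"
    if "i < length gs" for i
  proof -
    have "(\<lambda>w::'a \<times> 'b. (gs ! i) (fst w)) \<in> set (\<Omega>_ineqs gs)"
      using that by (auto simp: \<Omega>_ineqs_def)
    from quadratic_module_mult[OF sos_fst[OF p(1)] ineq_in_quadratic_module[OF this]] that
    show ?thesis by simp
  qed
  moreover have "(\<lambda>w::'a \<times> 'b. \<rho> j (fst w) * (hs ! j) (fst w)) \<in> quadratic_module (\<Omega>_ineqs gs) (\<Omega>_eqs hs)"
    if "j < length hs" for j
  proof -
    have "(\<lambda>w::'a \<times> 'b. (hs ! j) (fst w)) \<in> set (\<Omega>_eqs hs)"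
      using that by (auto simp: \<Omega>_eqs_def)
    from eq_in_quadratic_module[OF this real_polynomial_function_compose[OF fst p(2)[OF that], unfolded o_def]]
    show ?thesis .
  qed
  ultimately show ?thesis
    unfolding p(3)
    by (intro quadratic_module_add quadratic_module_sum sos_subset_quadratic_module[OF sos_fst[OF p(1)]]) auto
qed

text \<open>The sphere equation with multiplier \<open>- 1\<close> adds \<open>1 - |z|^2\<close> to
  \<open>R^2 - |x|^2\<close>. The square root appears because \<open>archimedean_spec\<close> wants
  the constant as a square.\<close>

lemma archimedean_spec_\<Omega>:
  assumes "archimedean_spec gs hs"
  shows "archimedean_spec (\<Omega>_ineqs gs)
    (\<Omega>_eqs hs :: ('a::euclidean_space \<times> 'b::euclidean_space \<Rightarrow> real) list)"
proof -
  let ?M = "quadratic_module (\<Omega>_ineqs gs) (\<Omega>_eqs hs :: ('a \<times> 'b \<Rightarrow> real) list)"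
  obtain R where R: "(\<lambda>x. R\<^sup>2 - (norm x)\<^sup>2) \<in> quadratic_module gs hs"
    using assms unfolding archimedean_spec_def by blast
  have "(\<lambda>w. (norm (snd w))\<^sup>2 - 1) \<in> set (\<Omega>_eqs hs :: ('a \<times> 'b \<Rightarrow> real) list)"
    by (simp add: \<Omega>_eqs_def)
  from eq_in_quadratic_module[OF this real_polynomial_function.intros(2)[of "-1"]]
  have "(\<lambda>w::'a \<times> 'b. (R\<^sup>2 - (norm (fst w))\<^sup>2) + - 1 * ((norm (snd w))\<^sup>2 - 1)) \<in> ?M"
    by (intro quadratic_module_add quadratic_module_\<Omega>_fst[OF R])
  moreover have "(\<lambda>w::'a \<times> 'b. (R\<^sup>2 - (norm (fst w))\<^sup>2) + - 1 * ((norm (snd w))\<^sup>2 - 1))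
      = (\<lambda>w. (sqrt (R\<^sup>2 + 1))\<^sup>2 - (norm w)\<^sup>2)"
    by (rule ext) (simp add: norm_prod_def)
  ultimately have "(\<lambda>w. (sqrt (R\<^sup>2 + 1))\<^sup>2 - (norm w)\<^sup>2) \<in> ?M" by (simp only:)
  then show ?thesis unfolding archimedean_spec_def by (rule exI)
qed

lemma grad_partial:
  fixes V :: "'a::euclidean_space \<times> 'b::euclidean_space \<Rightarrow> real"
  assumes "GDERIV V (x, z) :> G"
  shows "grad (\<lambda>x'. V (x', z)) x = fst G" and "grad (\<lambda>z'. V (x, z')) z = snd G"
proof -
  have V: "(V has_derivative (\<lambda>h. h \<bullet> G)) (at (x, z))" using assms unfolding gderiv_def .
  have "((\<lambda>x'. (x', z)) has_derivative (\<lambda>h. (h, 0))) (at x)"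
    by (auto intro!: derivative_eq_intros)
  from has_derivative_compose[OF this V] show "grad (\<lambda>x'. V (x', z)) x = fst G"
    by (intro grad_eq) (simp add: gderiv_def inner_prod_def)
  have "((\<lambda>z'. (x, z')) has_derivative (\<lambda>h. (0, h))) (at z)"
    by (auto intro!: derivative_eq_intros)
  from has_derivative_compose[OF this V] show "grad (\<lambda>z'. V (x, z')) z = snd G"
    by (intro grad_eq) (simp add: gderiv_def inner_prod_def)
qed

section \<open>The flow induced on the unit sphere\<close>

definition projected_field ::
  "nat \<Rightarrow> ('n::{finite,linorder} rvec \<Rightarrow> 'n rvec) \<Rightarrow> 'n rvec \<times> 'm::{finite,linorder} rvec \<Rightarrow> 'n rvec \<times> 'm rvec"
where
  "projected_field k f w = (f (fst w), ell k f (fst w) (snd w))"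

abbreviation projected_rate ::
  "nat \<Rightarrow> ('n::{finite,linorder} rvec \<Rightarrow> 'n rvec) \<Rightarrow> 'n rvec \<times> 'm::{finite,linorder} rvec \<Rightarrow> real"
where
  "projected_rate k f w \<equiv> \<Phi> k f (fst w) (snd w)"

lemma \<Phi>_scaleR: "\<Phi> k f x (a *\<^sub>R z) = a\<^sup>2 * \<Phi> k f x z"
  unfolding \<Phi>_def by (simp add: matrix_vector_mult_scaleR power2_eq_square)

context
  fixes f :: "'n::{finite,linorder} rvec \<Rightarrow> 'n rvec" and k :: nat
  assumes f: "polynomial_function f"
begin

lemma continuous_on_\<Phi>: "continuous_on X (projected_rate k f :: 'n rvec \<times> 'm::{finite,linorder} rvec \<Rightarrow> real)"
  by (rule continuous_on_polymonial_function[OF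
        real_polynomial_function_\<Phi>[OF f, unfolded real_polynomial_function_eq]])

text \<open>By the definition of \<open>ell\<close>, \<open>|z|^2 - 1\<close> decays at the rate
  \<open>2 \<Phi>\<close>, so its square \<open>q\<close> satisfies \<open>q' = - 4 \<Phi> q\<close>
  with \<open>q 0 = 0\<close>. The Gronwall bound forces \<open>q\<close> to stay 0.\<close>

lemma forward_invariant_projected_field:
  assumes "forward_invariant f B"
  shows "forward_invariant (projected_field k f) (B \<times> (sphere 0 1 :: 'm::{finite,linorder} rvec set))"
  unfolding forward_invariant_def
proof (intro ballI allI impI)
  fix w0 T and w :: "real \<Rightarrow> 'n rvec \<times> 'm rvec" and t :: real
  assume w0: "w0 \<in> B \<times> sphere 0 1" and traj: "trajectory (projected_field k f) w0 T w"
    and t: "0 \<le> t" "ereal t < T"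
  define x z where "x = (\<lambda>s. fst (w s))" and "z = (\<lambda>s. snd (w s))"
  have w_deriv: "(w has_vector_derivative projected_field k f (w s)) (at s within {0..})"
    if "0 \<le> s" "ereal s < T" for s
    using traj that unfolding trajectory_def by blast
  have x_deriv: "(x has_vector_derivative f (x s)) (at s within {0..})"
    and z_deriv: "(z has_vector_derivative ell k f (x s) (z s)) (at s within {0..})"
    if "0 \<le> s" "ereal s < T" for s
    using has_derivative_fst[OF w_deriv[OF that, unfolded has_vector_derivative_def]]
      has_derivative_snd[OF w_deriv[OF that, unfolded has_vector_derivative_def]]
    unfolding has_vector_derivative_def x_def z_def projected_field_def by simp_all
  have "trajectory f (fst w0) T x"
    unfolding trajectory_def using x_deriv traj by (auto simp: trajectory_def x_def)
  then have xB: "x t \<in> B"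
    using assms w0 t unfolding forward_invariant_def by auto
  have le_t: "ereal s < T" if "s \<le> t" for s
    using that t(2) by (metis ereal_less_eq(3) le_less_trans)
  have "continuous_on {0..t} w"
  proof (rule continuous_on_vector_derivative)
    show "(w has_vector_derivative projected_field k f (w s)) (at s within {0..t})" if "s \<in> {0..t}" for s
      using that le_t[of s] by (intro has_vector_derivative_within_subset[OF w_deriv]) auto
  qed
  then have "continuous_on {0..t} (\<lambda>s. \<Phi> k f (x s) (z s))"
    unfolding x_def z_def by (rule continuous_on_compose2[OF continuous_on_\<Phi>]) auto
  then have "bounded ((\<lambda>s. \<Phi> k f (x s) (z s)) ` {0..t})"
    by (intro compact_imp_bounded compact_continuous_image) auto
  \<comment> \<open>The bound is taken along the given solution on \<open>[0, t]\<close>, because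
    the size of \<open>z\<close> is not yet under control.\<close>
  then obtain c where c: "\<And>s. s \<in> {0..t} \<Longrightarrow> \<bar>\<Phi> k f (x s) (z s)\<bar> \<le> c"
    unfolding bounded_iff real_norm_def by blast
  define q where "q = (\<lambda>s. (z s \<bullet> z s - 1)\<^sup>2)"
  have "q t \<le> q 0 * exp (4 * c * t)"
  proof (rule gronwall[OF t(1)])
    fix s assume s: "0 \<le> s" "s \<le> t"
    let ?P = "\<Phi> k f (x s) (z s)"
    have zell: "z s \<bullet> ell k f (x s) (z s) = ?P - ?P * (z s \<bullet> z s)"
      unfolding ell_def \<Phi>_def by (simp add: inner_diff_right)
    note zd = z_deriv[OF s(1) le_t[OF s(2)], unfolded has_vector_derivative_def]
    from has_derivative_inner[OF zd zd]
    have "((\<lambda>s. z s \<bullet> z s) has_real_derivative 2 * (?P - ?P * (z s \<bullet> z s))) (at s within {0..})"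
      unfolding has_field_derivative_def by (rule has_derivative_eq_rhs) (auto simp: zell inner_commute[of "ell _ _ _ _"])
    then have "(q has_real_derivative 2 * (z s \<bullet> z s - 1) * (2 * (?P - ?P * (z s \<bullet> z s)))) (at s within {0..})"
      unfolding q_def by (auto intro!: derivative_eq_intros)
    moreover have "2 * (z s \<bullet> z s - 1) * (2 * (?P - ?P * (z s \<bullet> z s))) = - (4 * ?P * q s)"
      unfolding q_def by (simp add: power2_eq_square algebra_simps)
    ultimately show "(q has_real_derivative - (4 * ?P * q s)) (at s within {0..})" by simp
    have "- ?P * q s \<le> c * q s" using c[of s] s unfolding q_def by (intro mult_right_mono) auto
    then have "4 * (- ?P * q s) \<le> 4 * (c * q s)" by (rule mult_left_mono) simp
    then show "- (4 * ?P * q s) \<le> 4 * c * q s"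
      by (simp only: mult_minus_left mult_minus_right mult.assoc)
  qed
  moreover have "z 0 \<bullet> z 0 = 1"
    using w0 traj unfolding z_def trajectory_def by (auto simp: dot_square_norm)
  ultimately have "q t \<le> 0" unfolding q_def by simp
  then have "z t \<bullet> z t = 1" unfolding q_def by simp
  then have "norm (z t) = 1" by (simp add: norm_eq_sqrt_inner)
  then show "w t \<in> B \<times> sphere 0 1" using xB unfolding x_def z_def by (simp add: mem_Times_iff)
qed

text \<open>Dividing by the norm removes the radial part of the linear equation, and that part is
  exactly the growth rate of \<open>ln (norm (y t))\<close>. The division requires that
  \<open>y\<close> never vanishes, which is shown first.\<close>

lemma normalized_solution:
  fixes y :: "real \<Rightarrow> 'm::{finite,linorder} rvec"
  assumes inv: "forward_invariant f B" and "x0 \<in> B" and x: "trajectory f x0 \<infinity> x" and y0: "norm (y 0) = 1"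
    and y: "\<And>t. 0 \<le> t \<Longrightarrow> (y has_vector_derivative jac_compound k f (x t) *v y t) (at t within {0..})"
  shows "averaged_solution (projected_field k f) (projected_rate k f) (B \<times> sphere 0 1)
    (\<lambda>t. (x t, (1 / norm (y t)) *\<^sub>R y t)) (\<lambda>t. ln (norm (y t)))"
proof -
  have xd: "(x has_vector_derivative f (x t)) (at t within {0..})" if "0 \<le> t" for t
    using x that unfolding trajectory_def by simp
  have xB: "x t \<in> B" if "0 \<le> t" for t
    using inv x \<open>x0 \<in> B\<close> that unfolding forward_invariant_def by force
  have contx: "continuous_on {0..t} x" for t
  proof (rule continuous_on_vector_derivative)
    show "(x has_vector_derivative f (x s)) (at s within {0..t})" if "s \<in> {0..t}" for s
      using that by (intro has_vector_derivative_within_subset[OF xd]) auto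
  qed
  have rd: "((\<lambda>t. y t \<bullet> y t) has_real_derivative 2 * \<Phi> k f (x t) (y t)) (at t within {0..})" if "0 \<le> t" for t
  proof -
    note yd = y[OF that, unfolded has_vector_derivative_def]
    from has_derivative_inner[OF yd yd] show ?thesis
      unfolding has_field_derivative_def
      by (rule has_derivative_eq_rhs) (auto simp: \<Phi>_def inner_commute[of "_ *v _"])
  qed
  have pos: "y t \<noteq> 0" if "0 \<le> t" for t
  proof -
    have "compact (x ` {0..t} \<times> (sphere 0 1 :: 'm rvec set))"
      by (intro compact_Times compact_continuous_image contx) auto
    then have "bounded (projected_rate k f ` (x ` {0..t} \<times> (sphere 0 1 :: 'm rvec set)))"
      by (intro compact_imp_bounded compact_continuous_image continuous_on_\<Phi>)
    then obtain c where c: "\<And>s z. s \<in> {0..t} \<Longrightarrow> norm (z :: 'm rvec) = 1 \<Longrightarrow> \<bar>\<Phi> k f (x s) z\<bar> \<le> c"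
      unfolding bounded_iff real_norm_def by fastforce
    \<comment> \<open>A lower bound for the squared norm is obtained by applying Gronwall to its
      negative; \<open>c\<close> bounds the growth rate over unit vectors along \<open>x\<close>,
      and homogeneity of \<open>\<Phi>\<close> carries it over to \<open>y\<close>.\<close>
    have "- (y t \<bullet> y t) \<le> - (y 0 \<bullet> y 0) * exp (- (2 * c) * t)"
    proof (rule gronwall[OF that])
      fix s assume s: "0 \<le> s" "s \<le> t"
      show "((\<lambda>s. - (y s \<bullet> y s)) has_real_derivative - (2 * \<Phi> k f (x s) (y s))) (at s within {0..})"
        by (intro DERIV_minus rd s)
      have "y s = norm (y s) *\<^sub>R sgn (y s)" by (cases "y s = 0") (simp_all add: sgn_div_norm)
      then have eq: "\<Phi> k f (x s) (y s) = (norm (y s))\<^sup>2 * \<Phi> k f (x s) (sgn (y s))" by (metis \<Phi>_scaleR)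
      have "- \<Phi> k f (x s) (y s) \<le> c * (norm (y s))\<^sup>2"
      proof (cases "y s = 0")
        case False
        then have "- \<Phi> k f (x s) (sgn (y s)) \<le> c" using c[of s "sgn (y s)"] s by (auto simp: norm_sgn)
        from mult_left_mono[OF this, of "(norm (y s))\<^sup>2"] show ?thesis unfolding eq by (simp add: mult.commute)
      qed (simp add: \<Phi>_def)
      then show "- (2 * \<Phi> k f (x s) (y s)) \<le> - (2 * c) * - (y s \<bullet> y s)"
        by (simp add: dot_square_norm)
    qed
    moreover have "y 0 \<bullet> y 0 = 1" using y0 by (simp add: dot_square_norm)
    ultimately have "exp (- (2 * c) * t) \<le> y t \<bullet> y t" by simp
    then show "y t \<noteq> 0" by (metis exp_gt_zero inner_zero_left leD)
  qed
  \<comment> \<open>Using the squared norm avoids differentiating a norm, and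
    \<open>exp (- l t)\<close> makes the derivative of \<open>z\<close> a plain product rule. Both
    agree with the functions in the statement for \<open>t \<ge> 0\<close> only, so the derivatives
    are transferred at the end.\<close>
  define l where "l = (\<lambda>t. ln (y t \<bullet> y t) / 2)"
  define z where "z = (\<lambda>t. exp (- l t) *\<^sub>R y t)"
  have l: "l t = ln (norm (y t))" if "0 \<le> t" for t
    using pos[OF that] unfolding l_def by (simp add: dot_square_norm ln_realpow)
  have zeq: "z t = (1 / norm (y t)) *\<^sub>R y t" if "0 \<le> t" for t
    using pos[OF that] unfolding z_def by (simp add: l[OF that] exp_minus inverse_eq_divide)
  have znorm: "norm (z t) = 1" if "0 \<le> t" for t
    using pos[OF that] unfolding zeq[OF that] by simp
  have ld: "(l has_real_derivative \<Phi> k f (x t) (z t)) (at t within {0..})" if "0 \<le> t" for t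
  proof -
    have "0 < y t \<bullet> y t" using pos[OF that] by simp
    from DERIV_cdivide[OF DERIV_chain2[OF DERIV_ln_divide[OF this] rd[OF that]], of 2]
    have "(l has_real_derivative 1 / (y t \<bullet> y t) * (2 * \<Phi> k f (x t) (y t)) / 2) (at t within {0..})"
      unfolding l_def .
    moreover have "1 / (y t \<bullet> y t) * (2 * \<Phi> k f (x t) (y t)) / 2 = \<Phi> k f (x t) (z t)"
      unfolding zeq[OF that] \<Phi>_scaleR by (simp add: dot_square_norm power_divide)
    ultimately show ?thesis by simp
  qed
  have zd: "(z has_vector_derivative ell k f (x t) (z t)) (at t within {0..})" if "0 \<le> t" for t
  proof -
    have "((\<lambda>t. exp (- l t)) has_real_derivative exp (- l t) * - \<Phi> k f (x t) (z t)) (at t within {0..})"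
      using ld[OF that] by (auto intro!: derivative_eq_intros)
    from has_vector_derivative_scaleR[OF this y[OF that]]
    have "(z has_vector_derivative exp (- l t) *\<^sub>R (jac_compound k f (x t) *v y t)
        + (exp (- l t) * - \<Phi> k f (x t) (z t)) *\<^sub>R y t) (at t within {0..})"
      unfolding z_def .
    moreover have "exp (- l t) *\<^sub>R (jac_compound k f (x t) *v y t) + (exp (- l t) * - \<Phi> k f (x t) (z t)) *\<^sub>R y t
        = ell k f (x t) (z t)"
      unfolding ell_def by (simp add: z_def matrix_vector_mult_scaleR mult.commute)
    ultimately show ?thesis by simp
  qed
  have "averaged_solution (projected_field k f) (projected_rate k f) (B \<times> sphere 0 1) (\<lambda>t. (x t, z t)) l"
    unfolding averaged_solution_def
  proof (intro conjI allI impI)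
    fix t :: real assume t: "0 \<le> t"
    show "(x t, z t) \<in> B \<times> sphere 0 1" using xB[OF t] znorm[OF t] by simp
    show "((\<lambda>t. (x t, z t)) has_vector_derivative projected_field k f (x t, z t)) (at t within {0..})"
      unfolding projected_field_def fst_conv snd_conv
      by (intro has_vector_derivative_Pair xd zd t)
    show "(l has_vector_derivative projected_rate k f (x t, z t)) (at t within {0..})"
      using ld[OF t] by (simp add: has_real_derivative_iff_has_vector_derivative)
  next
    show "l 0 = 0" using y0 by (simp add: l)
  qed
  then show ?thesis
    unfolding averaged_solution_def using l zeq
    by (auto elim!: has_vector_derivative_transform[rotated 2])
qed

end

section \<open>The two inequalities between exponents and polynomial bounds\<close>

lemma Limsup_average_le:
  assumes "\<And>t. 0 < t \<Longrightarrow> I t \<le> B * t + M"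
  shows "Limsup at_top (\<lambda>t. ereal (1 / t * I t)) \<le> ereal B"
proof -
  have "((\<lambda>t::real. M * inverse t) \<longlongrightarrow> M * 0) at_top"
    by (intro tendsto_intros tendsto_inverse_0_at_top filterlim_ident)
  then have "((\<lambda>t::real. B + M * inverse t) \<longlongrightarrow> B + 0) at_top"
    by (intro tendsto_intros) simp
  then have lim: "((\<lambda>t::real. ereal (B + M * inverse t)) \<longlongrightarrow> ereal B) at_top" by simp
  have "eventually (\<lambda>t. ereal (1 / t * I t) \<le> ereal (B + M * inverse t)) at_top"
    using eventually_gt_at_top[of 0]
  proof eventually_elim
    case (elim t)
    then have "1 / t * I t \<le> 1 / t * (B * t + M)" using assms by (intro mult_left_mono) auto
    also have "\<dots> = B + M * inverse t" using elim by (simp add: field_simps)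
    finally show ?case by simp
  qed
  then have "Limsup at_top (\<lambda>t. ereal (1 / t * I t)) \<le> Limsup at_top (\<lambda>t::real. ereal (B + M * inverse t))"
    by (rule Limsup_mono)
  also have "\<dots> = ereal B" using lim by (intro lim_imp_Limsup) auto
  finally show ?thesis .
qed

text \<open>The partial gradients in \<open>C1\<close> are the two blocks of the full gradient, so
  the constraint becomes one inner product on the product space. It is an equality of functions,
  hence usable inside membership in the module.\<close>

lemma C1_constraint_eq:
  fixes V :: "'n::{finite,linorder} rvec \<times> 'm::{finite,linorder} rvec \<Rightarrow> real"
  assumes "\<And>w. GDERIV V w :> G w"
  shows "(\<lambda>(x, z). B - \<Phi> k f x z - f x \<bullet> grad (\<lambda>x'. V (x', z)) x - ell k f x z \<bullet> grad (\<lambda>z'. V (x, z')) z)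
    = (\<lambda>w. B - projected_rate k f w - projected_field k f w \<bullet> G w)"
  using grad_partial[OF assms]
  by (auto simp: fun_eq_iff projected_field_def inner_prod_def)

text \<open>Nonnegativity of the constraint on the product set says that \<open>I + V - B s\<close>
  does not increase along the flow. As the trajectory is bounded, so is \<open>V\<close> on it, by a
  constant that may depend on the trajectory and disappears after division by
  \<open>t\<close>.\<close>

lemma lyapunov_sum_le_C1:
  fixes f :: "'n::{finite,linorder} rvec \<Rightarrow> 'n rvec"
  assumes f: "polynomial_function f" and inv: "forward_invariant f (semialgebraic_set gs hs)"
    and bdd: "bounded_trajectories f (semialgebraic_set gs hs)" and x0: "x0 \<in> semialgebraic_set gs hs"
  shows "lyapunov_sum TYPE('m::{finite,linorder}) k f x0 \<le> C1 TYPE('m) f gs hs k \<nu> \<nu>'"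
  unfolding C1_def lyapunov_sum_def
proof (rule Inf_greatest, rule Sup_least, clarify)
  fix B and V :: "'n rvec \<times> 'm rvec \<Rightarrow> real" and x and y :: "real \<Rightarrow> 'm rvec"
  assume V: "V \<in> polys_upto \<nu>"
    and qm: "(\<lambda>(x, z). B - \<Phi> k f x z - f x \<bullet> grad (\<lambda>x'. V (x', z)) x - ell k f x z \<bullet> grad (\<lambda>z'. V (x, z')) z)
       \<in> quadratic_module_upto \<nu>' (\<Omega>_ineqs gs) (\<Omega>_eqs hs)"
    and x: "trajectory f x0 \<infinity> x" and y0: "y 0 \<in> sphere 0 1"
    and y: "\<forall>t\<ge>0. (y has_vector_derivative jac_compound k f (x t) *v y t) (at t within {0..})"
  have Vp: "real_polynomial_function V" using V by (rule polys_upto_imp_real_polynomial_function)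
  obtain G where G: "\<And>w. GDERIV V w :> G w" using real_polynomial_function_gderiv[OF Vp] by blast
  let ?\<Omega> = "semialgebraic_set gs hs \<times> (sphere 0 1 :: 'm rvec set)"
  have ineq: "projected_rate k f w + projected_field k f w \<bullet> G w \<le> B" if "w \<in> ?\<Omega>" for w
    using quadratic_module_upto_nonneg[OF qm[unfolded C1_constraint_eq[OF G]], of w] that
    unfolding semialgebraic_set_\<Omega> by simp
  define w where "w = (\<lambda>t. (x t, (1 / norm (y t)) *\<^sub>R y t))"
  define I where "I = (\<lambda>t. ln (norm (y t)))"
  have sol: "averaged_solution (projected_field k f) (projected_rate k f) ?\<Omega> w I"
    unfolding w_def I_def using y0 y by (intro normalized_solution[OF f inv x0 x]) auto
  have "bounded (x ` {t. 0 \<le> t \<and> ereal t < \<infinity>})"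
    using bdd x x0 unfolding bounded_trajectories_def by blast
  then obtain R where R: "\<And>t. 0 \<le> t \<Longrightarrow> norm (x t) \<le> R" unfolding bounded_iff by auto
  have "bounded (V ` (cball 0 R \<times> sphere 0 1))"
    using Vp by (intro compact_imp_bounded compact_continuous_image compact_Times
        continuous_on_polymonial_function) (auto simp: real_polynomial_function_eq)
  then obtain M where M: "\<And>v. v \<in> cball 0 R \<times> sphere 0 1 \<Longrightarrow> \<bar>V v\<bar> \<le> M"
    unfolding bounded_iff real_norm_def by blast
  have VM: "\<bar>V (w t)\<bar> \<le> M" if "0 \<le> t" for t
    using R[OF that] averaged_solutionD(1)[OF sol that] by (intro M) (auto simp: w_def)
  have "I t \<le> B * t + 2 * M" if "0 < t" for t
  proof -
    have "(\<lambda>s. I s + V (w s) - B * s) t \<le> (\<lambda>s. I s + V (w s) - B * s) 0 * exp (0 * t)"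
    proof (rule gronwall)
      fix s :: real assume s: "0 \<le> s" "s \<le> t"
      have "(w has_derivative (\<lambda>h. h *\<^sub>R projected_field k f (w s))) (at s within {0..})"
        using averaged_solutionD(2)[OF sol s(1) order_refl] unfolding has_vector_derivative_def .
      from has_derivative_compose[OF this G[unfolded gderiv_def]]
      have "((\<lambda>s. V (w s)) has_real_derivative projected_field k f (w s) \<bullet> G (w s)) (at s within {0..})"
        unfolding has_field_derivative_def by (simp add: mult_commute_abs)
      moreover have "(I has_real_derivative projected_rate k f (w s)) (at s within {0..})"
        using averaged_solutionD(3)[OF sol s(1) order_refl]
        unfolding has_real_derivative_iff_has_vector_derivative .
      ultimately show "((\<lambda>s. I s + V (w s) - B * s) has_real_derivative
          projected_rate k f (w s) + projected_field k f (w s) \<bullet> G (w s) - B) (at s within {0..})"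
        by (auto intro!: derivative_eq_intros)
      show "projected_rate k f (w s) + projected_field k f (w s) \<bullet> G (w s) - B \<le> 0 * (I s + V (w s) - B * s)"
        using ineq[OF averaged_solutionD(1)[OF sol s(1)]] by simp
    qed (use that in auto)
    then have "I t \<le> B * t + (V (w 0) - V (w t))" using averaged_solutionD(4)[OF sol order_refl] by simp
    also have "\<dots> \<le> B * t + 2 * M" using VM[of 0] VM[of t] that by (auto simp: abs_le_iff)
    finally show ?thesis .
  qed
  then show "Limsup at_top (\<lambda>t. ereal (1 / t * ln (norm (y t)))) \<le> ereal B"
    unfolding I_def by (rule Limsup_average_le)
qed

text \<open>The normalisation is undone by \<open>y = exp (I t) z\<close>, which solves the linear
  equation and has norm \<open>exp (I t)\<close>. So every long-time average over the projected flow
  is among those whose supremum is the exponent sum.\<close>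

lemma solution_lyapunov_le:
  fixes f :: "'n::{finite,linorder} rvec \<Rightarrow> 'n rvec"
  assumes sol: "averaged_solution (projected_field k f) (projected_rate k f) (S \<times> (sphere 0 1 :: 'm::{finite,linorder} rvec set)) w I"
  shows "Limsup at_top (\<lambda>t. ereal (1 / t * I t)) \<le> lyapunov_sum TYPE('m) k f (fst (w 0))"
proof -
  define x z where "x = (\<lambda>t. fst (w t))" and "z = (\<lambda>t. snd (w t))"
  define y where "y = (\<lambda>t. exp (I t) *\<^sub>R z t)"
  have xd: "(x has_vector_derivative f (x t)) (at t within {0..})"
    and zd: "(z has_vector_derivative ell k f (x t) (z t)) (at t within {0..})"
    and Id: "(I has_real_derivative \<Phi> k f (x t) (z t)) (at t within {0..})"
    and zn: "norm (z t) = 1" if "0 \<le> t" for t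
  proof -
    note D = averaged_solutionD[OF sol that]
    show "(x has_vector_derivative f (x t)) (at t within {0..})"
      "(z has_vector_derivative ell k f (x t) (z t)) (at t within {0..})"
      using has_derivative_fst[OF D(2)[OF order_refl, unfolded has_vector_derivative_def]]
        has_derivative_snd[OF D(2)[OF order_refl, unfolded has_vector_derivative_def]]
      unfolding has_vector_derivative_def x_def z_def projected_field_def by simp_all
    show "(I has_real_derivative \<Phi> k f (x t) (z t)) (at t within {0..})"
      using D(3)[OF order_refl] unfolding x_def z_def has_real_derivative_iff_has_vector_derivative .
    show "norm (z t) = 1" using D(1) unfolding z_def by (auto simp: mem_Times_iff)
  qed
  have I0: "I 0 = 0" using averaged_solutionD(4)[OF sol order_refl] .
  have "(y has_vector_derivative jac_compound k f (x t) *v y t) (at t within {0..})" if "0 \<le> t" for t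
  proof -
    have "((\<lambda>t. exp (I t)) has_real_derivative exp (I t) * \<Phi> k f (x t) (z t)) (at t within {0..})"
      using Id[OF that] by (auto intro!: derivative_eq_intros)
    from has_vector_derivative_scaleR[OF this zd[OF that]]
    have "(y has_vector_derivative exp (I t) *\<^sub>R ell k f (x t) (z t)
        + (exp (I t) * \<Phi> k f (x t) (z t)) *\<^sub>R z t) (at t within {0..})"
      unfolding y_def .
    moreover have "exp (I t) *\<^sub>R ell k f (x t) (z t) + (exp (I t) * \<Phi> k f (x t) (z t)) *\<^sub>R z t
        = jac_compound k f (x t) *v y t"
      unfolding ell_def by (simp add: y_def matrix_vector_mult_scaleR scaleR_diff_right)
    ultimately show ?thesis by simp
  qed
  moreover have "trajectory f (x 0) \<infinity> x" unfolding trajectory_def using xd by simp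
  moreover have "y 0 \<in> sphere 0 1" unfolding y_def using I0 zn[of 0] by simp
  ultimately have "Limsup at_top (\<lambda>t. ereal (1 / t * ln (norm (y t)))) \<le> lyapunov_sum TYPE('m) k f (x 0)"
    unfolding lyapunov_sum_def by (intro Sup_upper) blast
  moreover have "Limsup at_top (\<lambda>t. ereal (1 / t * ln (norm (y t)))) = Limsup at_top (\<lambda>t. ereal (1 / t * I t))"
  proof (rule Limsup_eq)
    show "eventually (\<lambda>t. ereal (1 / t * ln (norm (y t))) = ereal (1 / t * I t)) at_top"
      using eventually_ge_at_top[of 0]
    proof eventually_elim
      case (elim t)
      have "norm (y t) = exp (I t)" unfolding y_def using zn[OF elim] by simp
      then show ?case by simp
    qed
  qed
  ultimately show ?thesis unfolding x_def by simp
qed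

text \<open>The supremum lies strictly below \<open>b\<close>, so each solution has a time with
  average below \<open>b\<close>; the second gap, from \<open>b\<close> to \<open>b'\<close>, makes
  the constraint strictly positive on the product set as \<open>putinar\<close> demands. A
  certificate, once found, has some finite degrees.\<close>

lemma C1_less:
  fixes f :: "'n::{finite,linorder} rvec \<Rightarrow> 'n rvec"
  assumes f: "polynomial_function f"
    and gs: "\<forall>g\<in>set gs. real_polynomial_function g"
    and hs: "\<forall>h\<in>set hs. real_polynomial_function h"
    and inv: "forward_invariant f (semialgebraic_set gs hs)"
    and "compact (semialgebraic_set gs hs)" and arch: "archimedean_spec gs hs"
    and less: "(SUP x0\<in>semialgebraic_set gs hs. lyapunov_sum TYPE('m::{finite,linorder}) k f x0) < ereal b'"
  shows "\<exists>\<nu> \<nu>'. C1 TYPE('m) f gs hs k \<nu> \<nu>' \<le> ereal b'"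
proof -
  let ?B = "semialgebraic_set gs hs"
  let ?\<Omega> = "?B \<times> (sphere 0 1 :: 'm rvec set)"
  let ?F = "projected_field k f :: 'n rvec \<times> 'm rvec \<Rightarrow> _"
  obtain b where b: "(SUP x0\<in>?B. lyapunov_sum TYPE('m) k f x0) < ereal b" "b < b'"
    using ereal_dense2[OF less] by auto
  have F: "polynomial_function ?F"
    unfolding projected_field_def[abs_def] by (rule polynomial_function_projected_field[OF f])
  note P = real_polynomial_function_\<Phi>[OF f, of k, where 'm = 'm]
  have comp: "compact ?\<Omega>" using assms(5) by (intro compact_Times) auto
  have "\<exists>V. real_polynomial_function V \<and>
      (\<forall>w\<in>?\<Omega>. \<forall>G. GDERIV V w :> G \<longrightarrow> projected_rate k f w + ?F w \<bullet> G < b')"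
  proof (rule exists_polynomial_storage[OF F P comp _ _ b(2)])
    show "\<exists>w' I. averaged_solution ?F (projected_rate k f) ?\<Omega> w' I \<and> w' 0 = w" if "w \<in> ?\<Omega>" for w
      using that by (intro forward_invariant_solution F P comp forward_invariant_projected_field[OF f inv])
    fix w I assume sol: "averaged_solution ?F (projected_rate k f) ?\<Omega> w I"
    have "fst (w 0) \<in> ?B" using averaged_solutionD(1)[OF sol order_refl] by (auto simp: mem_Times_iff)
    then have "lyapunov_sum TYPE('m) k f (fst (w 0)) \<le> (SUP x0\<in>?B. lyapunov_sum TYPE('m) k f x0)"
      by (rule SUP_upper)
    with solution_lyapunov_le[OF sol] b(1)
    have "Limsup at_top (\<lambda>t. ereal (1 / t * I t)) < ereal b" by (meson le_less_trans order_trans)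
    then have "eventually (\<lambda>t. ereal (1 / t * I t) < ereal b) at_top" by (rule Limsup_lessD)
    then have "eventually (\<lambda>t. ereal (1 / t * I t) < ereal b \<and> 0 < t) at_top"
      using eventually_gt_at_top[of 0] by (rule eventually_conj)
    \<comment> \<open>A limsup below \<open>b\<close> holds the average below \<open>b\<close> for
      all large times; one positive time is enough.\<close>
    then obtain t where "ereal (1 / t * I t) < ereal b" "0 < t"
      by (metis (mono_tags, lifting) eventually_happens trivial_limit_at_top_linorder)
    then have "I t < b * t" by (simp add: pos_divide_less_eq)
    then show "\<exists>t>0. I t < b * t" using \<open>0 < t\<close> by blast
  qed
  then obtain V where V: "real_polynomial_function V"
    "\<And>w G. w \<in> ?\<Omega> \<Longrightarrow> GDERIV V w :> G \<Longrightarrow> projected_rate k f w + ?F w \<bullet> G < b'"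
    by blast
  obtain G where Gp: "polynomial_function G" and G: "\<And>w. GDERIV V w :> G w"
    using real_polynomial_function_gderiv[OF V(1)] by blast
  let ?p = "\<lambda>w. b' - projected_rate k f w - ?F w \<bullet> G w"
  have "real_polynomial_function (\<lambda>w. \<Sum>b\<in>Basis. (?F w \<bullet> b) * (G w \<bullet> b))"
    using F Gp unfolding polynomial_function_iff_Basis_inner
    by (intro real_polynomial_function_sum real_polynomial_function.intros(4)) auto
  moreover have "(\<lambda>w. ?F w \<bullet> G w) = (\<lambda>w. \<Sum>b\<in>Basis. (?F w \<bullet> b) * (G w \<bullet> b))"
    by (rule ext) (rule euclidean_inner)
  ultimately have "real_polynomial_function (\<lambda>w. ?F w \<bullet> G w)" by (simp only:)
  then have p: "real_polynomial_function ?p"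
    by (intro real_polynomial_function_diff real_polynomial_function.intros(2) P)
  have fst: "polynomial_function (fst :: 'n rvec \<times> 'm rvec \<Rightarrow> _)"
    and snd: "polynomial_function (snd :: 'n rvec \<times> 'm rvec \<Rightarrow> _)"
    by (intro polynomial_function_bounded_linear bounded_linear_fst bounded_linear_snd)+
  have "?p \<in> quadratic_module (\<Omega>_ineqs gs) (\<Omega>_eqs hs)"
  proof (rule putinar[OF _ _ archimedean_spec_\<Omega>[OF arch] p])
    show "real_polynomial_function g" if "g \<in> set (\<Omega>_ineqs gs)" for g :: "'n rvec \<times> 'm rvec \<Rightarrow> real"
      using that gs real_polynomial_function_compose[OF fst, unfolded o_def] by (auto simp: \<Omega>_ineqs_def)
    have "real_polynomial_function (\<lambda>w::'n rvec \<times> 'm rvec. (norm (snd w))\<^sup>2 - 1)"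
      unfolding power2_norm_eq_inner inner_vec_def inner_real_def
      using snd[unfolded polynomial_function_iff_nth]
      by (intro real_polynomial_function_diff real_polynomial_function_sum real_polynomial_function.intros(2,4)) auto
    then show "real_polynomial_function h" if "h \<in> set (\<Omega>_eqs hs)" for h :: "'n rvec \<times> 'm rvec \<Rightarrow> real"
      using that hs real_polynomial_function_compose[OF fst, unfolded o_def] by (auto simp: \<Omega>_eqs_def)
    show "0 < ?p w" if "w \<in> semialgebraic_set (\<Omega>_ineqs gs) (\<Omega>_eqs hs)" for w
      using V(2)[OF that[unfolded semialgebraic_set_\<Omega>] G] by simp
  qed
  then obtain \<nu>' where "?p \<in> quadratic_module_upto \<nu>' (\<Omega>_ineqs gs) (\<Omega>_eqs hs)"
    using quadratic_module_imp_upto by blast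
  moreover obtain \<nu> where "V \<in> polys_upto \<nu>" using real_polynomial_function_imp_polys_upto[OF V(1)] by blast
  ultimately have "C1 TYPE('m) f gs hs k \<nu> \<nu>' \<le> ereal b'"
    unfolding C1_def C1_constraint_eq[OF G, symmetric] by (intro Inf_lower) blast
  then show ?thesis by blast
qed

theorem proposition2p16:
  fixes f :: "'n::{finite,linorder} rvec \<Rightarrow> 'n rvec"
    and gs hs :: "('n rvec \<Rightarrow> real) list"
    and k :: nat
  assumes "polynomial_function f"
    and "\<forall>g\<in>set gs. real_polynomial_function g"
    and "\<forall>h\<in>set hs. real_polynomial_function h"
    and "forward_invariant f (semialgebraic_set gs hs)"
    and "1 \<le> k" and "k \<le> CARD('n)"
    and "CARD('m::{finite,linorder}) = CARD('n) choose k"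
  shows "(bounded_trajectories f (semialgebraic_set gs hs) \<longrightarrow>
            (\<forall>\<nu> \<nu>'. (SUP x0\<in>semialgebraic_set gs hs. lyapunov_sum TYPE('m) k f x0)
                      \<le> C1 TYPE('m) f gs hs k \<nu> \<nu>'))
       \<and> (compact (semialgebraic_set gs hs) \<and> archimedean_spec gs hs \<longrightarrow>
            (SUP x0\<in>semialgebraic_set gs hs. lyapunov_sum TYPE('m) k f x0)
              = (INF (\<nu>, \<nu>')\<in>UNIV. C1 TYPE('m) f gs hs k \<nu> \<nu>'))"
proof (intro conjI impI allI, goal_cases)
  case (1 \<nu> \<nu>')
  then show ?case by (intro SUP_least lyapunov_sum_le_C1 assms)
next
  case 2
  let ?B = "semialgebraic_set gs hs"
  \<comment> \<open>A compact forward invariant set contains its trajectories, so the bound for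
    bounded trajectories gives one inequality for every pair of degrees.\<close>
  have "bounded_trajectories f ?B"
    unfolding bounded_trajectories_def
  proof (intro ballI allI impI)
    fix x0 T x assume "x0 \<in> ?B" "trajectory f x0 T x"
    then have "x ` {t. 0 \<le> t \<and> ereal t < T} \<subseteq> ?B"
      using assms(4) unfolding forward_invariant_def by auto
    then show "bounded (x ` {t. 0 \<le> t \<and> ereal t < T})"
      using 2 compact_imp_bounded bounded_subset by blast
  qed
  then have "(SUP x0\<in>?B. lyapunov_sum TYPE('m) k f x0) \<le> (INF (\<nu>, \<nu>')\<in>UNIV. C1 TYPE('m) f gs hs k \<nu> \<nu>')"
    by (auto intro!: INF_greatest SUP_least lyapunov_sum_le_C1 assms)
  \<comment> \<open>Comparing with real numbers above the supremum, instead of adding a small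
    constant to it, also covers infinite values such as the supremum over an empty set.\<close>
  moreover have "(INF (\<nu>, \<nu>')\<in>UNIV. C1 TYPE('m) f gs hs k \<nu> \<nu>') \<le> (SUP x0\<in>?B. lyapunov_sum TYPE('m) k f x0)"
  proof (rule dense_ge)
    fix c :: ereal assume less: "(SUP x0\<in>?B. lyapunov_sum TYPE('m) k f x0) < c"
    then obtain b where b: "(SUP x0\<in>?B. lyapunov_sum TYPE('m) k f x0) < ereal b" "ereal b < c"
      using ereal_dense2 by blast
    obtain \<nu> \<nu>' where "C1 TYPE('m) f gs hs k \<nu> \<nu>' \<le> ereal b"
      using C1_less[OF assms(1-4) _ _ b(1)] 2 by blast
    then have "(INF (\<nu>, \<nu>')\<in>UNIV. C1 TYPE('m) f gs hs k \<nu> \<nu>') \<le> ereal b"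
      by (intro INF_lower2[of "(\<nu>, \<nu>')"]) auto
    then show "(INF (\<nu>, \<nu>')\<in>UNIV. C1 TYPE('m) f gs hs k \<nu> \<nu>') \<le> c" using b(2) by simp
  qed
  ultimately show ?case by (rule antisym)
qed

end
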